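(* The problem \textsc{Adapt SR to Forced and Forbidden Pairs} can be solved in $\mathcal{O}(2^{|P\cap M_1|}\cdot n\cdot m)$ time, where $P$ is the given set of forbidden pairs, $M_1$ is the given stable matching, $2n$ is the number of agents, and $m$ is the number of mutually acceptable agent pairs.
   Context: Stable Roommates (SR): there is a set $A=\{a_1,\dots,a_{2n}\}$ of agents; each agent $a$ has a set $\mathrm{Ac}(a)\subseteq A\setminus\{a\}$ of acceptable agents, acceptability is symmetric, and each agent $a$ has a strict total order $\succ_a$ over $\mathrm{Ac}(a)$. "Pairs" are unordered 2-element subsets of $A$. A matching is a set of pairs of mutually acceptable agents such that each agent appears in at most one pair; $M(a)$ denotes the partner of $a$ in $M$. A pair $\{a,a'\}$ blocks $M$ if $a,a'$ are mutually acceptable, $a$ is unmatched or prefers $a'$ to $M(a)$, and $a'$ is unmatched or prefers $a$ to $M(a')$. A matching is stable if no pair blocks it. $M\triangle M'$ denotes the symmetric difference. \textsc{Adapt SR to Forced and Forbidden Pairs}: Input: a set $A$ of agents with strict preferences over each other, a stable matching $M_1$, a set of forced pairs $Q\subseteq\binom{A}{2}$, a set of forbidden pairs $P\subseteq\binom{A}{2}$, and an integer $k$. Question: is there a stable matching $M_2$ with $Q\subseteq M_2$, $M_2\cap P=\emptyset$, and $|M_1\triangle M_2|\le k$? *)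

theory Defs
  imports Main
begin

section \<open>Stable roommates\<close>

text \<open>\<open>Ac a\<close> is the set of agents acceptable to \<open>a\<close>, and \<open>(b, c) \<in> R a\<close> means that \<open>a\<close>
  strictly prefers \<open>b\<close> to \<open>c\<close>.\<close>

definition roommates :: "'a set \<Rightarrow> ('a \<Rightarrow> 'a set) \<Rightarrow> ('a \<Rightarrow> ('a \<times> 'a) set) \<Rightarrow> bool" where
  "roommates A Ac R \<longleftrightarrow>
     finite A \<and> even (card A) \<and>
     (\<forall>a\<in>A. Ac a \<subseteq> A - {a}) \<and>
     (\<forall>a\<in>A. \<forall>b\<in>A. b \<in> Ac a \<longleftrightarrow> a \<in> Ac b) \<and>
     (\<forall>a\<in>A. R a \<subseteq> Ac a \<times> Ac a \<and> strict_linear_order_on (Ac a) (R a))"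

definition pairs :: "'a set \<Rightarrow> 'a set set" where
  "pairs A = {e. e \<subseteq> A \<and> card e = 2}"

definition acceptable_pairs :: "'a set \<Rightarrow> ('a \<Rightarrow> 'a set) \<Rightarrow> 'a set set" where
  "acceptable_pairs A Ac = {{a, b} | a b. a \<in> A \<and> b \<in> A \<and> b \<in> Ac a \<and> a \<in> Ac b}"

definition matching :: "'a set \<Rightarrow> ('a \<Rightarrow> 'a set) \<Rightarrow> 'a set set \<Rightarrow> bool" where
  "matching A Ac M \<longleftrightarrow>
     M \<subseteq> acceptable_pairs A Ac \<and>
     (\<forall>a\<in>A. \<forall>e\<in>M. \<forall>e'\<in>M. a \<in> e \<and> a \<in> e' \<longrightarrow> e = e')"

definition matched :: "'a set set \<Rightarrow> 'a \<Rightarrow> bool" where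
  "matched M a \<longleftrightarrow> (\<exists>e\<in>M. a \<in> e)"

definition partner :: "'a set set \<Rightarrow> 'a \<Rightarrow> 'a" where
  "partner M a = (THE b. {a, b} \<in> M)"

definition blocks :: "'a set \<Rightarrow> ('a \<Rightarrow> 'a set) \<Rightarrow> ('a \<Rightarrow> ('a \<times> 'a) set) \<Rightarrow> 'a set set \<Rightarrow> 'a set \<Rightarrow> bool"
  where
  "blocks A Ac R M e \<longleftrightarrow>
     (\<exists>a\<in>A. \<exists>b\<in>A. e = {a, b} \<and> b \<in> Ac a \<and> a \<in> Ac b \<and>
        (\<not> matched M a \<or> (b, partner M a) \<in> R a) \<and>
        (\<not> matched M b \<or> (a, partner M b) \<in> R b))"

definition stable_matching ::
  "'a set \<Rightarrow> ('a \<Rightarrow> 'a set) \<Rightarrow> ('a \<Rightarrow> ('a \<times> 'a) set) \<Rightarrow> 'a set set \<Rightarrow> bool" where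
  "stable_matching A Ac R M \<longleftrightarrow> matching A Ac M \<and> (\<nexists>e. blocks A Ac R M e)"

definition adapt_SR_instance ::
  "'a set \<Rightarrow> ('a \<Rightarrow> 'a set) \<Rightarrow> ('a \<Rightarrow> ('a \<times> 'a) set) \<Rightarrow>
   'a set set \<Rightarrow> 'a set set \<Rightarrow> 'a set set \<Rightarrow> bool" where
  "adapt_SR_instance A Ac R M1 Q P \<longleftrightarrow>
     roommates A Ac R \<and> stable_matching A Ac R M1 \<and> Q \<subseteq> pairs A \<and> P \<subseteq> pairs A"

definition adapt_SR ::
  "'a set \<Rightarrow> ('a \<Rightarrow> 'a set) \<Rightarrow> ('a \<Rightarrow> ('a \<times> 'a) set) \<Rightarrow>
   'a set set \<Rightarrow> 'a set set \<Rightarrow> 'a set set \<Rightarrow> int \<Rightarrow> bool" where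
  "adapt_SR A Ac R M1 Q P k \<longleftrightarrow>
     (\<exists>M2. stable_matching A Ac R M2 \<and> Q \<subseteq> M2 \<and> M2 \<inter> P = {} \<and>
           int (card (sym_diff M1 M2)) \<le> k)"


section \<open>Machine model\<close>

text \<open>
  A structured random access machine: finitely many integer registers and finitely many
  two-dimensional integer arrays with random access, both addressed by name. Every node of an
  evaluated expression and every executed command costs one time unit.

  The only arithmetic operations are increment and decrement. Hence after \<open>t\<close> time units no
  value exceeds the largest initial or program constant by more than \<open>t\<close> in absolute value, and
  the unit cost measure cannot be abused by packing data into huge numbers. An access to a cell
  of an array is a constant number of operations of the usual word RAM (row index times row
  length plus column index).
\<close>

record machine =
  reg :: "string \<Rightarrow> int"
  arr :: "string \<Rightarrow> int \<Rightarrow> int \<Rightarrow> int"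

datatype aexp =
    Num int
  | Reg string
  | Cell string aexp aexp
  | Inc aexp
  | Dec aexp

datatype bexp =
    Less aexp aexp
  | Equal aexp aexp
  | Neg bexp
  | Conj bexp bexp

datatype com =
    Skip
  | Assign string aexp
  | Store string aexp aexp aexp
  | Seq com com
  | If bexp com com
  | While bexp com

fun aval :: "aexp \<Rightarrow> machine \<Rightarrow> int" where
  "aval (Num c) s = c"
| "aval (Reg x) s = reg s x"
| "aval (Cell x e1 e2) s = arr s x (aval e1 s) (aval e2 s)"
| "aval (Inc e) s = aval e s + 1"
| "aval (Dec e) s = aval e s - 1"

fun bval :: "bexp \<Rightarrow> machine \<Rightarrow> bool" where
  "bval (Less e1 e2) s \<longleftrightarrow> aval e1 s < aval e2 s"
| "bval (Equal e1 e2) s \<longleftrightarrow> aval e1 s = aval e2 s"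
| "bval (Neg b) s \<longleftrightarrow> \<not> bval b s"
| "bval (Conj b1 b2) s \<longleftrightarrow> bval b1 s \<and> bval b2 s"

fun acost :: "aexp \<Rightarrow> nat" where
  "acost (Num c) = 1"
| "acost (Reg x) = 1"
| "acost (Cell x e1 e2) = 1 + acost e1 + acost e2"
| "acost (Inc e) = 1 + acost e"
| "acost (Dec e) = 1 + acost e"

fun bcost :: "bexp \<Rightarrow> nat" where
  "bcost (Less e1 e2) = 1 + acost e1 + acost e2"
| "bcost (Equal e1 e2) = 1 + acost e1 + acost e2"
| "bcost (Neg b) = 1 + bcost b"
| "bcost (Conj b1 b2) = 1 + bcost b1 + bcost b2"

definition set_reg :: "string \<Rightarrow> int \<Rightarrow> machine \<Rightarrow> machine" where
  "set_reg x v s = s\<lparr>reg := (reg s)(x := v)\<rparr>"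

definition set_arr :: "string \<Rightarrow> int \<Rightarrow> int \<Rightarrow> int \<Rightarrow> machine \<Rightarrow> machine" where
  "set_arr x i j v s = s\<lparr>arr := (arr s)(x := (arr s x)(i := (arr s x i)(j := v)))\<rparr>"

text \<open>\<open>exec c s t s'\<close>: started in \<open>s\<close>, the program \<open>c\<close> terminates in \<open>s'\<close> after exactly \<open>t\<close>
  time units.\<close>

inductive exec :: "com \<Rightarrow> machine \<Rightarrow> nat \<Rightarrow> machine \<Rightarrow> bool" where
  Skip: "exec Skip s 1 s"
| Assign: "exec (Assign x e) s (1 + acost e) (set_reg x (aval e s) s)"
| Store: "exec (Store x e1 e2 e) s (1 + acost e1 + acost e2 + acost e)
            (set_arr x (aval e1 s) (aval e2 s) (aval e s) s)"
| Seq: "exec c1 s t1 s1 \<Longrightarrow> exec c2 s1 t2 s2 \<Longrightarrow> exec (Seq c1 c2) s (1 + t1 + t2) s2"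
| IfTrue: "bval b s \<Longrightarrow> exec c1 s t s' \<Longrightarrow> exec (If b c1 c2) s (1 + bcost b + t) s'"
| IfFalse: "\<not> bval b s \<Longrightarrow> exec c2 s t s' \<Longrightarrow> exec (If b c1 c2) s (1 + bcost b + t) s'"
| WhileFalse: "\<not> bval b s \<Longrightarrow> exec (While b c) s (1 + bcost b) s"
| WhileTrue: "bval b s \<Longrightarrow> exec c s t1 s1 \<Longrightarrow> exec (While b c) s1 t2 s2 \<Longrightarrow>
            exec (While b c) s (1 + bcost b + t1 + t2) s2"

inductive_cases SkipE: "exec Skip s t s'"
inductive_cases AssignE: "exec (Assign x e) s t s'"
inductive_cases StoreE: "exec (Store x e1 e2 e) s t s'"
inductive_cases SeqE: "exec (Seq c1 c2) s t s'"
inductive_cases IfE: "exec (If b c1 c2) s t s'"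
inductive_cases WhileE: "exec (While b c) s t s'"

lemma exec_deterministic:
  "exec c s t s' \<Longrightarrow> exec c s u s'' \<Longrightarrow> t = u \<and> s' = s''"
proof (induction arbitrary: u s'' rule: exec.induct)
  case (Skip s)
  then show ?case by (rule SkipE) simp
next
  case (Assign x e s)
  then show ?case by (rule AssignE) simp
next
  case (Store x e1 e2 e s)
  then show ?case by (rule StoreE) simp
next
  case (Seq c1 s t1 s1 c2 t2 s2)
  from Seq.prems show ?case by (rule SeqE) (auto dest!: Seq.IH)
next
  case (IfTrue b s c1 t s' c2)
  from IfTrue.prems show ?case by (rule IfE) (use IfTrue.hyps(1) in \<open>auto dest!: IfTrue.IH\<close>)
next
  case (IfFalse b s c2 t s' c1)
  from IfFalse.prems show ?case by (rule IfE) (use IfFalse.hyps(1) in \<open>auto dest!: IfFalse.IH\<close>)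
next
  case (WhileFalse b s c)
  from WhileFalse.prems show ?case by (rule WhileE) (use WhileFalse.hyps in simp_all)
next
  case (WhileTrue b s c t1 s1 t2 s2)
  from WhileTrue.prems show ?case by (rule WhileE) (use WhileTrue.hyps(1) in \<open>auto dest!: WhileTrue.IH\<close>)
qed


section \<open>Representation of instances in memory\<close>

text \<open>The agents are \<open>1, \<dots>, 2 * n\<close>, so that \<open>0\<close> can stand for ``no agent''.\<close>

definition represents_prefs ::
  "nat set \<Rightarrow> (nat \<Rightarrow> nat set) \<Rightarrow> (nat \<Rightarrow> (nat \<times> nat) set) \<Rightarrow> (nat \<Rightarrow> nat list) \<Rightarrow> bool" where
  "represents_prefs A Ac R prefs \<longleftrightarrow>
     (\<forall>a\<in>A. set (prefs a) = Ac a \<and> sorted_wrt (\<lambda>b c. (b, c) \<in> R a) (prefs a))"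

definition lists_pairs :: "nat set set \<Rightarrow> (nat \<times> nat) list \<Rightarrow> bool" where
  "lists_pairs S es \<longleftrightarrow>
     distinct (map (\<lambda>(a, b). {a, b}) es) \<and> set (map (\<lambda>(a, b). {a, b}) es) = S"

definition prefs_array :: "nat set \<Rightarrow> (nat \<Rightarrow> nat list) \<Rightarrow> int \<Rightarrow> int \<Rightarrow> int" where
  "prefs_array A prefs i j =
     (if 0 \<le> i \<and> nat i \<in> A then
        (let xs = prefs (nat i) in
         if j = 0 then int (length xs)
         else if 1 \<le> j \<and> j \<le> int (length xs) then int (xs ! (nat j - 1)) else 0)
      else 0)"

definition matching_array :: "nat set set \<Rightarrow> int \<Rightarrow> int \<Rightarrow> int" where
  "matching_array M i j =
     (if 0 \<le> i \<and> j = 0 \<and> matched M (nat i) then int (partner M (nat i)) else 0)"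

definition pair_list_array :: "(nat \<times> nat) list \<Rightarrow> int \<Rightarrow> int \<Rightarrow> int" where
  "pair_list_array es i j =
     (if 0 \<le> i \<and> i < int (length es) then
        (if j = 0 then int (fst (es ! nat i)) else if j = 1 then int (snd (es ! nat i)) else 0)
      else 0)"

definition pair_matrix :: "nat set set \<Rightarrow> int \<Rightarrow> int \<Rightarrow> int" where
  "pair_matrix S i j = (if 0 \<le> i \<and> 0 \<le> j \<and> {nat i, nat j} \<in> S then 1 else 0)"

text \<open>
  The sets \<open>Q\<close> and \<open>P\<close> need not consist of acceptable pairs, so they may contain far more than
  \<open>n * m\<close> pairs, and then neither a list nor an adjacency matrix alone would do: if \<open>{a, b}\<close> is
  the only acceptable pair, whether it belongs to \<open>P\<close> cannot be found out from an unsorted list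
  of \<open>P\<close> without reading that list; and whether \<open>Q \<subseteq> M\<close> cannot be found out from the matrix of
  \<open>Q\<close> without reading that matrix. Each of the two sets is therefore given in both forms. All
  registers and cells not used for the input are 0.
\<close>

definition initial_machine ::
  "nat \<Rightarrow> (nat \<Rightarrow> nat list) \<Rightarrow> nat set set \<Rightarrow> (nat \<times> nat) list \<Rightarrow> (nat \<times> nat) list \<Rightarrow>
   nat set set \<Rightarrow> nat set set \<Rightarrow> int \<Rightarrow> machine" where
  "initial_machine n prefs M1 qs ps Q P k =
     \<lparr> reg = (\<lambda>_. 0)(''n'' := int n, ''k'' := k,
                     ''q'' := int (length qs), ''p'' := int (length ps)),
       arr = (\<lambda>_ _ _. 0)(''pref'' := prefs_array {1..2 * n} prefs,
                         ''M1'' := matching_array M1,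
                         ''Qlist'' := pair_list_array qs,
                         ''Plist'' := pair_list_array ps,
                         ''Q'' := pair_matrix Q,
                         ''P'' := pair_matrix P) \<rparr>"

definition encodes ::
  "machine \<Rightarrow> nat \<Rightarrow> (nat \<Rightarrow> nat set) \<Rightarrow> (nat \<Rightarrow> (nat \<times> nat) set) \<Rightarrow>
   nat set set \<Rightarrow> nat set set \<Rightarrow> nat set set \<Rightarrow> int \<Rightarrow> bool" where
  "encodes s n Ac R M1 Q P k \<longleftrightarrow>
     (\<exists>prefs qs ps. represents_prefs {1..2 * n} Ac R prefs \<and>
        lists_pairs Q qs \<and> lists_pairs P ps \<and>
        s = initial_machine n prefs M1 qs ps Q P k)"

end

theory Submission
  imports Defs
begin

text \<open>
  Fix the given stable matching \<open>M1\<close>. An agent improves in another stable matching if it prefers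
  its new partner to its partner in \<open>M1\<close>, and worsens in the opposite case. In every pair of one
  stable matching that is missing in the other, exactly one of the two agents improves. For each
  pair in \<open>P \<inter> M1\<close> the algorithm guesses which one, which accounts for the factor
  \<open>2 ^ card (P \<inter> M1)\<close>.

  For a fixed guess all other changes are forced. Every agent \<open>a\<close> carries a proposal position
  \<open>pos a\<close>, starting at its partner in \<open>M1\<close> and moving down its list, and a barrier \<open>hold a\<close>: the
  worst rank that it may accept, lowered initially by the guess and by \<open>Q\<close>. An agent whose barrier
  excludes a proposal rejects it, the proposer moves on, and the new proposal lowers the barrier of
  its receiver, by one more if the pair is forbidden. Every solution that agrees with the guess
  assigns to each agent that has moved a rank no better than its position, and to each agent with a
  lowered barrier a rank no worse than its barrier. When nobody is rejected any more, positions and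
  barriers describe a matching; if there is a solution for the guess at all, this matching is one,
  and it changes only agents that every such solution changes. A final test makes the answer correct
  in all cases. There are at most \<open>2 * m\<close> rejections, and looking for the next one takes \<open>O(n)\<close> time.
\<close>

section \<open>Stable matchings as rank functions\<close>

text \<open>Only a forbidden pair contained in \<open>M1\<close> needs a guess: it must be broken,
  but nothing tells which end improves. Every other requirement carries its own direction. If
  \<open>a\<close> reaches a forbidden \<open>b\<close> by proposing, stability keeps
  \<open>b\<close> at least as well off as with \<open>a\<close>, and the ban makes it strictly
  better off; this is the extra one on the barrier. A forced pair lowers the barriers of both ends,
  which is no restriction for an end that worsens and is exactly the bound needed for an end that
  improves. The obstacle is that the process cannot recognise a guess without solution: proposers
  may run off their lists and barriers may sink below every rank. The invariant therefore bounds all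
  solutions agreeing with the guess, vacuously if there are none, and a candidate is read off and
  tested in any case. That bounds become a matching is a counting argument: between two stable
  matchings, the agents that improve and those that worsen are partners of each other in both, so
  two injections in opposite directions are bijections.\<close>

text \<open>
  The entry \<open>pr a j\<close> is the \<open>j\<close>-th agent on the list of \<open>a\<close>, counted from 1, and \<open>rk a b\<close> is the
  position of \<open>b\<close> on it. A matching is represented by the rank of each agent's partner. Being
  unmatched counts as the partner \<open>0\<close> at rank \<open>len a + 1\<close>, which makes blocking a comparison of ranks.
\<close>

locale sr_ranks =
  fixes N :: int and len :: "int \<Rightarrow> int" and pr rk :: "int \<Rightarrow> int \<Rightarrow> int"
  assumes len_nonneg: "a \<in> {1..N} \<Longrightarrow> 0 \<le> len a"
    and pr_mem: "a \<in> {1..N} \<Longrightarrow> j \<in> {1..len a} \<Longrightarrow> pr a j \<in> {1..N} - {a}"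
    and pr_end: "a \<in> {1..N} \<Longrightarrow> pr a (len a + 1) = 0"
    and rk_pr: "a \<in> {1..N} \<Longrightarrow> j \<in> {1..len a} \<Longrightarrow> rk a (pr a j) = j"
    and rk_sym: "a \<in> {1..N} \<Longrightarrow> j \<in> {1..len a} \<Longrightarrow> b = pr a j \<Longrightarrow>
                   rk b a \<in> {1..len b} \<and> pr b (rk b a) = a"
    and rk_none: "a \<in> {1..N} \<Longrightarrow> rk a 0 = len a + 1"
    and rk_zero: "rk 0 a = 0"
begin

section \<open>Stable rank functions and the comparison of two of them\<close>

definition acc :: "int \<Rightarrow> int \<Rightarrow> bool" where
  "acc a b \<longleftrightarrow> a \<in> {1..N} \<and> (\<exists>j\<in>{1..len a}. pr a j = b)"

definition stable :: "(int \<Rightarrow> int) \<Rightarrow> bool" where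
  "stable f \<longleftrightarrow>
     (\<forall>a\<in>{1..N}. f a \<in> {1..len a + 1}) \<and>
     (\<forall>a\<in>{1..N}. f a \<le> len a \<longrightarrow> f (pr a (f a)) = rk (pr a (f a)) a) \<and>
     (\<forall>a b. acc a b \<longrightarrow> \<not> (rk a b < f a \<and> rk b a < f b))"

lemma accD:
  assumes "acc a b"
  shows "a \<in> {1..N}" "b \<in> {1..N}" "a \<noteq> b" "acc b a" "rk a b \<in> {1..len a}" "pr a (rk a b) = b"
  using assms pr_mem rk_pr rk_sym unfolding acc_def by (blast, blast, blast, metis DiffD1, metis, metis)

lemma acc_pr: "a \<in> {1..N} \<Longrightarrow> j \<in> {1..len a} \<Longrightarrow> acc a (pr a j)"
  unfolding acc_def by blast

lemma stableD:
  assumes "stable f"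
  shows "a \<in> {1..N} \<Longrightarrow> 1 \<le> f a" "a \<in> {1..N} \<Longrightarrow> f a \<le> len a + 1"
    "a \<in> {1..N} \<Longrightarrow> f a \<le> len a \<Longrightarrow> f (pr a (f a)) = rk (pr a (f a)) a"
    "acc a b \<Longrightarrow> rk a b < f a \<Longrightarrow> rk b a < f b \<Longrightarrow> False"
  using assms unfolding stable_def by auto

lemma stable_partner:
  assumes "stable f" "a \<in> {1..N}" "f a \<le> len a" "b = pr a (f a)"
  shows "acc a b" "rk a b = f a" "f b = rk b a" "f b \<le> len b" "pr b (f b) = a" "b \<in> {1..N}"
proof -
  have j: "f a \<in> {1..len a}" using stableD(1)[OF assms(1,2)] assms(3) by simp
  show 1: "acc a b" using acc_pr[OF assms(2) j] assms(4) by simp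
  show 2: "rk a b = f a" using rk_pr[OF assms(2) j] assms(4) by simp
  show 3: "f b = rk b a" using stableD(3)[OF assms(1-3)] assms(4) by simp
  show "f b \<le> len b" "pr b (f b) = a" "b \<in> {1..N}"
    using 3 accD(5,6)[OF accD(4)[OF 1]] accD(2)[OF 1] by auto
qed

text \<open>Otherwise \<open>a\<close> and \<open>b\<close> would block \<open>r\<close>, since
  \<open>a\<close> ranks \<open>b\<close> above its partner in \<open>r\<close>. Equal ranks of
  \<open>b\<close> are excluded separately: they would make \<open>a\<close> the partner of
  \<open>b\<close> in \<open>r\<close> as well.\<close>

lemma partner_of_improver:
  assumes "stable r" "stable s" "a \<in> {1..N}" "s a < r a" "b = pr a (s a)"
  shows "r b < s b"
proof -
  have le: "s a \<le> len a" using assms(4) stableD(2)[OF assms(1,3)] by simp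
  note p = stable_partner[OF assms(2,3) le assms(5)]
  have "r b \<noteq> s b"
  proof
    assume eq: "r b = s b"
    have "r b \<le> len b" "a = pr b (r b)" using eq p by auto
    then have "r a = rk a b" using stable_partner(3)[OF assms(1) p(6)] by blast
    then show False using p(2) assms(4) by simp
  qed
  moreover have "\<not> rk b a < r b" using stableD(4)[OF assms(1) p(1)] p(2) assms(4) by auto
  ultimately show ?thesis using p(3) by simp
qed

text \<open>The partners under \<open>s\<close> of the agents preferring \<open>s\<close> prefer \<open>r\<close>, and the partners under
  \<open>r\<close> of the agents preferring \<open>r\<close> prefer \<open>s\<close>. These two injections between finite sets are
  therefore bijections, which determines the other two kinds of partners as well.\<close>

lemma partner_of_worsener:
  assumes "stable r" "stable s" "a \<in> {1..N}" "r a < s a"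
  shows "s a \<le> len a" "s (pr a (s a)) < r (pr a (s a))"
proof -
  define I where "I = {a \<in> {1..N}. s a < r a}"
  define W where "W = {a \<in> {1..N}. r a < s a}"
  have fin: "finite I" "finite W" unfolding I_def W_def by (auto intro: finite_subset[of _ "{1..N}"])
  have IL: "x \<in> {1..N}" "s x < r x" "s x \<le> len x" if "x \<in> I" for x
    using that stableD(2)[OF assms(1), of x] unfolding I_def by auto
  have WL: "x \<in> {1..N}" "r x < s x" "r x \<le> len x" if "x \<in> W" for x
    using that stableD(2)[OF assms(2), of x] unfolding W_def by auto
  have iI: "inj_on (\<lambda>x. pr x (s x)) I"
    by (rule inj_on_inverseI[where g = "\<lambda>x. pr x (s x)"])
       (use stable_partner(5)[OF assms(2)] IL in blast)
  have iW: "inj_on (\<lambda>x. pr x (r x)) W"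
    by (rule inj_on_inverseI[where g = "\<lambda>x. pr x (r x)"])
       (use stable_partner(5)[OF assms(1)] WL in blast)
  have sI: "(\<lambda>x. pr x (s x)) ` I \<subseteq> W"
  proof
    fix b assume "b \<in> (\<lambda>x. pr x (s x)) ` I"
    then obtain x where x: "x \<in> I" "b = pr x (s x)" by auto
    show "b \<in> W" using partner_of_improver[OF assms(1,2) IL(1,2)[OF x(1)] x(2)]
        stable_partner(6)[OF assms(2) IL(1,3)[OF x(1)] x(2)] unfolding W_def by auto
  qed
  have sW: "(\<lambda>x. pr x (r x)) ` W \<subseteq> I"
  proof
    fix b assume "b \<in> (\<lambda>x. pr x (r x)) ` W"
    then obtain x where x: "x \<in> W" "b = pr x (r x)" by auto
    show "b \<in> I" using partner_of_improver[OF assms(2,1) WL(1,2)[OF x(1)] x(2)]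
        stable_partner(6)[OF assms(1) WL(1,3)[OF x(1)] x(2)] unfolding I_def by auto
  qed
  have "card I = card W"
    using card_inj_on_le[OF iI sI fin(2)] card_inj_on_le[OF iW sW fin(1)] by simp
  then have "(\<lambda>x. pr x (s x)) ` I = W"
    using card_subset_eq[OF fin(2) sI] card_image[OF iI] by simp
  moreover have "a \<in> W" using assms unfolding W_def by simp
  ultimately obtain b where b: "b \<in> I" "a = pr b (s b)" by auto
  note p = stable_partner[OF assms(2) IL(1,3)[OF b(1)] b(2)]
  \<comment> \<open>An agent that is worse off is still matched, being the partner of an agent in
    \<open>I\<close>. Hence all stable matchings leave the same agents unmatched.\<close>
  show "s a \<le> len a" "s (pr a (s a)) < r (pr a (s a))" using p IL(2)[OF b(1)] by auto
qed

end

section \<open>Forced changes under a guess\<close>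

text \<open>Here \<open>r\<close> describes the given stable matching. The set \<open>G\<close> is a guess: for a forbidden pair
  of partners \<open>a < b\<close>, agent \<open>a\<close> has to improve if \<open>a \<in> G\<close>, and \<open>b\<close> has to improve otherwise.\<close>

locale adapt_ranks = sr_ranks +
  fixes r :: "int \<Rightarrow> int" and P Q :: "int \<Rightarrow> int \<Rightarrow> bool"
  assumes r: "stable r"
    and P_sym: "P a b \<Longrightarrow> P b a" and Q_sym: "Q a b \<Longrightarrow> Q b a"
    and P_zero: "\<not> P a 0" and P_irrefl: "\<not> P a a"
    and Q_mem: "Q a b \<Longrightarrow> a \<in> {1..N} \<and> b \<in> {1..N}"
begin

definition mate :: "int \<Rightarrow> int" where "mate a = pr a (r a)"

text \<open>One representative, the smaller agent, for each forbidden pair of the given matching.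
  The guesses are the subsets of \<open>F\<close>.\<close>

definition F :: "int set" where "F = {a \<in> {1..N}. a < mate a \<and> P a (mate a)}"

definition must_improve :: "int set \<Rightarrow> int \<Rightarrow> bool" where
  "must_improve G a \<longleftrightarrow> P a (mate a) \<and> (a < mate a \<and> a \<in> G \<or> mate a < a \<and> mate a \<notin> G)"

definition good :: "(int \<Rightarrow> int) \<Rightarrow> bool" where
  "good f \<longleftrightarrow> stable f \<and> (\<forall>a\<in>{1..N}. \<not> P a (pr a (f a))) \<and> (\<forall>a b. Q a b \<longrightarrow> b = pr a (f a))"

definition changed :: "(int \<Rightarrow> int) \<Rightarrow> int set" where
  "changed f = {a \<in> {1..N}. f a \<noteq> r a}"

text \<open>The three conditions make \<open>h a\<close> the minimum of the old rank, less one if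
  \<open>a\<close> has to improve, and the ranks of forced partners. The last one, that the minimum
  is attained, is what bounds the barrier from below in terms of a solution.\<close>

definition init_hold :: "int set \<Rightarrow> (int \<Rightarrow> int) \<Rightarrow> bool" where
  "init_hold G h \<longleftrightarrow> h 0 = 0 \<and> (\<forall>a\<in>{1..N}.
     h a \<le> r a - of_bool (must_improve G a) \<and>
     (\<forall>j\<in>{1..len a}. Q a (pr a j) \<longrightarrow> h a \<le> j) \<and>
     (h a = r a - of_bool (must_improve G a) \<or> (\<exists>j\<in>{1..len a}. Q a (pr a j) \<and> h a = j)))"

text \<open>A proposer at the end of its list needs no special case: its target is the dummy agent
  \<open>0\<close>, whose ranks and barrier are both \<open>0\<close>, so it counts as
  content.\<close>

definition content :: "(int \<Rightarrow> int) \<Rightarrow> (int \<Rightarrow> int) \<Rightarrow> int \<Rightarrow> bool" where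
  "content pos hold a \<longleftrightarrow> rk (pr a (pos a)) a \<le> hold (pr a (pos a))"

text \<open>If the guess admits a solution, an agent still at its starting position either kept its
  partner, its barrier being \<open>r a\<close>, or improves, and then the barrier is the rank of
  the proposal it holds.\<close>

definition outcome :: "(int \<Rightarrow> int) \<Rightarrow> (int \<Rightarrow> int) \<Rightarrow> int \<Rightarrow> int" where
  "outcome pos hold a = (if pos a = r a then hold a else pos a)"

text \<open>The last conjunct compares with an arbitrary solution that agrees with the guess; the others
  make the final outcome stable and free of forbidden pairs.\<close>

definition propose_inv :: "int set \<Rightarrow> (int \<Rightarrow> int) \<Rightarrow> (int \<Rightarrow> int) \<Rightarrow> bool" where
  "propose_inv G pos hold \<longleftrightarrow> hold 0 = 0 \<and>
     (\<forall>a\<in>{1..N}. r a \<le> pos a \<and> pos a \<le> len a + 1 \<and>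
        hold a \<le> r a - of_bool (must_improve G a) \<and>
        (\<forall>j\<in>{1..len a}. Q a (pr a j) \<longrightarrow> hold a \<le> j) \<and>
        (\<forall>j. r a < j \<longrightarrow> j \<le> pos a \<longrightarrow>
           hold (pr a j) \<le> rk (pr a j) a - of_bool (P a (pr a j)))) \<and>
     (\<forall>s. good s \<longrightarrow> G = {a \<in> F. s a < r a} \<longrightarrow>
        (\<forall>a\<in>{1..N}. pos a \<le> max (r a) (s a) \<and> min (r a) (s a) \<le> hold a))"

section \<open>Bounds on all solutions, maintained along the proposals\<close>

lemma goodD:
  assumes "good f"
  shows "stable f" "a \<in> {1..N} \<Longrightarrow> \<not> P a (pr a (f a))" "Q a b \<Longrightarrow> b = pr a (f a)"
  using assms unfolding good_def by auto

lemma mate_props: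
  assumes "a \<in> {1..N}" "r a \<le> len a"
  shows "acc a (mate a)" "mate (mate a) = a" "mate a \<in> {1..N}"
    "rk a (mate a) = r a" "rk (mate a) a = r (mate a)" "r (mate a) \<le> len (mate a)"
  using stable_partner[OF r assms refl] unfolding mate_def by auto

lemma unmatched_r: "a \<in> {1..N} \<Longrightarrow> \<not> r a \<le> len a \<Longrightarrow> r a = len a + 1 \<and> mate a = 0"
proof -
  assume a: "a \<in> {1..N}" "\<not> r a \<le> len a"
  then have "r a = len a + 1" using stableD(2)[OF r a(1)] by simp
  then show ?thesis using pr_end[OF a(1)] unfolding mate_def by simp
qed

lemma P_mate_matched: "a \<in> {1..N} \<Longrightarrow> P a (mate a) \<Longrightarrow> r a \<le> len a"
  using unmatched_r P_zero by fastforce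

text \<open>The point is the lower bound \<open>min (r a) (s a) \<le> h a\<close>. If the barrier
  comes from the guess, a solution must break the forbidden pair, and \<open>a\<close> cannot
  worsen, because then its partner would improve against the recorded direction. If it comes from
  \<open>Q\<close>, the forced rank is \<open>s a\<close> itself.\<close>

lemma init_propose_inv:
  assumes "init_hold G h" "\<And>a. a \<in> {1..N} \<Longrightarrow> pos a = r a"
  shows "propose_inv G pos h"
proof -
  have lower: "min (r a) (s a) \<le> h a" if s: "good s" and G: "G = {a \<in> F. s a < r a}" and a: "a \<in> {1..N}" for s a
  proof -
    consider "h a = r a - of_bool (must_improve G a)" | j where "j \<in> {1..len a}" "Q a (pr a j)" "h a = j"
      using assms(1) a unfolding init_hold_def by blast
    then show ?thesis
    proof cases
      case 1
      show ?thesis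
      proof (cases "must_improve G a")
        case True
        then have Pa: "P a (mate a)" and ch: "a < mate a \<and> a \<in> G \<or> mate a < a \<and> mate a \<notin> G"
          unfolding must_improve_def by auto
        note m = mate_props[OF a P_mate_matched[OF a Pa]]
        have sr: "s a \<noteq> r a" using goodD(2)[OF s a] Pa unfolding mate_def by auto
        have "s a < r a"
        proof (rule ccontr)
          assume "\<not> s a < r a"
          then have w: "r a < s a" using sr by simp
          have "s (mate a) < r (mate a)"
            using partner_of_improver[OF goodD(1)[OF s] r a w] unfolding mate_def by simp
          moreover have "a \<notin> G" using w G by auto
          moreover have "mate a \<in> F" if "mate a < a"
            using that P_sym[OF Pa] m(2,3) unfolding F_def by simp
          ultimately show False using ch G by blast
        qed
        then show ?thesis using 1 True by simp
      qed (use 1 in simp)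
    next
      case 2
      have eq: "pr a j = pr a (s a)" using goodD(3)[OF s 2(2)] .
      have "s a \<le> len a"
      proof (rule ccontr)
        assume "\<not> ?thesis"
        then have "s a = len a + 1" using stableD(2)[OF goodD(1)[OF s] a] by simp
        then show False using eq pr_end[OF a] pr_mem[OF a 2(1)] by simp
      qed
      then have "s a \<in> {1..len a}" using stableD(1)[OF goodD(1)[OF s] a] by simp
      then have "rk a (pr a (s a)) = s a" by (rule rk_pr[OF a])
      then have "s a = j" using rk_pr[OF a 2(1)] unfolding eq by (rule subst)
      then show ?thesis using 2 by simp
    qed
  qed
  show ?thesis unfolding propose_inv_def
  proof (intro conjI ballI allI impI)
    show "h 0 = 0" using assms(1) unfolding init_hold_def by simp
  next
    fix a assume a: "a \<in> {1..N}"
    note h = assms(1)[unfolded init_hold_def, THEN conjunct2, THEN bspec, OF a]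
    show "r a \<le> pos a" "pos a \<le> len a + 1" using assms(2)[OF a] stableD(2)[OF r a] by auto
    show "h a \<le> r a - of_bool (must_improve G a)" using h by (rule conjunct1)
    show "h a \<le> j" if "j \<in> {1..len a}" "Q a (pr a j)" for j
      using h[THEN conjunct2, THEN conjunct1] that by blast
    show "h (pr a j) \<le> rk (pr a j) a - of_bool (P a (pr a j))" if "r a < j" "j \<le> pos a" for j
      using that assms(2)[OF a] by simp
  next
    fix s a assume s: "good s" "G = {a \<in> F. s a < r a}" and a: "a \<in> {1..N}"
    show "pos a \<le> max (r a) (s a)" using assms(2)[OF a] by simp
    show "min (r a) (s a) \<le> h a" using lower[OF s a] .
  qed
qed

text \<open>A rejection is forced: no solution agreeing with the guess lets \<open>a\<close> stay,
  so every one has rank at least \<open>pos a + 1\<close> for \<open>a\<close>. The next agent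
  \<open>b\<close> then gets either \<open>a\<close>, if that is allowed, or something better by
  stability, which justifies its new barrier. That only an agent inside its list is rejected bounds
  the number of steps.\<close>

lemma propose_inv_step:
  assumes inv: "propose_inv G pos hold" and a: "a \<in> {1..N}" and nc: "\<not> content pos hold a"
    and b: "b = pr a (pos a + 1)" and pos': "pos' = pos(a := pos a + 1)"
    and hold': "hold' = hold(b := min (hold b) (rk b a - of_bool (P a b)))"
  shows "propose_inv G pos' hold'" "pos a \<le> len a"
proof -
  define c where "c = pr a (pos a)"
  have inv0: "hold 0 = 0"
    and inv1: "\<And>a. a \<in> {1..N} \<Longrightarrow> r a \<le> pos a \<and> pos a \<le> len a + 1 \<and>
        hold a \<le> r a - of_bool (must_improve G a) \<and>
        (\<forall>j\<in>{1..len a}. Q a (pr a j) \<longrightarrow> hold a \<le> j) \<and>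
        (\<forall>j. r a < j \<longrightarrow> j \<le> pos a \<longrightarrow>
           hold (pr a j) \<le> rk (pr a j) a - of_bool (P a (pr a j)))"
    and inv2: "\<And>s a. good s \<Longrightarrow> G = {a \<in> F. s a < r a} \<Longrightarrow> a \<in> {1..N} \<Longrightarrow>
        pos a \<le> max (r a) (s a) \<and> min (r a) (s a) \<le> hold a"
    using inv unfolding propose_inv_def by auto
  have hc: "hold c < rk c a" using nc unfolding content_def c_def by simp
  \<comment> \<open>The dummy agent never rejects, as its rank of any proposer and its barrier are
    both \<open>0\<close>.\<close>
  then have "c \<noteq> 0" using inv0 rk_zero by auto
  have "pos a \<noteq> len a + 1" using \<open>c \<noteq> 0\<close> pr_end[OF a] unfolding c_def by auto
  then show le: "pos a \<le> len a" using inv1[OF a] by linarith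
  have pa: "pos a \<in> {1..len a}" using le inv1[OF a] stableD(1)[OF r a] by simp
  have ac: "acc a c" using acc_pr[OF a pa] c_def by simp
  have rkac: "rk a c = pos a" using rk_pr[OF a pa] c_def by simp
  \<comment> \<open>The move may lead off the list, to the dummy agent; \<open>key\<close> shows
    that this cannot happen if a solution exists.\<close>
  have b_cases: "b = 0 \<or> acc a b \<and> rk a b = pos a + 1"
  proof (cases "pos a + 1 \<le> len a")
    case True
    then have "pos a + 1 \<in> {1..len a}" using pa by simp
    then show ?thesis using acc_pr[OF a] rk_pr[OF a] b by blast
  next
    case False
    then have "pos a + 1 = len a + 1" using le by simp
    then show ?thesis using pr_end[OF a] b by simp
  qed
  have hold0: "hold' 0 = 0" using hold' inv0 rk_zero P_zero by simp
  have hold_le: "hold' x \<le> hold x" for x using hold' by simp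
  have hold_b: "hold' b \<le> rk b a - of_bool (P a b)" using hold' by simp
  have key: "pos a + 1 \<le> s a" "b \<noteq> 0" "s b \<le> rk b a - of_bool (P a b)"
    if s: "good s" and G: "G = {a \<in> F. s a < r a}" for s
  proof -
    note i2 = inv2[OF s G] and st = goodD(1)[OF s]
    have cN: "c \<in> {1..N}" using accD(2)[OF ac] .
    show *: "pos a + 1 \<le> s a"
    proof (cases "pos a = r a")
      case True
      \<comment> \<open>At the starting position the rejecting agent is the old partner. Its barrier
        lies below its own old rank, so it improves in \<open>s\<close>.\<close>
      have cm: "c = mate a" using True unfolding c_def mate_def by simp
      have ra: "r a \<le> len a" using le True by simp
      note m = mate_props[OF a ra]
      have "hold c < r c" using hc cm m(5) by simp
      then have sc: "s c < r c" using i2[OF cN] by auto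
      have c: "c \<in> {1..N}" "c = pr a (r a)" using cN cm unfolding mate_def by auto
      have "s a \<noteq> r a"
      proof
        assume eq: "s a = r a"
        then have "s c = rk c a" using stableD(3)[OF st a] ra c(2) by simp
        then show False using sc m(5) cm by simp
      qed
      moreover have "\<not> s a < r a"
      proof
        assume "s a < r a"
        \<comment> \<open>The comparison is used with the roles of \<open>r\<close> and
          \<open>s\<close> exchanged: \<open>c\<close> improves in \<open>s\<close>, so its partner
          in \<open>r\<close> is worse off in \<open>s\<close>. Two old partners never both
          improve.\<close>
        have "s (mate (mate a)) > r (mate (mate a))"
          using partner_of_worsener(2)[OF st r c(1) sc] cm unfolding mate_def by simp
        then show False using \<open>s a < r a\<close> m(2) by simp
      qed
      ultimately show ?thesis using True by simp
    next
      case False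
      then have gt: "r a < pos a" using inv1[OF a] by simp
      then have ge: "pos a \<le> s a" using i2[OF a] by auto
      \<comment> \<open>If \<open>c\<close> were the partner in \<open>s\<close>, it would improve
        because \<open>a\<close> worsens, but its rank \<open>rk c a\<close> lies beyond the barrier
        that every solution respects.\<close>
      have "s a \<noteq> pos a"
      proof
        assume eq: "s a = pos a"
        have "s c = rk c a" using stableD(3)[OF st a] eq le c_def by simp
        moreover have "s c < r c"
          using partner_of_worsener(2)[OF r st a] gt eq c_def by simp
        ultimately show False using i2[OF cN] hc by auto
      qed
      then show ?thesis using ge by simp
    qed
    have wor: "r a < s a" using * inv1[OF a] by simp
    have sl: "s a \<le> len a" using partner_of_worsener(1)[OF r st a wor] .
    then have "pos a + 1 \<in> {1..len a}" using * pa by simp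
    then show b0: "b \<noteq> 0" using pr_mem[OF a, of "pos a + 1"] b by auto
    then have ab: "acc a b" "rk a b = pos a + 1" using b_cases by auto
    show "s b \<le> rk b a - of_bool (P a b)"
    proof (cases "s a = pos a + 1")
      case True
      have "s b = rk b a" using stableD(3)[OF st a sl] b True by simp
      moreover have "\<not> P a b" using goodD(2)[OF s a] b True by simp
      ultimately show ?thesis by simp
    next
      case False
      \<comment> \<open>Here \<open>a\<close> prefers \<open>b\<close> to its partner in
        \<open>s\<close>, so stability gives \<open>b\<close> a rank no worse than that of
        \<open>a\<close>.\<close>
      have "\<not> rk b a < s b" using stableD(4)[OF st ab(1)] ab(2) * False by auto
      moreover have "s b \<noteq> rk b a"
      proof
        assume eq: "s b = rk b a"
        have bN: "b \<in> {1..N}" using accD(2)[OF ab(1)] .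
        have "s b \<le> len b" "a = pr b (s b)" using eq accD(5,6)[OF accD(4)[OF ab(1)]] by auto
        then have "s a = rk a b" using stable_partner(3)[OF st bN] by blast
        then show False using ab(2) False by simp
      qed
      \<comment> \<open>Strictness between integers provides the additional one in case the pair is
        forbidden.\<close>
      ultimately show ?thesis by (simp add: of_bool_def)
    qed
  qed
  have part2: "pos' x \<le> max (r x) (s x) \<and> min (r x) (s x) \<le> hold' x"
    if "good s" "G = {a \<in> F. s a < r a}" "x \<in> {1..N}" for s x
  proof
    note i2 = inv2[OF that] and k = key[OF that(1,2)]
    show "pos' x \<le> max (r x) (s x)" using i2 k(1) unfolding pos' by (cases "x = a") auto
    show "min (r x) (s x) \<le> hold' x"
    proof (cases "x = b")
      case True
      have "s b \<le> rk b a - of_bool (P a b)" using k(3) .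
      then show ?thesis using i2 True unfolding hold' by (simp add: min_le_iff_disj)
    qed (use i2 hold' in simp)
  qed
  have part1: "r x \<le> pos' x \<and> pos' x \<le> len x + 1 \<and>
        hold' x \<le> r x - of_bool (must_improve G x) \<and>
        (\<forall>j\<in>{1..len x}. Q x (pr x j) \<longrightarrow> hold' x \<le> j) \<and>
        (\<forall>j. r x < j \<longrightarrow> j \<le> pos' x \<longrightarrow>
           hold' (pr x j) \<le> rk (pr x j) x - of_bool (P x (pr x j)))" if x: "x \<in> {1..N}" for x
  proof (intro conjI ballI allI impI)
    show "r x \<le> pos' x" "pos' x \<le> len x + 1" using inv1[OF x] le unfolding pos' by auto
    show "hold' x \<le> r x - of_bool (must_improve G x)" using inv1[OF x] hold_le[of x] by linarith
    show "hold' x \<le> j" if "j \<in> {1..len x}" "Q x (pr x j)" for j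
      using inv1[OF x] hold_le[of x] that by (meson order_trans)
    show "hold' (pr x j) \<le> rk (pr x j) x - of_bool (P x (pr x j))" if j: "r x < j" "j \<le> pos' x" for j
    proof (cases "x = a \<and> j = pos a + 1")
      case True
      then show ?thesis using hold_b b by simp
    next
      case False
      then have "j \<le> pos x" using j unfolding pos' by (auto split: if_splits)
      then have "hold (pr x j) \<le> rk (pr x j) x - of_bool (P x (pr x j))" using inv1[OF x] j(1) by simp
      then show ?thesis using hold_le[of "pr x j"] by linarith
    qed
  qed
  show "propose_inv G pos' hold'" unfolding propose_inv_def
    using hold0 part1 part2 by blast
qed

text \<open>The solution \<open>s\<close> shows that the agents \<open>W\<close> that moved worsen
  and the agents \<open>I\<close> with a lowered barrier improve. Proposals map \<open>W\<close>
  injectively into \<open>I\<close>, and old partners map \<open>I\<close> injectively into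
  \<open>W\<close>. Both maps are therefore bijections, so positions and barriers fit together into
  partners. Blocking pairs of the outcome are excluded by those of \<open>r\<close>, those of
  \<open>s\<close>, and the proposals already made.\<close>

lemma outcome_good:
  assumes inv: "propose_inv G pos hold" and fin: "\<And>a. a \<in> {1..N} \<Longrightarrow> content pos hold a"
    and s: "good s" and G: "G = {a \<in> F. s a < r a}"
  shows "good (outcome pos hold)" "changed (outcome pos hold) \<subseteq> changed s"
proof -
  let ?f = "outcome pos hold"
  define W where "W = {a \<in> {1..N}. r a < pos a}"
  define I where "I = {a \<in> {1..N}. hold a < r a}"
  have st: "stable s" using goodD(1)[OF s] .
  have inv0: "hold 0 = 0"
    and inv1: "\<And>a. a \<in> {1..N} \<Longrightarrow> r a \<le> pos a \<and> pos a \<le> len a + 1 \<and>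
        hold a \<le> r a - of_bool (must_improve G a) \<and>
        (\<forall>j\<in>{1..len a}. Q a (pr a j) \<longrightarrow> hold a \<le> j) \<and>
        (\<forall>j. r a < j \<longrightarrow> j \<le> pos a \<longrightarrow>
           hold (pr a j) \<le> rk (pr a j) a - of_bool (P a (pr a j)))"
    and inv2: "\<And>a. a \<in> {1..N} \<Longrightarrow> pos a \<le> max (r a) (s a) \<and> min (r a) (s a) \<le> hold a"
    using inv s G unfolding propose_inv_def by auto
  have hr: "hold x \<le> r x" if "x \<in> {1..N}" for x using inv1[OF that] by (auto simp: of_bool_def split: if_splits)
  have W: "x \<in> {1..N}" "r x < pos x" "pos x \<le> s x" "r x < s x" "s x \<le> len x" "hold x = r x" "?f x = pos x"
    if "x \<in> W" for x
  proof -
    show x: "x \<in> {1..N}" "r x < pos x" using that unfolding W_def by auto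
    show p: "pos x \<le> s x" using inv2[OF x(1)] x(2) by auto
    then show w: "r x < s x" using x by simp
    show "s x \<le> len x" using partner_of_worsener(1)[OF r st x(1) w] .
    show "hold x = r x" using hr[OF x(1)] inv2[OF x(1)] w by auto
    show "?f x = pos x" using x unfolding outcome_def by simp
  qed
  have I: "x \<in> {1..N}" "hold x < r x" "s x \<le> hold x" "s x < r x" "r x \<le> len x" "pos x = r x" "?f x = hold x"
    if "x \<in> I" for x
  proof -
    show x: "x \<in> {1..N}" "hold x < r x" using that unfolding I_def by auto
    show p: "s x \<le> hold x" using inv2[OF x(1)] x(2) by auto
    then show w: "s x < r x" using x by simp
    show "r x \<le> len x" using partner_of_worsener(1)[OF st r x(1) w] .
    show "pos x = r x" using inv1[OF x(1)] inv2[OF x(1)] w by auto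
    then show "?f x = hold x" unfolding outcome_def by simp
  qed
  have same: "?f x = r x" "hold x = r x" "pos x = r x" if "x \<in> {1..N}" "x \<notin> W" "x \<notin> I" for x
    using that hr[OF that(1)] inv1[OF that(1)] unfolding W_def I_def outcome_def by auto
  have notW: "?f x = hold x" if "x \<in> {1..N}" "x \<notin> W" for x
    using that inv1[OF that(1)] unfolding W_def outcome_def by auto
  have WtoI: "pr x (pos x) \<in> I" "hold (pr x (pos x)) = rk (pr x (pos x)) x" "\<not> P x (pr x (pos x))"
     "acc x (pr x (pos x))" "rk x (pr x (pos x)) = pos x" if x: "x \<in> W" for x
  proof -
    define b where "b = pr x (pos x)"
    note w = W[OF x]
    have j: "pos x \<in> {1..len x}" using w stableD(1)[OF r w(1)] by auto
    have ac: "acc x b" "rk x b = pos x" using acc_pr[OF w(1) j] rk_pr[OF w(1) j] b_def by auto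
    then show "acc x (pr x (pos x))" "rk x (pr x (pos x)) = pos x" using b_def by auto
    have "hold b \<le> rk b x - of_bool (P x b)" using inv1[OF w(1)] w(2) b_def by auto
    moreover have "rk b x \<le> hold b" using fin[OF w(1)] unfolding content_def b_def by simp
    \<comment> \<open>The invariant bounds the barrier from above and contentment bounds it from
      below, leaving no room for the extra one of a forbidden pair.\<close>
    ultimately have h: "hold b = rk b x" "\<not> P x b" by (auto simp: of_bool_def split: if_splits)
    then show "hold (pr x (pos x)) = rk (pr x (pos x)) x" "\<not> P x (pr x (pos x))" using b_def by auto
    have bN: "b \<in> {1..N}" using accD(2)[OF ac(1)] .
    \<comment> \<open>Otherwise \<open>b\<close> would be the old partner of \<open>x\<close> and
      sit at rank \<open>r x\<close>, whereas \<open>x\<close> has moved beyond it.\<close>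
    have "r b \<noteq> rk b x"
    proof
      assume eq: "r b = rk b x"
      have "r b \<le> len b" "x = pr b (r b)" using eq accD(5,6)[OF accD(4)[OF ac(1)]] by auto
      then have "r x = rk x b" using stable_partner(3)[OF r bN] by blast
      then show False using ac(2) w(2) by simp
    qed
    then have "hold b < r b" using hr[OF bN] h(1) by simp
    then show "pr x (pos x) \<in> I" using bN unfolding I_def b_def by simp
  qed
  have ItoW: "mate x \<in> W" if x: "x \<in> I" for x
  proof -
    note i = I[OF x]
    note m = mate_props[OF i(1,5)]
    \<comment> \<open>An unmoved old partner would still propose to \<open>x\<close> at rank
      \<open>r x\<close>; the lowered barrier excludes this, contrary to contentment.\<close>
    have "\<not> pos (mate x) = r (mate x)"
    proof
      assume "pos (mate x) = r (mate x)"
      then have "pr (mate x) (pos (mate x)) = x" using m(2) unfolding mate_def by simp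
      then have "rk x (mate x) \<le> hold x" using fin[OF m(3)] unfolding content_def by simp
      then show False using m(4) i(2) by simp
    qed
    then show ?thesis using inv1[OF m(3)] m(3) unfolding W_def by auto
  qed
  have fins: "finite I" "finite W" unfolding I_def W_def by (auto intro: finite_subset[of _ "{1..N}"])
  let ?g = "\<lambda>x. pr x (pos x)"
  have inj: "inj_on ?g W"
  proof (rule inj_on_inverseI[where g = "\<lambda>x. pr x (hold x)"])
    fix x assume x: "x \<in> W"
    show "pr (?g x) (hold (?g x)) = x"
      using WtoI(2)[OF x] accD(6)[OF accD(4)[OF WtoI(4)[OF x]]] by simp
  qed
  have injm: "inj_on mate I"
    by (rule inj_on_inverseI[where g = mate]) (use mate_props(2)[OF I(1) I(5)] in blast)
  have gW: "?g ` W \<subseteq> I" and mI: "mate ` I \<subseteq> W" using WtoI(1) ItoW by auto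
  have cards: "card I = card W"
    using card_inj_on_le[OF injm mI fins(2)] card_inj_on_le[OF inj gW fins(1)] by simp
  \<comment> \<open>Surjectivity turns barriers into ranks: every agent of \<open>I\<close> holds a
    proposal at exactly its barrier, even where the barrier was first lowered by the guess or by
    \<open>Q\<close>.\<close>
  have "?g ` W = I" using card_subset_eq[OF fins(1) gW] card_image[OF inj] cards by simp
  then have IobtW: "\<exists>w\<in>W. x = pr w (pos w)" if "x \<in> I" for x using that by blast
  have Iprops: "acc x (pr x (?f x))" "pr x (?f x) \<in> W" "?f (pr x (?f x)) = rk (pr x (?f x)) x"
    "pr (pr x (?f x)) (?f (pr x (?f x))) = x" if x: "x \<in> I" for x
  proof -
    obtain w where w: "w \<in> W" "x = pr w (pos w)" using IobtW[OF x] by auto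
    have "?f x = rk x w" using I(7)[OF x] WtoI(2)[OF w(1)] w(2) by simp
    then have p: "pr x (?f x) = w" using accD(6)[OF accD(4)[OF WtoI(4)[OF w(1)]]] w(2) by simp
    then show "pr x (?f x) \<in> W" "acc x (pr x (?f x))" "?f (pr x (?f x)) = rk (pr x (?f x)) x"
      using w WtoI(5)[OF w(1)] W(7)[OF w(1)] accD(4)[OF WtoI(4)[OF w(1)]] by auto
    show "pr (pr x (?f x)) (?f (pr x (?f x))) = x" using p w W(7)[OF w(1)] by simp
  qed
  have Wprops: "?f (pr x (?f x)) = rk (pr x (?f x)) x" "pr x (?f x) \<in> I" if x: "x \<in> W" for x
    using WtoI(1,2)[OF x] W(7)[OF x] I(7)[OF WtoI(1)[OF x]] by auto
  have I_range: "1 \<le> ?f x \<and> ?f x \<le> len x" if x: "x \<in> I" for x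
    using I[OF x] stableD(1)[OF st I(1)[OF x]] by simp
  have W_range: "1 \<le> ?f x \<and> ?f x \<le> len x" if x: "x \<in> W" for x
    using W[OF x] stableD(1)[OF r W(1)[OF x]] by simp
  have disj: "x \<notin> I" if "x \<in> W" for x using W(4)[OF that] I(4)[of x] by auto
  have same_partner: "?f (pr x (?f x)) = rk (pr x (?f x)) x"
    if x: "x \<in> {1..N}" "x \<notin> W" "x \<notin> I" "?f x \<le> len x" for x
  proof -
    have rx: "r x \<le> len x" using same(1)[OF x(1-3)] x(4) by simp
    note m = mate_props[OF x(1) rx]
    have "mate x \<notin> I" using ItoW[of "mate x"] m(2) x(2) by auto
    \<comment> \<open>By the equal cardinalities \<open>mate\<close> maps \<open>I\<close> onto
      \<open>W\<close>, so a partner in \<open>W\<close> would put \<open>x\<close> into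
      \<open>I\<close>.\<close>
    moreover have "mate x \<notin> W"
    proof
      assume w: "mate x \<in> W"
      have "mate ` I = W"
        using card_subset_eq[OF fins(2) mI] card_image[OF injm] cards by simp
      then have "mate x \<in> mate ` I" using w by simp
      then obtain y where y: "y \<in> I" "mate x = mate y" by (rule imageE)
      have "x = mate (mate y)" using m(2)[symmetric] unfolding y(2) .
      also have "\<dots> = y" using mate_props(2)[OF I(1)[OF y(1)] I(5)[OF y(1)]] .
      finally have "x = y" .
      then show False using y(1) x(3) by simp
    qed
    ultimately have "?f (mate x) = r (mate x)" using same(1)[OF m(3)] by simp
    then show ?thesis using same(1)[OF x(1-3)] m(5) unfolding mate_def by simp
  qed
  have "stable ?f" unfolding stable_def
  proof (intro conjI ballI allI impI notI)
    fix x assume x: "x \<in> {1..N}"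
    show "?f x \<in> {1..len x + 1}"
      using I_range[of x] W_range[of x] same(1)[OF x] stableD(1)[OF r x] stableD(2)[OF r x]
      by (cases "x \<in> W"; cases "x \<in> I") auto
    show "?f (pr x (?f x)) = rk (pr x (?f x)) x" if "?f x \<le> len x"
      using Wprops(1)[of x] Iprops(3)[of x] same_partner[OF x _ _ that] by blast
  next
    fix a b assume ab: "acc a b" "rk a b < ?f a \<and> rk b a < ?f b"
    \<comment> \<open>Positions of movers are no worse than their ranks in \<open>s\<close>, so two
      movers would block \<open>s\<close>.\<close>
    have WW: False if "a \<in> W" "b \<in> W" "acc a b" "rk a b < ?f a" "rk b a < ?f b" for a b
      using stableD(4)[OF st that(3)] that W(3)[OF that(1)] W(7)[OF that(1)] W(3)[OF that(2)] W(7)[OF that(2)] by simp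
    \<comment> \<open>For a mover \<open>a\<close> there are three places for \<open>b\<close>:
      above the old partner the pair would block \<open>r\<close>; the old partner itself has a
      barrier no worse than its old rank; and an agent passed on the way down has its barrier
      lowered by the proposal of \<open>a\<close>.\<close>
    have WN: False if h: "a \<in> W" "b \<notin> W" "acc a b" "rk a b < ?f a" "rk b a < ?f b" for a b
    proof -
      note ac = accD[OF h(3)]
      have fb: "?f b = hold b" using notW[OF ac(2) h(2)] .
      have fa: "?f a = pos a" using W(7)[OF h(1)] .
      consider "rk a b < r a" | "rk a b = r a" | "r a < rk a b" by linarith
      then show False
      proof cases
        case 1
        then show False using stableD(4)[OF r h(3)] h(5) fb hr[OF ac(2)] by simp
      next
        case 2
        then have "r a \<le> len a" "b = mate a" using ac(5,6) unfolding mate_def by auto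
        then have "rk b a = r b" using mate_props(5)[OF ac(1)] by simp
        then show False using h(5) fb hr[OF ac(2)] by simp
      next
        case 3
        then have "hold b \<le> rk b a - of_bool (P a b)"
          using inv1[OF ac(1)] h(4) fa ac(6) by (metis less_imp_le)
        then show False using h(5) fb by (simp add: of_bool_def split: if_splits)
      qed
    qed
    \<comment> \<open>Agents that did not move are at least as well off as in \<open>r\<close>, so
      two of them would block \<open>r\<close>.\<close>
    have NN: False if h: "a \<notin> W" "b \<notin> W" "acc a b" "rk a b < ?f a" "rk b a < ?f b" for a b
      using stableD(4)[OF r h(3)] h(4,5) notW[OF accD(1)[OF h(3)] h(1)] notW[OF accD(2)[OF h(3)] h(2)]
        hr[OF accD(1)[OF h(3)]] hr[OF accD(2)[OF h(3)]] by simp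
    show False using WW[of a b] WN[of a b] WN[of b a] NN[of a b] ab accD(4)[OF ab(1)] by blast
  qed
  moreover have "\<not> P x (pr x (?f x))" if x: "x \<in> {1..N}" for x
  proof
    assume Px: "P x (pr x (?f x))"
    consider "x \<in> W" | "x \<in> I" | "x \<notin> W" "x \<notin> I" by auto
    then show False
    proof cases
      case 1
      then show False using WtoI(3)[OF 1] Px W(7)[OF 1] by simp
    next
      case 2
      let ?w = "pr x (?f x)"
      have w: "?w \<in> W" using Iprops(2)[OF 2] .
      have "pr ?w (pos ?w) = x" using Iprops(4)[OF 2] W(7)[OF w] by simp
      then show False using WtoI(3)[OF w] P_sym[OF Px] by simp
    next
      case 3
      then have Pm: "P x (mate x)" using Px same(1)[OF x] unfolding mate_def by simp
      note m = mate_props[OF x P_mate_matched[OF x Pm]]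
      have "mate x \<noteq> x" using accD(3)[OF m(1)] by simp
      \<comment> \<open>A forbidden pair of old partners cannot survive: the guess lowers the
        barrier of one end, and the other end has then moved.\<close>
      then have "must_improve G x \<or> must_improve G (mate x)"
        using Pm P_sym[OF Pm] m(2) unfolding must_improve_def by auto
      then show False
      proof
        assume "must_improve G x"
        then have "hold x < r x" using inv1[OF x] by simp
        then show False using 3 x unfolding I_def by simp
      next
        assume "must_improve G (mate x)"
        then have "hold (mate x) < r (mate x)" using inv1[OF m(3)] by simp
        then have "mate x \<in> I" using m(3) unfolding I_def by simp
        then show False using ItoW m(2) 3 by force
      qed
    qed
  qed
  moreover have "b = pr a (?f a)" if q: "Q a b" for a b
  proof -
    \<comment> \<open>At an improving end the barrier is squeezed between \<open>s a\<close>, the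
      bound valid for all solutions, and the forced rank, which is \<open>s a\<close> too.\<close>
    have aux: "a \<in> I \<and> b = pr a (?f a)" if q: "Q a b" and lt: "s a < r a" for a b
    proof -
      have a: "a \<in> {1..N}" using Q_mem[OF q] by simp
      have bp: "b = pr a (s a)" using goodD(3)[OF s q] .
      have sl: "s a \<in> {1..len a}" using stableD(1)[OF st a] stableD(2)[OF r a] lt by simp
      have "hold a \<le> s a" using inv1[OF a] sl q bp by blast
      then have "a \<in> I" "hold a = s a" using lt a inv2[OF a] unfolding I_def by auto
      then show ?thesis using I(7)[of a] bp by simp
    qed
    have a: "a \<in> {1..N}" "b \<in> {1..N}" using Q_mem[OF q] by auto
    have ab: "b = pr a (s a)" using goodD(3)[OF s q] .
    consider "s a < r a" | "r a < s a" | "s a = r a" by linarith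
    then show ?thesis
    proof cases
      case 1 then show ?thesis using aux[OF q] by simp
    next
      case 2
      \<comment> \<open>A worsening end is treated through its forced partner, which
        improves.\<close>
      have "s b < r b" using partner_of_worsener(2)[OF r st a(1) 2] ab by simp
      then have "b \<in> I" "a = pr b (?f b)" using aux[OF Q_sym[OF q]] by auto
      then show ?thesis using Iprops(4)[of b] by simp
    next
      case 3
      then have "a \<notin> W" "a \<notin> I" using W(4)[of a] I(4)[of a] by auto
      then show ?thesis using same(1)[OF a(1)] 3 ab by simp
    qed
  qed
  ultimately show "good ?f" unfolding good_def by blast
  show "changed ?f \<subseteq> changed s"
  proof
    fix x assume "x \<in> changed ?f"
    then have "x \<in> {1..N}" "x \<in> W \<or> x \<in> I" using same(1)[of x] unfolding changed_def by auto
    then show "x \<in> changed s" using W(4)[of x] I(4)[of x] unfolding changed_def by auto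
  qed
qed

end

section \<open>Timed weakest preconditions\<close>

text \<open>Total correctness, with the running time as an argument of the postcondition. As
  \<open>exec\<close> is deterministic, the run that is asserted to exist is the only one.\<close>

definition wp :: "com \<Rightarrow> machine \<Rightarrow> (nat \<Rightarrow> machine \<Rightarrow> bool) \<Rightarrow> bool" where
  "wp c s Q \<longleftrightarrow> (\<exists>t s'. exec c s t s' \<and> Q t s')"

lemma wp_Skip [simp]: "wp Skip s Q \<longleftrightarrow> Q 1 s"
  unfolding wp_def by (rule iffI, elim exE conjE, erule SkipE, simp, rule exI, rule exI, erule conjI[OF exec.Skip])

lemma wp_Assign [simp]: "wp (Assign x e) s Q \<longleftrightarrow> Q (1 + acost e) (set_reg x (aval e s) s)"
  unfolding wp_def
  by (rule iffI, elim exE conjE, erule AssignE, simp, rule exI, rule exI, erule conjI[OF exec.Assign])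

lemma wp_Store [simp]:
  "wp (Store x e1 e2 e) s Q \<longleftrightarrow>
     Q (1 + acost e1 + acost e2 + acost e) (set_arr x (aval e1 s) (aval e2 s) (aval e s) s)"
  unfolding wp_def
  by (rule iffI, elim exE conjE, erule StoreE, simp, rule exI, rule exI, erule conjI[OF exec.Store])

lemma wp_Seq [simp]:
  "wp (Seq c1 c2) s Q \<longleftrightarrow> wp c1 s (\<lambda>t1 s1. wp c2 s1 (\<lambda>t2. Q (1 + t1 + t2)))"
proof
  assume "wp c1 s (\<lambda>t1 s1. wp c2 s1 (\<lambda>t2. Q (1 + t1 + t2)))"
  then obtain t1 s1 t2 s2 where "exec c1 s t1 s1" "exec c2 s1 t2 s2" "Q (1 + t1 + t2) s2"
    unfolding wp_def by blast
  then show "wp (Seq c1 c2) s Q" unfolding wp_def using exec.Seq by blast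
next
  assume "wp (Seq c1 c2) s Q"
  then obtain t s2 where "exec (Seq c1 c2) s t s2" and Q: "Q t s2" unfolding wp_def by blast
  then obtain t1 s1 t2 where "t = 1 + t1 + t2" "exec c1 s t1 s1" "exec c2 s1 t2 s2" by (elim SeqE) simp
  then show "wp c1 s (\<lambda>t1 s1. wp c2 s1 (\<lambda>t2. Q (1 + t1 + t2)))" unfolding wp_def using Q by blast
qed

lemma wp_If [simp]:
  "wp (If b c1 c2) s Q \<longleftrightarrow>
     (if bval b s then wp c1 s (\<lambda>t. Q (1 + bcost b + t)) else wp c2 s (\<lambda>t. Q (1 + bcost b + t)))"
    (is "_ \<longleftrightarrow> ?R")
proof
  assume "wp (If b c1 c2) s Q"
  then obtain t s2 where "exec (If b c1 c2) s t s2" and Q: "Q t s2" unfolding wp_def by blast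
  then obtain t1 where "t = 1 + bcost b + t1" "exec (if bval b s then c1 else c2) s t1 s2"
    by (elim IfE) simp_all
  then show ?R using Q unfolding wp_def by (cases "bval b s") auto
next
  assume ?R
  then show "wp (If b c1 c2) s Q"
    unfolding wp_def using exec.IfTrue exec.IfFalse by (cases "bval b s") (simp only: if_True if_False simp_thms, blast)+
qed

lemma wp_mono: "wp c s Q \<Longrightarrow> (\<And>t s'. Q t s' \<Longrightarrow> Q' t s') \<Longrightarrow> wp c s Q'"
  unfolding wp_def by blast

section \<open>Frame conditions and loop rules with time bounds\<close>

fun written_regs :: "com \<Rightarrow> string set" where
  "written_regs (Assign x e) = {x}"
| "written_regs (Seq c1 c2) = written_regs c1 \<union> written_regs c2"
| "written_regs (If b c1 c2) = written_regs c1 \<union> written_regs c2"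
| "written_regs (While b c) = written_regs c"
| "written_regs _ = {}"

fun written_arrs :: "com \<Rightarrow> string set" where
  "written_arrs (Store x e1 e2 e) = {x}"
| "written_arrs (Seq c1 c2) = written_arrs c1 \<union> written_arrs c2"
| "written_arrs (If b c1 c2) = written_arrs c1 \<union> written_arrs c2"
| "written_arrs (While b c) = written_arrs c"
| "written_arrs _ = {}"

text \<open>A frame condition read off the program text: whatever is not syntactically assigned
  keeps its value.\<close>

definition agree :: "com \<Rightarrow> machine \<Rightarrow> machine \<Rightarrow> bool" where
  "agree c s s' \<longleftrightarrow> (\<forall>x. x \<notin> written_regs c \<longrightarrow> reg s' x = reg s x) \<and>
                    (\<forall>x. x \<notin> written_arrs c \<longrightarrow> arr s' x = arr s x)"

lemma set_simps [simp]:
  "reg (set_reg x v s) = (reg s)(x := v)" "arr (set_reg x v s) = arr s"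
  "reg (set_arr y i j v s) = reg s"
  "arr (set_arr y i j v s) = (arr s)(y := (arr s y)(i := (arr s y i)(j := v)))"
  by (simp_all add: set_reg_def set_arr_def)

lemma exec_agree: "exec c s t s' \<Longrightarrow> agree c s s'"
  by (induction rule: exec.induct) (auto simp: agree_def)

lemma agree_refl: "agree c s s"
  by (simp add: agree_def)

lemma agree_trans: "agree c s s' \<Longrightarrow> agree c s' s'' \<Longrightarrow> agree c s s''"
  by (simp add: agree_def)

lemma wp_frame: "wp c s Q \<Longrightarrow> wp c s (\<lambda>t s'. agree c s s' \<and> Q t s')"
  unfolding wp_def using exec_agree by blast

text \<open>The number \<open>\<phi> s\<close> bounds the time that remains for further iterations.\<close>

lemma wp_While:
  fixes \<phi> :: "machine \<Rightarrow> nat"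
  assumes init: "I s"
    and step: "\<And>s'. agree c s s' \<Longrightarrow> I s' \<Longrightarrow> bval b s' \<Longrightarrow>
                 wp c s' (\<lambda>t s''. I s'' \<and> 1 + bcost b + t + \<phi> s'' \<le> \<phi> s')"
    and exit: "\<And>t s'. agree c s s' \<Longrightarrow> I s' \<Longrightarrow> \<not> bval b s' \<Longrightarrow> t \<le> \<phi> s + 1 + bcost b \<Longrightarrow> Q t s'"
  shows "wp (While b c) s Q"
proof -
  have "\<exists>t s''. exec (While b c) s' t s'' \<and> agree c s s'' \<and> I s'' \<and> \<not> bval b s'' \<and>
          t \<le> \<phi> s' + 1 + bcost b" if "I s'" "agree c s s'" for s'
    using that
  proof (induction "\<phi> s'" arbitrary: s' rule: less_induct)
    case less
    show ?case
    proof (cases "bval b s'")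
      case False
      then show ?thesis using exec.WhileFalse less.prems
        by (metis add.assoc le_add2)
    next
      case True
      obtain t1 s1 where 1: "exec c s' t1 s1" "I s1" "1 + bcost b + t1 + \<phi> s1 \<le> \<phi> s'"
        using step[OF less.prems(2,1) True] unfolding wp_def by blast
      have a1: "agree c s s1" using agree_trans[OF less.prems(2) exec_agree[OF 1(1)]] .
      have "\<phi> s1 < \<phi> s'" using 1(3) by simp
      from less.hyps[OF this 1(2) a1] obtain t2 s2 where
        2: "exec (While b c) s1 t2 s2" "agree c s s2" "I s2" "\<not> bval b s2" "t2 \<le> \<phi> s1 + 1 + bcost b"
        by blast
      have "exec (While b c) s' (1 + bcost b + t1 + t2) s2" using exec.WhileTrue[OF True 1(1) 2(1)] .
      moreover have "1 + bcost b + t1 + t2 \<le> \<phi> s' + 1 + bcost b" using 1(3) 2(5) by simp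
      ultimately show ?thesis using 2 by blast
    qed
  qed
  from this[OF init agree_refl] show ?thesis using exit unfolding wp_def by blast
qed

text \<open>The bound \<open>e\<close> is evaluated anew at every test. This is why the loop rule
  asks that its value be stable under the loop and why \<open>acost e\<close> is paid in each
  round.\<close>

definition For :: "string \<Rightarrow> aexp \<Rightarrow> com \<Rightarrow> com" where
  "For x e c = Seq (Assign x (Num 1))
     (While (Neg (Less e (Reg x))) (Seq c (Assign x (Inc (Reg x)))))"

lemma written_For [simp]:
  "written_regs (For x e c) = insert x (written_regs c)"
  "written_arrs (For x e c) = written_arrs c"
  by (auto simp: For_def)

lemma agree_For_intro:
  "agree (Seq c (Assign x (Inc (Reg x)))) (set_reg x 1 s) s' \<Longrightarrow> agree (For x e c) s s'"
  by (auto simp: agree_def)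

text \<open>The invariant \<open>I i\<close> must not mention the loop counter, and facts about whatever the loop does
  not write need not be part of it: they are provided by \<open>agree\<close>.\<close>

lemma wp_For:
  assumes x: "x \<notin> written_regs c" and E: "0 \<le> E"
    and bound: "\<And>s'. agree (For x e c) s s' \<Longrightarrow> aval e s' = E"
    and indep: "\<And>i v s'. I i (set_reg x v s') = I i s'"
    and init: "I 1 s"
    and step: "\<And>i s'. agree (For x e c) s s' \<Longrightarrow> reg s' x = i \<Longrightarrow> 1 \<le> i \<Longrightarrow> i \<le> E \<Longrightarrow> I i s' \<Longrightarrow>
                 wp c s' (\<lambda>t s''. t \<le> T \<and> I (i + 1) s'')"
    and exit: "\<And>t s'. agree (For x e c) s s' \<Longrightarrow> I (E + 1) s' \<Longrightarrow>
                 t \<le> (nat E + 1) * (T + acost e + 8) \<Longrightarrow> Q t s'"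
  shows "wp (For x e c) s Q"
proof -
  define J :: "machine \<Rightarrow> bool" where "J s' \<longleftrightarrow> 1 \<le> reg s' x \<and> reg s' x \<le> E + 1 \<and> I (reg s' x) s'" for s'
  \<comment> \<open>The fixed cost of a round is 8 besides \<open>T\<close> and
    \<open>acost e\<close>: three more nodes of the test, one unit for the loop, one for the
    sequence, and three for the increment.\<close>
  define \<phi> :: "machine \<Rightarrow> nat" where "\<phi> s' = nat (E + 1 - reg s' x) * (T + acost e + 8)" for s'
  let ?b = "Neg (Less e (Reg x))" and ?c = "Seq c (Assign x (Inc (Reg x)))"
  have "wp (While ?b ?c) (set_reg x 1 s) (\<lambda>t s'. Q (3 + t) s')"
  proof (rule wp_While[where I = J and \<phi> = \<phi>])
    show "J (set_reg x 1 s)" using init E indep unfolding J_def by simp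
  next
    fix s' assume s': "agree ?c (set_reg x 1 s) s'" "J s'" "bval ?b s'"
    note a = agree_For_intro[OF s'(1)]
    have le: "reg s' x \<le> E" using s'(3) bound[OF a] by simp
    have fr: "wp c s' (\<lambda>t s''. agree c s' s'' \<and> t \<le> T \<and> I (reg s' x + 1) s'')"
      by (rule wp_frame, rule step[OF a refl _ le]) (use s'(2) J_def in auto)
    have nE: "\<phi> s' = T + acost e + 8 + nat (E - reg s' x) * (T + acost e + 8)"
    proof -
      have "nat (E + 1 - reg s' x) = Suc (nat (E - reg s' x))" using le by simp
      then show ?thesis unfolding \<phi>_def by simp
    qed
    have post: "J s3 \<and> 1 + bcost ?b + (1 + t + (1 + acost (Inc (Reg x)))) + \<phi> s3 \<le> \<phi> s'"
      if h: "agree c s' s''" "t \<le> T" "I (reg s' x + 1) s''" and s3: "s3 = set_reg x (reg s'' x + 1) s''"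
      for t s'' s3
    proof
      have "reg s'' x = reg s' x" using x h(1) unfolding agree_def by simp
      then have r3: "reg s3 x = reg s' x + 1" using s3 by simp
      have "I (reg s3 x) s3" unfolding r3 using h(3) by (simp only: s3 indep)
      then show "J s3" using s'(2) le r3 unfolding J_def by simp
      have "\<phi> s3 = nat (E - reg s' x) * (T + acost e + 8)" unfolding \<phi>_def r3 by (simp only: add_diff_cancel_right)
      then show "1 + bcost ?b + (1 + t + (1 + acost (Inc (Reg x)))) + \<phi> s3 \<le> \<phi> s'"
        using h(2) nE by simp
    qed
    show "wp ?c s' (\<lambda>t s''. J s'' \<and> 1 + bcost ?b + t + \<phi> s'' \<le> \<phi> s')"
      unfolding wp_Assign wp_Seq by (rule wp_mono[OF fr], rule post) auto
  next
    fix t s' assume s': "agree ?c (set_reg x 1 s) s'" "J s'" "\<not> bval ?b s'"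
      "t \<le> \<phi> (set_reg x 1 s) + 1 + bcost ?b"
    note a = agree_For_intro[OF s'(1)]
    have r: "reg s' x = E + 1" using s'(2,3) bound[OF a] unfolding J_def by simp
    have I: "I (E + 1) s'" using s'(2) r unfolding J_def by simp
    \<comment> \<open>The additional factor one covers setting the counter and the last, failing
      test.\<close>
    have "3 + t \<le> (nat E + 1) * (T + acost e + 8)" using s'(4) unfolding \<phi>_def by simp
    then show "Q (3 + t) s'" using exit[OF a I] by blast
  qed
  moreover have "1 + (1 + acost (Num 1)) = (3::nat)" by simp
  ultimately show ?thesis unfolding For_def wp_Assign wp_Seq aval.simps by (simp only:)
qed

text \<open>Replacing exact times by fixed upper bounds lets the time analysis compose through one
  arithmetic side condition per sequence.\<close>

lemma wp_SeqI:
  assumes "wp c1 s (\<lambda>t s'. t \<le> T \<and> R s')"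
    and "\<And>s'. agree c1 s s' \<Longrightarrow> R s' \<Longrightarrow> wp c2 s' (\<lambda>t s''. t \<le> T' \<and> Q s'')"
    and "1 + T + T' \<le> U"
  shows "wp (Seq c1 c2) s (\<lambda>t s'. t \<le> U \<and> Q s')"
  unfolding wp_Seq
proof (rule wp_mono[OF wp_frame[OF assms(1)]])
  fix t1 s1 assume 1: "agree c1 s s1 \<and> t1 \<le> T \<and> R s1"
  show "wp c2 s1 (\<lambda>t2 s'. 1 + t1 + t2 \<le> U \<and> Q s')"
    by (rule wp_mono[OF assms(2)]) (use 1 assms(3) in auto)
qed

lemma wp_weaken:
  assumes "wp c s (\<lambda>t s'. t \<le> T \<and> R s')" "\<And>s'. agree c s s' \<Longrightarrow> R s' \<Longrightarrow> Q s'" "T \<le> T'"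
  shows "wp c s (\<lambda>t s'. t \<le> T' \<and> Q s')"
  by (rule wp_mono[OF wp_frame[OF assms(1)]]) (use assms(2,3) in auto)

section \<open>The search program\<close>

text \<open>Machine arrays are two-dimensional; tables indexed by agents occupy column
  \<open>0\<close>.\<close>

definition col :: "machine \<Rightarrow> string \<Rightarrow> int \<Rightarrow> int" where
  "col s x = (\<lambda>a. arr s x a 0)"

abbreviation entry :: "string \<Rightarrow> aexp \<Rightarrow> aexp" where
  "entry x e \<equiv> Cell x e (Num 0)"

abbreviation put :: "string \<Rightarrow> aexp \<Rightarrow> aexp \<Rightarrow> com" where
  "put x e \<equiv> Store x e (Num 0)"

abbreviation Disj :: "bexp \<Rightarrow> bexp \<Rightarrow> bexp" where
  "Disj b1 b2 \<equiv> Neg (Conj (Neg b1) (Neg b2))"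

definition init_agent :: com where
  "init_agent = Seq (put ''pos'' (Reg ''a'') (entry ''r1'' (Reg ''a'')))
    (Seq (put ''hold'' (Reg ''a'') (entry ''r1'' (Reg ''a'')))
    (Seq (Assign ''b'' (entry ''M1'' (Reg ''a'')))
      (If (Conj (Equal (Cell ''P'' (Reg ''a'') (Reg ''b'')) (Num 1))
             (Disj (Conj (Less (Reg ''a'') (Reg ''b'')) (Equal (entry ''bit'' (Reg ''a'')) (Num 1)))
                   (Conj (Less (Reg ''b'') (Reg ''a'')) (Equal (entry ''bit'' (Reg ''b'')) (Num 0)))))
        (put ''hold'' (Reg ''a'') (Dec (entry ''hold'' (Reg ''a'')))) Skip)))"

definition init_forced :: com where
  "init_forced = For ''j'' (entry ''pref'' (Reg ''a''))
     (If (Conj (Equal (Cell ''Q'' (Reg ''a'') (Cell ''pref'' (Reg ''a'') (Reg ''j''))) (Num 1))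
            (Less (Reg ''j'') (entry ''hold'' (Reg ''a''))))
       (put ''hold'' (Reg ''a'') (Reg ''j'')) Skip)"

definition init_guess :: com where
  "init_guess = For ''a'' (Reg ''N'') (Seq init_agent init_forced)"

text \<open>A rejection lowers a barrier and may make an agent scanned earlier discontent, so the
  scan starts again at agent 1. This costs \<open>O(n)\<close> per rejection.\<close>

definition propose_step :: com where
  "propose_step = Seq (Assign ''b'' (Cell ''pref'' (Reg ''a'') (entry ''pos'' (Reg ''a''))))
    (If (Less (entry ''hold'' (Reg ''b'')) (Cell ''rk'' (Reg ''b'') (Reg ''a'')))
      (Seq (put ''pos'' (Reg ''a'') (Inc (entry ''pos'' (Reg ''a''))))
      (Seq (Assign ''b'' (Cell ''pref'' (Reg ''a'') (entry ''pos'' (Reg ''a''))))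
      (Seq (Assign ''t'' (Cell ''rk'' (Reg ''b'') (Reg ''a'')))
      (Seq (If (Equal (Cell ''P'' (Reg ''a'') (Reg ''b'')) (Num 1)) (Assign ''t'' (Dec (Reg ''t''))) Skip)
      (Seq (If (Less (Reg ''t'') (entry ''hold'' (Reg ''b''))) (put ''hold'' (Reg ''b'') (Reg ''t'')) Skip)
        (Assign ''a'' (Num 1)))))))
      (Assign ''a'' (Inc (Reg ''a''))))"

definition propose :: com where
  "propose = Seq (Assign ''a'' (Num 1)) (While (Neg (Less (Reg ''N'') (Reg ''a''))) propose_step)"

definition read_outcome :: com where
  "read_outcome = For ''a'' (Reg ''N'')
     (If (Equal (entry ''pos'' (Reg ''a'')) (entry ''r1'' (Reg ''a'')))
       (put ''f'' (Reg ''a'') (entry ''hold'' (Reg ''a'')))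
       (put ''f'' (Reg ''a'') (entry ''pos'' (Reg ''a''))))"

text \<open>For a guess without solution a barrier may have sunk to 0 or below, hence the explicit
  test for a positive rank. Partner \<open>0\<close> stands for being unmatched and has no rank to
  compare with.\<close>

definition check_partner :: com where
  "check_partner = Seq (Assign ''b'' (Cell ''pref'' (Reg ''a'') (entry ''f'' (Reg ''a''))))
     (If (Conj (Less (Num 0) (entry ''f'' (Reg ''a'')))
         (Conj (Disj (Equal (Reg ''b'') (Num 0))
                     (Equal (entry ''f'' (Reg ''b'')) (Cell ''rk'' (Reg ''b'') (Reg ''a''))))
               (Neg (Equal (Cell ''P'' (Reg ''a'') (Reg ''b'')) (Num 1)))))
       Skip (Assign ''ok'' (Num 0)))"

definition check_blocking :: com where
  "check_blocking = For ''j'' (entry ''pref'' (Reg ''a''))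
     (Seq (Assign ''b'' (Cell ''pref'' (Reg ''a'') (Reg ''j'')))
       (If (Conj (Less (Reg ''j'') (entry ''f'' (Reg ''a'')))
                 (Less (Cell ''rk'' (Reg ''b'') (Reg ''a'')) (entry ''f'' (Reg ''b''))))
         (Assign ''ok'' (Num 0)) Skip))"

definition check_outcome :: com where
  "check_outcome = Seq (Assign ''ok'' (Num 1)) (For ''a'' (Reg ''N'') (Seq check_partner check_blocking))"

text \<open>Each changed agent counts once in \<open>''c''\<close>; this number equals the size of
  the symmetric difference. Forced pairs realised by the outcome are counted at their smaller
  agents, and comparing the count with \<open>q\<close> decides inclusion of \<open>Q\<close>
  without running through the possibly very long list of forced pairs.\<close>

definition count_outcome :: com where
  "count_outcome = Seq (Assign ''c'' (Num 0)) (Seq (Assign ''d'' (Num 0))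
     (For ''a'' (Reg ''N'')
       (Seq (If (Equal (entry ''f'' (Reg ''a'')) (entry ''r1'' (Reg ''a''))) Skip
               (Assign ''c'' (Inc (Reg ''c''))))
         (If (Conj (Less (Reg ''a'') (Cell ''pref'' (Reg ''a'') (entry ''f'' (Reg ''a''))))
               (Equal (Cell ''Q'' (Reg ''a'') (Cell ''pref'' (Reg ''a'') (entry ''f'' (Reg ''a'')))) (Num 1)))
            (Assign ''d'' (Inc (Reg ''d''))) Skip))))"

definition decide_outcome :: com where
  "decide_outcome = If (Conj (Equal (Reg ''ok'') (Num 1))
       (Conj (Equal (Reg ''d'') (Reg ''q'')) (Neg (Less (Reg ''k'') (Reg ''c'')))))
     (Assign ''answer'' (Num 1)) Skip"

definition try_guess :: com where
  "try_guess = Seq init_guess (Seq propose (Seq read_outcome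
     (Seq check_outcome (Seq count_outcome decide_outcome))))"

text \<open>The bits of the current guess are stored at the smaller agents of the pairs in \<open>P \<inter> M1\<close>. The
  loop resets the trailing ones and stops at the first zero.\<close>

definition next_guess :: com where
  "next_guess = Seq (Assign ''a'' (Num 1))
    (Seq (While (Conj (Neg (Less (Reg ''N'') (Reg ''a'')))
              (Neg (Conj (Conj (Less (Reg ''a'') (entry ''M1'' (Reg ''a'')))
                           (Equal (Cell ''P'' (Reg ''a'') (entry ''M1'' (Reg ''a''))) (Num 1)))
                     (Equal (entry ''bit'' (Reg ''a'')) (Num 0)))))
            (Seq (put ''bit'' (Reg ''a'') (Num 0)) (Assign ''a'' (Inc (Reg ''a'')))))
      (If (Less (Reg ''N'') (Reg ''a'')) (Assign ''go'' (Num 0)) (put ''bit'' (Reg ''a'') (Num 1))))"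

definition search :: com where
  "search = Seq (Assign ''go'' (Num 1))
     (While (Equal (Reg ''go'') (Num 1)) (Seq try_guess next_guess))"

text \<open>\<open>M\<close> stands for the number of acceptable pairs. The bound on single lists
  serves the loops over one list, and the bound on their total length serves the number of
  rejections.\<close>

locale adapt_machine = adapt_ranks +
  fixes k q :: int and M :: nat
  assumes N_nonneg: "0 \<le> N"
    and len_pr: "len a = pr a 0"
    and len_le: "a \<in> {1..N} \<Longrightarrow> nat (len a) \<le> M"
    and len_total: "(\<Sum>a\<in>{1..N}. nat (len a)) \<le> 2 * M"
    and q: "q = int (card {(a, b). Q a b \<and> a < b})"
    and Q_irrefl: "\<not> Q a a"
begin

section \<open>Time and correctness of the phases for one guess\<close>

definition env :: "machine \<Rightarrow> bool" where
  "env s \<longleftrightarrow> reg s ''N'' = N \<and> reg s ''k'' = k \<and> reg s ''q'' = q \<and>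
     arr s ''pref'' = pr \<and> arr s ''rk'' = rk \<and>
     (\<forall>a\<in>{1..N}. arr s ''r1'' a 0 = r a) \<and> (\<forall>a\<in>{1..N}. arr s ''M1'' a 0 = mate a) \<and>
     arr s ''P'' = (\<lambda>a b. of_bool (P a b)) \<and> arr s ''Q'' = (\<lambda>a b. of_bool (Q a b))"

lemma env_simps:
  assumes "env s"
  shows "reg s ''N'' = N" "reg s ''k'' = k" "reg s ''q'' = q" "arr s ''pref'' = pr" "arr s ''rk'' = rk"
    "1 \<le> a \<Longrightarrow> a \<le> N \<Longrightarrow> arr s ''r1'' a 0 = r a" "1 \<le> a \<Longrightarrow> a \<le> N \<Longrightarrow> arr s ''M1'' a 0 = mate a"
    "arr s ''P'' a b = of_bool (P a b)" "arr s ''Q'' a b = of_bool (Q a b)"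
  using assms unfolding env_def by auto

lemma env_agree:
  assumes "agree c s s'" "env s" "written_regs c \<inter> {''N'', ''k'', ''q''} = {}"
    "written_arrs c \<inter> {''pref'', ''rk'', ''r1'', ''M1'', ''P'', ''Q''} = {}"
  shows "env s'"
  using assms unfolding env_def agree_def by auto

lemma loop_time:
  assumes "t \<le> (nat N + 1) * y" "y \<le> c * (M + 1)"
  shows "t \<le> c * ((nat N + 1) * (M + 1))"
proof -
  have "(nat N + 1) * y \<le> (nat N + 1) * (c * (M + 1))" using assms(2) by (rule mult_le_mono2)
  then show ?thesis using assms(1) by (simp add: algebra_simps)
qed

text \<open>The condition of \<open>init_hold\<close> for the agent \<open>a\<close>, restricted to the first \<open>j - 1\<close> entries of
  its list.\<close>

definition hold_ok :: "int set \<Rightarrow> int \<Rightarrow> int \<Rightarrow> int \<Rightarrow> bool" where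
  "hold_ok G a j h \<longleftrightarrow> h \<le> r a - of_bool (must_improve G a) \<and>
     (\<forall>i\<in>{1..<j}. Q a (pr a i) \<longrightarrow> h \<le> i) \<and>
     (h = r a - of_bool (must_improve G a) \<or> (\<exists>i\<in>{1..<j}. Q a (pr a i) \<and> h = i))"

lemma hold_ok_step:
  assumes "hold_ok G a j h" "1 \<le> j"
  shows "hold_ok G a (j + 1) (if Q a (pr a j) \<and> j < h then j else h)"
proof -
  have "{1..<j + 1} = insert j {1..<j}" using assms(2) by auto
  then show ?thesis using assms(1) unfolding hold_ok_def by (auto; fastforce)
qed

lemma wp_init_agent:
  assumes s: "env s" "reg s ''a'' = a" "1 \<le> a" "a \<le> N"
    and bits: "\<And>x. x \<in> {1..N} \<Longrightarrow> arr s ''bit'' x 0 = of_bool (x \<in> G)"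
  shows "wp init_agent s (\<lambda>t s'. t \<le> 100 \<and>
     col s' ''pos'' = (col s ''pos'')(a := r a) \<and>
     col s' ''hold'' = (col s ''hold'')(a := r a - of_bool (must_improve G a)))"
proof -
  \<comment> \<open>The bit of the partner matters only for a forbidden pair, and then the partner
    is a real agent, where the bits are known.\<close>
  have m: "mate a \<in> {1..N}" if "P a (mate a)"
    using mate_props(3)[OF _ P_mate_matched[OF _ that]] s by auto
  have "must_improve G a \<longleftrightarrow> P a (mate a) \<and> \<not> (\<not> (a < mate a \<and> arr s ''bit'' a 0 = 1) \<and>
          \<not> (mate a < a \<and> arr s ''bit'' (mate a) 0 = 0))"
    using m bits[of a] bits[of "mate a"] s(3,4) unfolding must_improve_def by auto
  then show ?thesis
    using s(2-4) env_simps[OF s(1)] unfolding init_agent_def by (simp add: col_def fun_eq_iff)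
qed

lemma wp_init_forced:
  assumes s: "env s" "reg s ''a'' = a" "1 \<le> a" "a \<le> N"
    and h: "col s ''hold'' a = r a - of_bool (must_improve G a)"
  shows "wp init_forced s (\<lambda>t s'. t \<le> 100 * (M + 1) \<and>
     (\<forall>x. x \<noteq> a \<longrightarrow> col s' ''hold'' x = col s ''hold'' x) \<and>
     hold_ok G a (len a + 1) (col s' ''hold'' a))"
proof -
  let ?c = "If (Conj (Equal (Cell ''Q'' (Reg ''a'') (Cell ''pref'' (Reg ''a'') (Reg ''j''))) (Num 1))
            (Less (Reg ''j'') (entry ''hold'' (Reg ''a''))))
       (put ''hold'' (Reg ''a'') (Reg ''j'')) Skip"
  show ?thesis unfolding init_forced_def
  proof (rule wp_For[where E = "len a" and T = 50 and
        I = "\<lambda>j s'. (\<forall>x. x \<noteq> a \<longrightarrow> col s' ''hold'' x = col s ''hold'' x) \<and> hold_ok G a j (col s' ''hold'' a)"])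
    show "0 \<le> len a" using len_nonneg s(3,4) by simp
  next
    fix s' assume "agree (For ''j'' (entry ''pref'' (Reg ''a'')) ?c) s s'"
    then show "aval (entry ''pref'' (Reg ''a'')) s' = len a"
      using s(2) env_simps(4)[OF s(1)] len_pr unfolding agree_def by simp
  next
    show "(\<forall>x. x \<noteq> a \<longrightarrow> col s ''hold'' x = col s ''hold'' x) \<and> hold_ok G a 1 (col s ''hold'' a)"
      using h unfolding hold_ok_def by simp
  next
    fix j s'
    assume ag: "agree (For ''j'' (entry ''pref'' (Reg ''a'')) ?c) s s'"
      and j: "reg s' ''j'' = j" "1 \<le> j" "j \<le> len a"
      and I: "(\<forall>x. x \<noteq> a \<longrightarrow> col s' ''hold'' x = col s ''hold'' x) \<and> hold_ok G a j (col s' ''hold'' a)"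
    have e: "env s'" by (rule env_agree[OF ag s(1)]) auto
    have ra: "reg s' ''a'' = a" using ag s(2) unfolding agree_def by simp
    show "wp ?c s' (\<lambda>t s'. t \<le> 50 \<and>
           (\<forall>x. x \<noteq> a \<longrightarrow> col s' ''hold'' x = col s ''hold'' x) \<and> hold_ok G a (j + 1) (col s' ''hold'' a))"
      using hold_ok_step[OF conjunct2[OF I] j(2)] conjunct1[OF I] j(1) ra
      by (auto simp: env_simps[OF e] col_def split: if_splits)
  next
    fix t s' assume I: "(\<forall>x. x \<noteq> a \<longrightarrow> col s' ''hold'' x = col s ''hold'' x) \<and>
        hold_ok G a (len a + 1) (col s' ''hold'' a)"
      and t: "t \<le> (nat (len a) + 1) * (50 + acost (entry ''pref'' (Reg ''a'')) + 8)"
    have "nat (len a) \<le> M" using len_le s(3,4) by simp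
    then show "t \<le> 100 * (M + 1) \<and> (\<forall>x. x \<noteq> a \<longrightarrow> col s' ''hold'' x = col s ''hold'' x) \<and>
        hold_ok G a (len a + 1) (col s' ''hold'' a)" using I t by simp
  qed (auto simp: col_def)
qed

lemma wp_init_guess:
  assumes s: "env s" "col s ''hold'' 0 = 0"
    and bits: "\<And>x. x \<in> {1..N} \<Longrightarrow> arr s ''bit'' x 0 = of_bool (x \<in> G)"
  shows "wp init_guess s (\<lambda>t s'. t \<le> 400 * ((nat N + 1) * (M + 1)) \<and>
     init_hold G (col s' ''hold'') \<and> (\<forall>a\<in>{1..N}. col s' ''pos'' a = r a))"
proof -
  define I :: "int \<Rightarrow> machine \<Rightarrow> bool" where "I i s' \<longleftrightarrow> col s' ''hold'' 0 = 0 \<and>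
    (\<forall>x\<in>{1..<i}. col s' ''pos'' x = r x \<and> hold_ok G x (len x + 1) (col s' ''hold'' x))" for i s'
  show ?thesis unfolding init_guess_def
  proof (rule wp_For[where E = N and T = "101 + 100 * (M + 1)" and I = I])
    fix s' assume "agree (For ''a'' (Reg ''N'') (Seq init_agent init_forced)) s s'"
    then show "aval (Reg ''N'') s' = N"
      using env_simps(1)[OF s(1)] unfolding agree_def by (simp add: init_agent_def init_forced_def)
  next
    show "I 1 s" using s(2) unfolding I_def by simp
  next
    fix a s'
    assume ag: "agree (For ''a'' (Reg ''N'') (Seq init_agent init_forced)) s s'"
      and a: "reg s' ''a'' = a" "1 \<le> a" "a \<le> N" and I: "I a s'"
    have e: "env s'" by (rule env_agree[OF ag s(1)]) (auto simp: init_agent_def init_forced_def)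
    have b: "arr s' ''bit'' x 0 = of_bool (x \<in> G)" if "x \<in> {1..N}" for x
      using bits[OF that] ag unfolding agree_def by (simp add: init_agent_def init_forced_def)
    show "wp (Seq init_agent init_forced) s' (\<lambda>t s''. t \<le> 101 + 100 * (M + 1) \<and> I (a + 1) s'')"
    proof (rule wp_SeqI[OF wp_init_agent[OF e a b]])
      fix s1 assume ag1: "agree init_agent s' s1"
        and s1: "col s1 ''pos'' = (col s' ''pos'')(a := r a) \<and>
          col s1 ''hold'' = (col s' ''hold'')(a := r a - of_bool (must_improve G a))"
      have e1: "env s1" by (rule env_agree[OF ag1 e]) (auto simp: init_agent_def)
      have a1: "reg s1 ''a'' = a" using ag1 a(1) unfolding agree_def by (simp add: init_agent_def)
      show "wp init_forced s1 (\<lambda>t s2. t \<le> 100 * (M + 1) \<and> I (a + 1) s2)"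
      proof (rule wp_weaken[OF wp_init_forced[OF e1 a1 a(2,3)]])
        show "col s1 ''hold'' a = r a - of_bool (must_improve G a)" using s1 by simp
      next
        fix s2 assume ag2: "agree init_forced s1 s2"
          and s2: "(\<forall>x. x \<noteq> a \<longrightarrow> col s2 ''hold'' x = col s1 ''hold'' x) \<and>
            hold_ok G a (len a + 1) (col s2 ''hold'' a)"
        have "col s2 ''pos'' = col s1 ''pos''"
          using ag2 unfolding agree_def col_def by (simp add: init_forced_def)
        moreover have "{1..<a + 1} = insert a {1..<a}" using a(2) by auto
        ultimately show "I (a + 1) s2" using I s1 s2 a(2) unfolding I_def by auto
      qed simp
    qed simp_all
  next
    fix t s'
    assume I: "I (N + 1) s'"
      and t: "t \<le> (nat N + 1) * (101 + 100 * (M + 1) + acost (Reg ''N'') + 8)"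
    have "t \<le> 400 * ((nat N + 1) * (M + 1))" by (rule loop_time[OF t]) simp
    moreover have "{1..<N + 1} = {1..N}" "\<And>a. {1..<len a + 1} = {1..len a}" by auto
    ultimately show "t \<le> 400 * ((nat N + 1) * (M + 1)) \<and>
       init_hold G (col s' ''hold'') \<and> (\<forall>a\<in>{1..N}. col s' ''pos'' a = r a)"
      using I unfolding I_def init_hold_def hold_ok_def by simp
  qed (use N_nonneg in \<open>auto simp: I_def col_def init_agent_def init_forced_def\<close>)
qed

text \<open>The potential of the proposal phase: a rejection advances one position, and no position
  passes \<open>len x + 1\<close>.\<close>

definition proposals_left :: "(int \<Rightarrow> int) \<Rightarrow> nat" where
  "proposals_left pos = (\<Sum>x\<in>{1..N}. nat (len x + 1 - pos x))"

lemma proposals_left_step: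
  assumes "a \<in> {1..N}" "pos a \<le> len a"
  shows "proposals_left pos = Suc (proposals_left (pos(a := pos a + 1)))"
proof -
  have "nat (len a + 1 - pos a) = Suc (nat (len a + 1 - (pos a + 1)))" using assms(2) by simp
  then show ?thesis unfolding proposals_left_def
    using assms(1) by (simp add: sum.remove[where x = a])
qed

lemma wp_propose_step:
  assumes s: "env s" "reg s ''a'' = a" "1 \<le> a" "a \<le> N"
    and inv: "propose_inv G (col s ''pos'') (col s ''hold'')"
  shows "wp propose_step s (\<lambda>t s'. t \<le> 100 \<and>
     (if content (col s ''pos'') (col s ''hold'') a
      then reg s' ''a'' = a + 1 \<and> col s' ''pos'' = col s ''pos'' \<and> col s' ''hold'' = col s ''hold''
      else reg s' ''a'' = 1 \<and> propose_inv G (col s' ''pos'') (col s' ''hold'') \<and>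
        Suc (proposals_left (col s' ''pos'')) = proposals_left (col s ''pos'')))"
proof (cases "content (col s ''pos'') (col s ''hold'') a")
  case True
  then have "\<not> arr s ''hold'' (pr a (arr s ''pos'' a 0)) 0 < rk (pr a (arr s ''pos'' a 0)) a"
    unfolding content_def col_def by simp
  then show ?thesis using True s(2) env_simps(4,5)[OF s(1)]
    unfolding propose_step_def by (simp add: col_def)
next
  case False
  then have lt: "arr s ''hold'' (pr a (arr s ''pos'' a 0)) 0 < rk (pr a (arr s ''pos'' a 0)) a"
    unfolding content_def col_def by simp
  define b where "b = pr a (arr s ''pos'' a 0 + 1)"
  define v where "v = rk b a - of_bool (P a b)"
  have a: "a \<in> {1..N}" using s by simp
  define pos' where "pos' = (col s ''pos'')(a := col s ''pos'' a + 1)"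
  define hold' where "hold' = (col s ''hold'')(b := min (col s ''hold'' b) v)"
  have "b = pr a (col s ''pos'' a + 1)" unfolding b_def col_def by simp
  note st = propose_inv_step[OF inv a False this pos'_def hold'_def[unfolded v_def]]
  have left: "Suc (proposals_left pos') = proposals_left (col s ''pos'')"
    using proposals_left_step[where pos = "col s ''pos''", OF a st(2)] unfolding pos'_def by simp
  have "wp propose_step s (\<lambda>t s'. t \<le> 100 \<and> reg s' ''a'' = 1 \<and> col s' ''pos'' = pos' \<and> col s' ''hold'' = hold')"
    using lt s(2) env_simps(4,5,8)[OF s(1)] unfolding propose_step_def pos'_def hold'_def v_def
    by (simp add: b_def[symmetric] col_def fun_eq_iff min_def)
  then show ?thesis by (rule wp_mono) (use False st(1) left in auto)
qed

lemma wp_propose: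
  assumes s: "env s" and inv: "propose_inv G (col s ''pos'') (col s ''hold'')"
  shows "wp propose s (\<lambda>t s'. t \<le> 500 * ((nat N + 1) * (M + 1)) \<and>
     propose_inv G (col s' ''pos'') (col s' ''hold'') \<and>
     (\<forall>a\<in>{1..N}. content (col s' ''pos'') (col s' ''hold'') a))"
proof -
  define I :: "machine \<Rightarrow> bool" where "I s' \<longleftrightarrow> 1 \<le> reg s' ''a'' \<and> reg s' ''a'' \<le> N + 1 \<and>
    propose_inv G (col s' ''pos'') (col s' ''hold'') \<and>
    (\<forall>x\<in>{1..<reg s' ''a''}. content (col s' ''pos'') (col s' ''hold'') x)" for s'
  \<comment> \<open>One round costs at most 110. A rejection releases \<open>nat N + 1\<close>
    rounds: one for itself and \<open>nat N\<close> for the scan that starts over.\<close>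
  define \<phi> :: "machine \<Rightarrow> nat" where "\<phi> s' = 110 * (proposals_left (col s' ''pos'') * (nat N + 1) + nat (N + 1 - reg s' ''a''))"
    for s'
  let ?b = "Neg (Less (Reg ''N'') (Reg ''a''))"
  let ?s = "set_reg ''a'' 1 s"
  have cols: "col ?s x = col s x" for x unfolding col_def by simp
  have eN: "reg s' ''N'' = N" "env s'" if "agree propose_step ?s s'" for s'
  proof -
    have "env ?s" using s unfolding env_def by simp
    then show "env s'" by (rule env_agree[OF that]) (auto simp: propose_step_def)
    then show "reg s' ''N'' = N" by (rule env_simps)
  qed
  have "wp (While ?b propose_step) ?s (\<lambda>t s'. 3 + t \<le> 500 * ((nat N + 1) * (M + 1)) \<and>
     propose_inv G (col s' ''pos'') (col s' ''hold'') \<and>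
     (\<forall>a\<in>{1..N}. content (col s' ''pos'') (col s' ''hold'') a))"
  proof (rule wp_While[where I = I and \<phi> = \<phi>])
    show "I ?s" using inv N_nonneg unfolding I_def cols by simp
  next
    fix s' assume ag: "agree propose_step ?s s'" and I: "I s'" and b: "bval ?b s'"
    have a: "1 \<le> reg s' ''a''" "reg s' ''a'' \<le> N" using I b eN[OF ag] unfolding I_def by auto
    have inv': "propose_inv G (col s' ''pos'') (col s' ''hold'')" using I unfolding I_def by simp
    show "wp propose_step s' (\<lambda>t s''. I s'' \<and> 1 + bcost ?b + t + \<phi> s'' \<le> \<phi> s')"
    proof (rule wp_mono[OF wp_propose_step[OF eN(2)[OF ag] refl a inv']])
      fix t :: nat and s''
      assume h: "t \<le> 100 \<and> (if content (col s' ''pos'') (col s' ''hold'') (reg s' ''a'')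
        then reg s'' ''a'' = reg s' ''a'' + 1 \<and> col s'' ''pos'' = col s' ''pos'' \<and> col s'' ''hold'' = col s' ''hold''
        else reg s'' ''a'' = 1 \<and> propose_inv G (col s'' ''pos'') (col s'' ''hold'') \<and>
          Suc (proposals_left (col s'' ''pos'')) = proposals_left (col s' ''pos''))"
      show "I s'' \<and> 1 + bcost ?b + t + \<phi> s'' \<le> \<phi> s'"
      proof (cases "content (col s' ''pos'') (col s' ''hold'') (reg s' ''a'')")
        case True
        have "{1..<reg s' ''a'' + 1} = insert (reg s' ''a'') {1..<reg s' ''a''}" using a(1) by auto
        then have "I s''" using I h True a unfolding I_def by auto
        moreover have "nat (N + 1 - reg s' ''a'') = Suc (nat (N + 1 - reg s'' ''a''))" using h True a by simp
        ultimately show ?thesis using h True unfolding \<phi>_def by simp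
      next
        case False
        then have h': "reg s'' ''a'' = 1" "propose_inv G (col s'' ''pos'') (col s'' ''hold'')"
          "proposals_left (col s' ''pos'') = Suc (proposals_left (col s'' ''pos''))" using h by auto
        have "I s''" using h' N_nonneg unfolding I_def by simp
        moreover have "1 + bcost ?b + t + \<phi> s'' \<le> \<phi> s'"
          using h a unfolding \<phi>_def h'(1,3) by simp
        ultimately show ?thesis by simp
      qed
    qed
  next
    fix t s' assume ag: "agree propose_step ?s s'" and I: "I s'" and b: "\<not> bval ?b s'"
      and t: "t \<le> \<phi> ?s + 1 + bcost ?b"
    have "reg s' ''a'' = N + 1" using I b eN[OF ag] unfolding I_def by auto
    moreover have "{1..<N + 1} = {1..N}" by auto
    moreover have "3 + t \<le> 500 * ((nat N + 1) * (M + 1))"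
    proof -
      have "r x \<le> col s ''pos'' x" "1 \<le> r x" if "x \<in> {1..N}" for x
        using inv that stableD(1)[OF r] unfolding propose_inv_def by auto
      \<comment> \<open>Positions are at least 1, so at most one rejection per list entry is
        possible.\<close>
      then have "proposals_left (col s ''pos'') \<le> (\<Sum>x\<in>{1..N}. nat (len x))"
        unfolding proposals_left_def by (intro sum_mono nat_mono) force
      then have "proposals_left (col s ''pos'') \<le> 2 * M" using len_total by simp
      then have "proposals_left (col s ''pos'') * (nat N + 1) \<le> 2 * M * (nat N + 1)" by (rule mult_le_mono1)
      then show ?thesis using t unfolding \<phi>_def cols by (simp add: algebra_simps)
    qed
    ultimately show "3 + t \<le> 500 * ((nat N + 1) * (M + 1)) \<and>
     propose_inv G (col s' ''pos'') (col s' ''hold'') \<and>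
     (\<forall>a\<in>{1..N}. content (col s' ''pos'') (col s' ''hold'') a)"
      using I unfolding I_def by auto
  qed
  then show ?thesis unfolding propose_def wp_Seq wp_Assign aval.simps by (elim wp_mono) simp
qed

lemma wp_read_outcome:
  assumes s: "env s"
  shows "wp read_outcome s (\<lambda>t s'. t \<le> 50 * ((nat N + 1) * (M + 1)) \<and>
     (\<forall>a\<in>{1..N}. col s' ''f'' a = outcome (col s ''pos'') (col s ''hold'') a))"
proof -
  define I :: "int \<Rightarrow> machine \<Rightarrow> bool" where "I i s' \<longleftrightarrow>
    (\<forall>x\<in>{1..<i}. col s' ''f'' x = outcome (col s ''pos'') (col s ''hold'') x)" for i s'
  let ?c = "If (Equal (entry ''pos'' (Reg ''a'')) (entry ''r1'' (Reg ''a'')))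
       (put ''f'' (Reg ''a'') (entry ''hold'' (Reg ''a'')))
       (put ''f'' (Reg ''a'') (entry ''pos'' (Reg ''a'')))"
  show ?thesis unfolding read_outcome_def
  proof (rule wp_For[where E = N and T = 30 and I = I])
    fix s' assume "agree (For ''a'' (Reg ''N'') ?c) s s'"
    then show "aval (Reg ''N'') s' = N" using env_simps(1)[OF s] unfolding agree_def by simp
  next
    fix a s' assume ag: "agree (For ''a'' (Reg ''N'') ?c) s s'"
      and a: "reg s' ''a'' = a" "1 \<le> a" "a \<le> N" and I: "I a s'"
    have e: "env s'" by (rule env_agree[OF ag s]) auto
    have "arr s' ''pos'' = arr s ''pos''" "arr s' ''hold'' = arr s ''hold''"
      using ag unfolding agree_def by auto
    moreover have "{1..<a + 1} = insert a {1..<a}" using a(2) by auto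
    ultimately show "wp ?c s' (\<lambda>t s''. t \<le> 30 \<and> I (a + 1) s'')"
      using a I env_simps(6)[OF e a(2,3)] unfolding I_def by (auto simp: col_def outcome_def)
  next
    fix t s' assume I: "I (N + 1) s'" and t: "t \<le> (nat N + 1) * (30 + acost (Reg ''N'') + 8)"
    have "t \<le> 50 * ((nat N + 1) * (M + 1))" by (rule loop_time[OF t]) simp
    moreover have "{1..<N + 1} = {1..N}" by auto
    ultimately show "t \<le> 50 * ((nat N + 1) * (M + 1)) \<and>
       (\<forall>a\<in>{1..N}. col s' ''f'' a = outcome (col s ''pos'') (col s ''hold'') a)"
      using I unfolding I_def by simp
  qed (use N_nonneg in \<open>auto simp: I_def col_def\<close>)
qed

text \<open>The prefix bound \<open>j\<close> makes this a loop invariant: at \<open>j = 1\<close>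
  it is the partner test alone, at \<open>j = len a + 1\<close> the complete test of
  \<open>a\<close>.\<close>

definition locally_ok :: "(int \<Rightarrow> int) \<Rightarrow> int \<Rightarrow> int \<Rightarrow> bool" where
  "locally_ok f a j \<longleftrightarrow>
     0 < f a \<and> (pr a (f a) = 0 \<or> f (pr a (f a)) = rk (pr a (f a)) a) \<and> \<not> P a (pr a (f a)) \<and>
     (\<forall>i\<in>{1..<j}. \<not> (i < f a \<and> rk (pr a i) a < f (pr a i)))"

text \<open>The upper bound on ranks is a hypothesis because \<open>outcome_le\<close> supplies it
  for every guess, with or without solution; the remaining conditions of stability are
  tested.\<close>

lemma locally_ok_iff:
  assumes "\<And>a. a \<in> {1..N} \<Longrightarrow> f a \<le> len a + 1"
  shows "(\<forall>a\<in>{1..N}. locally_ok f a (len a + 1)) \<longleftrightarrow> stable f \<and> (\<forall>a\<in>{1..N}. \<not> P a (pr a (f a)))"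
proof
  assume ok: "\<forall>a\<in>{1..N}. locally_ok f a (len a + 1)"
  have "stable f" unfolding stable_def
  proof (intro conjI ballI allI impI notI)
    fix a assume a: "a \<in> {1..N}"
    have o: "locally_ok f a (len a + 1)" using ok a by blast
    show f: "f a \<in> {1..len a + 1}" using o assms[OF a] unfolding locally_ok_def by simp
    show "f (pr a (f a)) = rk (pr a (f a)) a" if "f a \<le> len a"
    proof -
      have "pr a (f a) \<noteq> 0" using pr_mem[OF a, of "f a"] f that by auto
      then show ?thesis using o unfolding locally_ok_def by blast
    qed
  next
    fix a b assume ab: "acc a b" "rk a b < f a \<and> rk b a < f b"
    have "locally_ok f a (len a + 1)" using ok accD(1)[OF ab(1)] by blast
    moreover have "rk a b \<in> {1..<len a + 1}" using accD(5)[OF ab(1)] by simp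
    ultimately have "\<not> (rk a b < f a \<and> rk (pr a (rk a b)) a < f (pr a (rk a b)))"
      unfolding locally_ok_def by blast
    then show False using ab(2) unfolding accD(6)[OF ab(1)] by blast
  qed
  then show "stable f \<and> (\<forall>a\<in>{1..N}. \<not> P a (pr a (f a)))" using ok unfolding locally_ok_def by blast
next
  assume st: "stable f \<and> (\<forall>a\<in>{1..N}. \<not> P a (pr a (f a)))"
  show "\<forall>a\<in>{1..N}. locally_ok f a (len a + 1)"
  proof
    fix a assume a: "a \<in> {1..N}"
    have "pr a (f a) = 0 \<or> f (pr a (f a)) = rk (pr a (f a)) a"
    proof (cases "f a \<le> len a")
      case True
      then show ?thesis using stableD(3)[OF conjunct1[OF st] a] by blast
    next
      case False
      then have "f a = len a + 1" using assms[OF a] by simp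
      then show ?thesis using pr_end[OF a] by simp
    qed
    moreover have "\<not> (i < f a \<and> rk (pr a i) a < f (pr a i))" if "i \<in> {1..<len a + 1}" for i
    proof -
      have i: "i \<in> {1..len a}" using that by auto
      show ?thesis using stableD(4)[OF conjunct1[OF st] acc_pr[OF a i]] rk_pr[OF a i] by auto
    qed
    ultimately show "locally_ok f a (len a + 1)"
      using stableD(1)[OF conjunct1[OF st] a] st a unfolding locally_ok_def by fastforce
  qed
qed

lemma wp_check_partner:
  assumes s: "env s" "reg s ''a'' = a" "reg s ''ok'' = of_bool X"
  shows "wp check_partner s (\<lambda>t s'. t \<le> 100 \<and> reg s' ''ok'' = of_bool (X \<and> locally_ok (col s ''f'') a 1))"
  using s(2,3) env_simps[OF s(1)] unfolding check_partner_def locally_ok_def by (auto simp: col_def)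

lemma wp_check_blocking:
  assumes s: "env s" "reg s ''a'' = a" "1 \<le> a" "a \<le> N"
    and ok: "reg s ''ok'' = of_bool (X \<and> locally_ok (col s ''f'') a 1)"
  shows "wp check_blocking s (\<lambda>t s'. t \<le> 100 * (M + 1) \<and>
    reg s' ''ok'' = of_bool (X \<and> locally_ok (col s ''f'') a (len a + 1)))"
proof -
  let ?c = "Seq (Assign ''b'' (Cell ''pref'' (Reg ''a'') (Reg ''j'')))
       (If (Conj (Less (Reg ''j'') (entry ''f'' (Reg ''a'')))
                 (Less (Cell ''rk'' (Reg ''b'') (Reg ''a'')) (entry ''f'' (Reg ''b''))))
         (Assign ''ok'' (Num 0)) Skip)"
  define I :: "int \<Rightarrow> machine \<Rightarrow> bool" where "I j s' \<longleftrightarrow> reg s' ''ok'' = of_bool (X \<and> locally_ok (col s ''f'') a j)" for j s'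
  show ?thesis unfolding check_blocking_def
  proof (rule wp_For[where E = "len a" and T = 60 and I = I])
    show "0 \<le> len a" using len_nonneg s(3,4) by simp
  next
    fix s' assume "agree (For ''j'' (entry ''pref'' (Reg ''a'')) ?c) s s'"
    then show "aval (entry ''pref'' (Reg ''a'')) s' = len a"
      using s(2) env_simps(4)[OF s(1)] len_pr unfolding agree_def by simp
  next
    show "I 1 s" using ok unfolding I_def .
  next
    fix j s' assume ag: "agree (For ''j'' (entry ''pref'' (Reg ''a'')) ?c) s s'"
      and j: "reg s' ''j'' = j" "1 \<le> j" "j \<le> len a" and I: "I j s'"
    have e: "env s'" by (rule env_agree[OF ag s(1)]) auto
    have ra: "reg s' ''a'' = a" "arr s' ''f'' = arr s ''f''" using ag s(2) unfolding agree_def by auto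
    have "{1..<j + 1} = insert j {1..<j}" using j(2) by auto
    then show "wp ?c s' (\<lambda>t s''. t \<le> 60 \<and> I (j + 1) s'')"
      using I j(1) ra unfolding I_def locally_ok_def by (auto simp: env_simps[OF e] col_def)
  next
    fix t s' assume I: "I (len a + 1) s'"
      and t: "t \<le> (nat (len a) + 1) * (60 + acost (entry ''pref'' (Reg ''a'')) + 8)"
    have "nat (len a) \<le> M" using len_le s(3,4) by simp
    then show "t \<le> 100 * (M + 1) \<and> reg s' ''ok'' = of_bool (X \<and> locally_ok (col s ''f'') a (len a + 1))"
      using I t unfolding I_def by simp
  qed (auto simp: I_def)
qed

lemma wp_check_outcome:
  assumes s: "env s" and f: "\<And>a. a \<in> {1..N} \<Longrightarrow> col s ''f'' a \<le> len a + 1"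
  shows "wp check_outcome s (\<lambda>t s'. t \<le> 500 * ((nat N + 1) * (M + 1)) \<and>
    reg s' ''ok'' = of_bool (stable (col s ''f'') \<and> (\<forall>a\<in>{1..N}. \<not> P a (pr a (col s ''f'' a)))))"
proof -
  define I :: "int \<Rightarrow> machine \<Rightarrow> bool" where "I i s' \<longleftrightarrow> reg s' ''ok'' = of_bool (\<forall>a\<in>{1..<i}. locally_ok (col s ''f'') a (len a + 1))"
    for i s'
  let ?s = "set_reg ''ok'' 1 s"
  let ?c = "Seq check_partner check_blocking"
  have e0: "env ?s" using s unfolding env_def by simp
  have iff: "(\<forall>a\<in>{1..N}. locally_ok (col s ''f'') a (len a + 1)) \<longleftrightarrow>
      stable (col s ''f'') \<and> (\<forall>a\<in>{1..N}. \<not> P a (pr a (col s ''f'' a)))"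
    using f by (rule locally_ok_iff)
  have "wp (For ''a'' (Reg ''N'') ?c) ?s (\<lambda>t s'. 3 + t \<le> 500 * ((nat N + 1) * (M + 1)) \<and>
    reg s' ''ok'' = of_bool (stable (col s ''f'') \<and> (\<forall>a\<in>{1..N}. \<not> P a (pr a (col s ''f'' a)))))"
  proof (rule wp_For[where E = N and T = "101 + 100 * (M + 1)" and I = I])
    fix s' assume "agree (For ''a'' (Reg ''N'') ?c) ?s s'"
    then show "aval (Reg ''N'') s' = N"
      using env_simps(1)[OF s] unfolding agree_def by (simp add: check_partner_def check_blocking_def)
  next
    show "I 1 ?s" unfolding I_def by simp
  next
    fix a s'
    assume ag: "agree (For ''a'' (Reg ''N'') ?c) ?s s'"
      and a: "reg s' ''a'' = a" "1 \<le> a" "a \<le> N" and I: "I a s'"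
    have e: "env s'" by (rule env_agree[OF ag e0]) (auto simp: check_partner_def check_blocking_def)
    have f': "col s' ''f'' = col s ''f''"
      using ag unfolding agree_def col_def by (simp add: check_partner_def check_blocking_def)
    show "wp ?c s' (\<lambda>t s''. t \<le> 101 + 100 * (M + 1) \<and> I (a + 1) s'')"
    proof (rule wp_SeqI[OF wp_check_partner[OF e a(1) I[unfolded I_def]]])
      fix s1 assume ag1: "agree check_partner s' s1"
        and s1: "reg s1 ''ok'' = of_bool ((\<forall>a\<in>{1..<a}. locally_ok (col s ''f'') a (len a + 1)) \<and>
            locally_ok (col s' ''f'') a 1)"
      have e1: "env s1" by (rule env_agree[OF ag1 e]) (auto simp: check_partner_def)
      have a1: "reg s1 ''a'' = a" using ag1 a(1) unfolding agree_def by (simp add: check_partner_def)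
      have f1: "col s1 ''f'' = col s' ''f''" using ag1 unfolding agree_def col_def by (simp add: check_partner_def)
      show "wp check_blocking s1 (\<lambda>t s2. t \<le> 100 * (M + 1) \<and> I (a + 1) s2)"
      proof (rule wp_weaken[OF wp_check_blocking[OF e1 a1 a(2,3) s1[folded f1]]])
        fix s2 :: machine assume "reg s2 ''ok'' = of_bool ((\<forall>a\<in>{1..<a}. locally_ok (col s ''f'') a (len a + 1)) \<and>
            locally_ok (col s1 ''f'') a (len a + 1))"
        moreover have "{1..<a + 1} = insert a {1..<a}" using a(2) by auto
        ultimately show "I (a + 1) s2" unfolding I_def f1 f' by auto
      qed simp
    qed simp_all
  next
    fix t s' assume I: "I (N + 1) s'"
      and t: "t \<le> (nat N + 1) * (101 + 100 * (M + 1) + acost (Reg ''N'') + 8)"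
    have "t \<le> 400 * ((nat N + 1) * (M + 1))" by (rule loop_time[OF t]) simp
    moreover have "{1..<N + 1} = {1..N}" by auto
    ultimately show "3 + t \<le> 500 * ((nat N + 1) * (M + 1)) \<and>
      reg s' ''ok'' = of_bool (stable (col s ''f'') \<and> (\<forall>a\<in>{1..N}. \<not> P a (pr a (col s ''f'' a))))"
      using I unfolding I_def by (simp add: iff)
  qed (use N_nonneg in \<open>auto simp: I_def check_partner_def check_blocking_def\<close>)
  then show ?thesis unfolding check_outcome_def wp_Seq wp_Assign aval.simps by (elim wp_mono) simp
qed

definition forced_count :: "(int \<Rightarrow> int) \<Rightarrow> int" where
  "forced_count f = int (card {a \<in> {1..N}. a < pr a (f a) \<and> Q a (pr a (f a))})"

text \<open>Pairing the counted agents with their partners embeds them into the ordered forced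
  pairs. For finite sets, equal cardinality means that no forced pair is missing; pairs listed with
  the larger agent first follow by symmetry of partnership.\<close>

lemma forced_count_iff:
  assumes "stable f"
  shows "forced_count f = q \<longleftrightarrow> (\<forall>a b. Q a b \<longrightarrow> b = pr a (f a))"
proof -
  let ?A = "{a \<in> {1..N}. a < pr a (f a) \<and> Q a (pr a (f a))}"
  let ?B = "{(a, b). Q a b \<and> a < b}"
  let ?g = "\<lambda>a. (a, pr a (f a))"
  have sub: "?g ` ?A \<subseteq> ?B" by auto
  have "?B \<subseteq> {1..N} \<times> {1..N}" using Q_mem by auto
  then have fin: "finite ?B" by (rule finite_subset) simp
  have "inj_on ?g ?A" by (rule inj_onI) simp
  then have card: "card (?g ` ?A) = card ?A" by (rule card_image)
  show ?thesis
  proof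
    assume "forced_count f = q"
    then have eq: "?g ` ?A = ?B" using card_subset_eq[OF fin sub] card q unfolding forced_count_def by simp
    have lt: "b = pr a (f a)" if "Q a b" "a < b" for a b
    proof -
      have "(a, b) \<in> ?g ` ?A" unfolding eq using that by simp
      then show ?thesis by auto
    qed
    have "b = pr a (f a)" if Q: "Q a b" for a b
    proof -
      consider "a < b" | "b < a" | "a = b" by linarith
      then show ?thesis
      proof cases
        case 1
        then show ?thesis using lt Q by simp
      next
        case 2
        have a: "a = pr b (f b)" using lt[OF Q_sym[OF Q] 2] .
        have ab: "a \<in> {1..N}" "b \<in> {1..N}" using Q_mem[OF Q] by auto
        have "f b \<noteq> len b + 1" using a ab pr_end[OF ab(2)] by auto
        then have "f b \<le> len b" using stableD(2)[OF assms ab(2)] by simp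
        then show ?thesis using stable_partner(5)[OF assms ab(2) _ a] by simp
      qed (use Q Q_irrefl in simp)
    qed
    then show "\<forall>a b. Q a b \<longrightarrow> b = pr a (f a)" by blast
  next
    assume all: "\<forall>a b. Q a b \<longrightarrow> b = pr a (f a)"
    have "?B \<subseteq> ?g ` ?A"
    proof
      fix p assume "p \<in> ?B"
      then obtain a b where p: "p = (a, b)" "Q a b" "a < b" by auto
      have b: "b = pr a (f a)" using all p(2) by blast
      then have "a \<in> ?A" using p Q_mem[OF p(2)] by simp
      then show "p \<in> ?g ` ?A" using b p(1) by blast
    qed
    then have "?g ` ?A = ?B" using sub by blast
    then show "forced_count f = q" using card q unfolding forced_count_def by simp
  qed
qed

lemma wp_count_outcome:
  assumes s: "env s"
  shows "wp count_outcome s (\<lambda>t s'. t \<le> 200 * ((nat N + 1) * (M + 1)) \<and>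
    reg s' ''c'' = int (card (changed (col s ''f''))) \<and> reg s' ''d'' = forced_count (col s ''f''))"
proof -
  let ?f = "col s ''f''"
  define I :: "int \<Rightarrow> machine \<Rightarrow> bool" where "I i s' \<longleftrightarrow> reg s' ''c'' = int (card {a \<in> {1..<i}. ?f a \<noteq> r a}) \<and>
      reg s' ''d'' = int (card {a \<in> {1..<i}. a < pr a (?f a) \<and> Q a (pr a (?f a))})" for i s'
  let ?s = "set_reg ''d'' 0 (set_reg ''c'' 0 s)"
  let ?c = "Seq (If (Equal (entry ''f'' (Reg ''a'')) (entry ''r1'' (Reg ''a''))) Skip
               (Assign ''c'' (Inc (Reg ''c''))))
         (If (Conj (Less (Reg ''a'') (Cell ''pref'' (Reg ''a'') (entry ''f'' (Reg ''a''))))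
               (Equal (Cell ''Q'' (Reg ''a'') (Cell ''pref'' (Reg ''a'') (entry ''f'' (Reg ''a'')))) (Num 1)))
            (Assign ''d'' (Inc (Reg ''d''))) Skip)"
  have e0: "env ?s" using s unfolding env_def by simp
  have "wp (For ''a'' (Reg ''N'') ?c) ?s (\<lambda>t s'. 6 + t \<le> 200 * ((nat N + 1) * (M + 1)) \<and>
    reg s' ''c'' = int (card (changed ?f)) \<and> reg s' ''d'' = forced_count ?f)"
  proof (rule wp_For[where E = N and T = 80 and I = I])
    fix s' assume "agree (For ''a'' (Reg ''N'') ?c) ?s s'"
    then show "aval (Reg ''N'') s' = N" using env_simps(1)[OF s] unfolding agree_def by simp
  next
    show "I 1 ?s" unfolding I_def by simp
  next
    fix a s'
    assume ag: "agree (For ''a'' (Reg ''N'') ?c) ?s s'"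
      and a: "reg s' ''a'' = a" "1 \<le> a" "a \<le> N" and I: "I a s'"
    have e: "env s'" by (rule env_agree[OF ag e0]) auto
    have f': "arr s' ''f'' a 0 = ?f a" using ag unfolding agree_def col_def by simp
    have step: "int (card {x \<in> {1..<a + 1}. R x}) = int (card {x \<in> {1..<a}. R x}) + of_bool (R a)" for R
    proof -
      have "{x \<in> {1..<a + 1}. R x} = (if R a then insert a {x \<in> {1..<a}. R x} else {x \<in> {1..<a}. R x})"
        using a(2) by (auto simp: less_le)
      moreover have "finite {x \<in> {1..<a}. R x}" by (rule finite_subset[of _ "{1..<a}"]) auto
      ultimately show ?thesis by (simp only: card_insert_if split: if_split) simp
    qed
    show "wp ?c s' (\<lambda>t s''. t \<le> 80 \<and> I (a + 1) s'')"
      using I a env_simps(4,6,9)[OF e] f' unfolding I_def step by simp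
  next
    fix t s' assume I: "I (N + 1) s'" and t: "t \<le> (nat N + 1) * (80 + acost (Reg ''N'') + 8)"
    have "t \<le> 100 * ((nat N + 1) * (M + 1))" by (rule loop_time[OF t]) simp
    moreover have "{1..<N + 1} = {1..N}" by auto
    ultimately show "6 + t \<le> 200 * ((nat N + 1) * (M + 1)) \<and>
       reg s' ''c'' = int (card (changed ?f)) \<and> reg s' ''d'' = forced_count ?f"
      using I unfolding I_def changed_def forced_count_def by simp
  qed (use N_nonneg in \<open>auto simp: I_def\<close>)
  then show ?thesis unfolding count_outcome_def wp_Seq wp_Assign aval.simps by (elim wp_mono) simp
qed

section \<open>From one guess to a verdict\<close>

definition solution :: "(int \<Rightarrow> int) \<Rightarrow> bool" where
  "solution f \<longleftrightarrow> good f \<and> int (card (changed f)) \<le> k"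

text \<open>Every \<open>f\<close> fits exactly one guess, namely its improving representatives, so
  running through all subsets of \<open>F\<close> misses no solution.\<close>

definition fits :: "int set \<Rightarrow> (int \<Rightarrow> int) \<Rightarrow> bool" where
  "fits G f \<longleftrightarrow> G = {a \<in> F. f a < r a}"

definition bits_of :: "machine \<Rightarrow> int set \<Rightarrow> bool" where
  "bits_of s G \<longleftrightarrow> (\<forall>a\<in>{1..N}. col s ''bit'' a = of_bool (a \<in> G))"

lemma outcome_le:
  assumes "propose_inv G pos hold" "a \<in> {1..N}"
  shows "outcome pos hold a \<le> len a + 1"
proof -
  have "pos a \<le> len a + 1" "hold a \<le> r a - of_bool (must_improve G a)"
    using assms unfolding propose_inv_def by auto
  moreover have "r a \<le> len a + 1" using stableD(2)[OF r assms(2)] .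
  ultimately show ?thesis unfolding outcome_def by (auto simp: of_bool_def split: if_splits)
qed

text \<open>The table computed by the machine agrees with \<open>outcome\<close> only at real
  agents; off that range the two functions may differ.\<close>

lemma stable_cong: "(\<And>a. a \<in> {1..N} \<Longrightarrow> f a = g a) \<Longrightarrow> stable f = stable g"
proof -
  have "stable g" if eq: "\<And>a. a \<in> {1..N} \<Longrightarrow> f a = g a" and f: "stable f" for f g
    unfolding stable_def
  proof (intro conjI ballI allI impI notI)
    show "g a \<in> {1..len a + 1}" if "a \<in> {1..N}" for a using eq[OF that] stableD(1,2)[OF f that] by simp
    show "g (pr a (g a)) = rk (pr a (g a)) a" if a: "a \<in> {1..N}" "g a \<le> len a" for a
      using stable_partner(3,6)[OF f a(1) _ refl] eq a by auto
    show False if "acc a b" "rk a b < g a \<and> rk b a < g b" for a b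
      using stableD(4)[OF f that(1)] that(2) eq[OF accD(1)[OF that(1)]] eq[OF accD(2)[OF that(1)]] by simp
  qed
  from this[of f g] this[of g f] show "stable f = stable g" if "\<And>a. a \<in> {1..N} \<Longrightarrow> f a = g a"
    using that by metis
qed

lemma good_cong:
  assumes "\<And>a. a \<in> {1..N} \<Longrightarrow> f a = g a"
  shows "good f = good g" "changed f = changed g"
  using stable_cong[of f g] assms Q_mem unfolding good_def changed_def by auto

text \<open>A positive answer is sound because the candidate has been tested. Failure is conclusive
  for the guess because the candidate, whenever a solution \<open>f'\<close> fits, is good and
  changes only agents that \<open>f'\<close> changes, so it satisfies the bound \<open>k\<close> if
  \<open>f'\<close> does. The barrier of the dummy agent is kept at \<open>0\<close> for the next
  guess.\<close>

lemma wp_try_guess: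
  assumes s: "env s" "col s ''hold'' 0 = 0" "bits_of s G"
  shows "wp try_guess s (\<lambda>t s'. t \<le> 2000 * ((nat N + 1) * (M + 1)) \<and> col s' ''hold'' 0 = 0 \<and>
    ((\<exists>f. solution f) \<and> reg s' ''answer'' = 1 \<or>
     (\<forall>f. fits G f \<longrightarrow> \<not> solution f) \<and> reg s' ''answer'' = reg s ''answer''))"
proof -
  let ?X = "(nat N + 1) * (M + 1)"
  have X: "1 \<le> ?X" by simp
  have b: "arr s ''bit'' x 0 = of_bool (x \<in> G)" if "x \<in> {1..N}" for x
    using s(3) that unfolding bits_of_def col_def by blast
  show ?thesis unfolding try_guess_def
  proof (rule wp_SeqI[OF wp_init_guess[OF s(1,2) b], where T' = "1500 * ?X"])
    fix s1 assume a1: "agree init_guess s s1"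
      and h1: "init_hold G (col s1 ''hold'') \<and> (\<forall>a\<in>{1..N}. col s1 ''pos'' a = r a)"
    have e1: "env s1" by (rule env_agree[OF a1 s(1)]) (auto simp: init_guess_def init_agent_def init_forced_def)
    have ans1: "reg s1 ''answer'' = reg s ''answer''"
      using a1 unfolding agree_def by (simp add: init_guess_def init_agent_def init_forced_def)
    have inv1: "propose_inv G (col s1 ''pos'') (col s1 ''hold'')" using h1 init_propose_inv by blast
    show "wp (Seq propose (Seq read_outcome (Seq check_outcome (Seq count_outcome decide_outcome)))) s1
      (\<lambda>t s'. t \<le> 1500 * ?X \<and> col s' ''hold'' 0 = 0 \<and>
        ((\<exists>f. solution f) \<and> reg s' ''answer'' = 1 \<or>
         (\<forall>f. fits G f \<longrightarrow> \<not> solution f) \<and> reg s' ''answer'' = reg s ''answer''))"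
    proof (rule wp_SeqI[OF wp_propose[OF e1 inv1], where T' = "900 * ?X"])
      fix s2 assume a2: "agree propose s1 s2"
        and h2: "propose_inv G (col s2 ''pos'') (col s2 ''hold'') \<and>
           (\<forall>a\<in>{1..N}. content (col s2 ''pos'') (col s2 ''hold'') a)"
      have e2: "env s2" by (rule env_agree[OF a2 e1]) (auto simp: propose_def propose_step_def)
      have ans2: "reg s2 ''answer'' = reg s ''answer''"
        using a2 ans1 unfolding agree_def by (simp add: propose_def propose_step_def)
      define f where "f = outcome (col s2 ''pos'') (col s2 ''hold'')"
      have h0: "col s2 ''hold'' 0 = 0" using h2 unfolding propose_inv_def by blast
      show "wp (Seq read_outcome (Seq check_outcome (Seq count_outcome decide_outcome))) s2
        (\<lambda>t s'. t \<le> 900 * ?X \<and> col s' ''hold'' 0 = 0 \<and>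
          ((\<exists>f. solution f) \<and> reg s' ''answer'' = 1 \<or>
           (\<forall>f. fits G f \<longrightarrow> \<not> solution f) \<and> reg s' ''answer'' = reg s ''answer''))"
      proof (rule wp_SeqI[OF wp_read_outcome[OF e2], where T' = "800 * ?X"])
        fix s3 assume a3: "agree read_outcome s2 s3"
          and h3: "\<forall>a\<in>{1..N}. col s3 ''f'' a = outcome (col s2 ''pos'') (col s2 ''hold'') a"
        have e3: "env s3" by (rule env_agree[OF a3 e2]) (auto simp: read_outcome_def)
        have ans3: "reg s3 ''answer'' = reg s ''answer''" "col s3 ''hold'' 0 = 0"
          using a3 ans2 h0 unfolding agree_def col_def by (simp_all add: read_outcome_def)
        let ?g = "col s3 ''f''"
        have fg: "?g a = f a" if "a \<in> {1..N}" for a using h3 that unfolding f_def by blast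
        have le: "?g a \<le> len a + 1" if "a \<in> {1..N}" for a
          using outcome_le[OF conjunct1[OF h2] that] fg[OF that] unfolding f_def by simp
        show "wp (Seq check_outcome (Seq count_outcome decide_outcome)) s3
          (\<lambda>t s'. t \<le> 800 * ?X \<and> col s' ''hold'' 0 = 0 \<and>
            ((\<exists>f. solution f) \<and> reg s' ''answer'' = 1 \<or>
             (\<forall>f. fits G f \<longrightarrow> \<not> solution f) \<and> reg s' ''answer'' = reg s ''answer''))"
        proof (rule wp_SeqI[OF wp_check_outcome[OF e3 le], where T' = "280 * ?X"])
          fix s4 assume a4: "agree check_outcome s3 s4"
            and h4: "reg s4 ''ok'' = of_bool (stable ?g \<and> (\<forall>a\<in>{1..N}. \<not> P a (pr a (?g a))))"
          have e4: "env s4"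
            by (rule env_agree[OF a4 e3]) (auto simp: check_outcome_def check_partner_def check_blocking_def)
          have ans4: "reg s4 ''answer'' = reg s ''answer''" "col s4 ''hold'' 0 = 0" "col s4 ''f'' = ?g"
            using a4 ans3 unfolding agree_def col_def
            by (simp_all add: check_outcome_def check_partner_def check_blocking_def)
          show "wp (Seq count_outcome decide_outcome) s4
            (\<lambda>t s'. t \<le> 280 * ?X \<and> col s' ''hold'' 0 = 0 \<and>
              ((\<exists>f. solution f) \<and> reg s' ''answer'' = 1 \<or>
               (\<forall>f. fits G f \<longrightarrow> \<not> solution f) \<and> reg s' ''answer'' = reg s ''answer''))"
          proof (rule wp_SeqI[OF wp_count_outcome[OF e4], where T' = "40"])
            fix s5 assume a5: "agree count_outcome s4 s5"
              and h5: "reg s5 ''c'' = int (card (changed (col s4 ''f''))) \<and>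
                reg s5 ''d'' = forced_count (col s4 ''f'')"
            have e5: "env s5" by (rule env_agree[OF a5 e4]) (auto simp: count_outcome_def)
            have ans5: "reg s5 ''answer'' = reg s ''answer''" "col s5 ''hold'' 0 = 0"
              "reg s5 ''ok'' = of_bool (stable ?g \<and> (\<forall>a\<in>{1..N}. \<not> P a (pr a (?g a))))"
              using a5 ans4 h4 unfolding agree_def col_def by (simp_all add: count_outcome_def)
            have iff: "reg s5 ''ok'' = 1 \<and> reg s5 ''d'' = q \<and> \<not> k < reg s5 ''c'' \<longleftrightarrow> solution ?g"
              using ans5(3) h5 forced_count_iff[of ?g] unfolding solution_def good_def ans4(3) by auto
            have "solution ?g" if sf: "fits G f'" "solution f'" for f'
            proof -
              have og: "good f" "changed f \<subseteq> changed f'"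
                using outcome_good[OF conjunct1[OF h2] _ _ sf(1)[unfolded fits_def]] h2 sf(2)
                unfolding solution_def f_def by blast+
              have "finite (changed f')"
                unfolding changed_def by (rule finite_subset[of _ "{1..N}"]) auto
              then have "card (changed f) \<le> card (changed f')" using og(2) by (rule card_mono)
              then have "solution f" using sf(2) og(1) unfolding solution_def by simp
              then show ?thesis using good_cong[of ?g f, OF fg] unfolding solution_def by simp
            qed
            moreover have "wp decide_outcome s5 (\<lambda>t s'. t \<le> 40 \<and> col s' ''hold'' 0 = 0 \<and>
                reg s' ''answer'' = (if solution ?g then 1 else reg s ''answer''))"
              unfolding decide_outcome_def iff[symmetric] using ans5(1,2) env_simps(2,3)[OF e5]
              by (simp add: col_def)
            ultimately show "wp decide_outcome s5 (\<lambda>t s'. t \<le> 40 \<and> col s' ''hold'' 0 = 0 \<and>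
              ((\<exists>f. solution f) \<and> reg s' ''answer'' = 1 \<or>
               (\<forall>f. fits G f \<longrightarrow> \<not> solution f) \<and> reg s' ''answer'' = reg s ''answer''))"
              by (elim wp_mono) (auto split: if_splits)
          qed (assumption?, use X in linarith)
        qed (assumption?, use X in linarith)
      qed (assumption?, use X in linarith)
    qed (assumption?, use X in linarith)
  qed (assumption?, use X in linarith)
qed

text \<open>The guesses are enumerated in colexicographic order, as by a binary counter.\<close>

definition colex :: "int set \<Rightarrow> int set \<Rightarrow> bool" where
  "colex A B \<longleftrightarrow> (\<exists>z\<in>B - A. \<forall>y>z. y \<in> A \<longleftrightarrow> y \<in> B)"

section \<open>Counting through the guesses\<close>

lemma finite_F: "finite F"
  unfolding F_def by (rule finite_subset[of _ "{1..N}"]) auto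

text \<open>\<open>G'\<close> is the binary increment of \<open>G\<close>: the lowest absent element
  \<open>x\<close> of \<open>F\<close> enters and everything below it leaves. The first claim says
  that no guess lies strictly between the two, so advancing skips nothing.\<close>

lemma colex_successor:
  assumes G: "G \<subseteq> F" and x: "x \<in> F - G" "\<forall>y\<in>F. y < x \<longrightarrow> y \<in> G"
    and G': "G' = insert x {y \<in> G. x < y}"
  shows "H \<subseteq> F \<Longrightarrow> colex H G' \<Longrightarrow> colex H G \<or> H = G" "colex H G \<Longrightarrow> colex H G'" "colex G G'"
proof -
  show "colex G G'" unfolding colex_def G' using x(1) by (intro bexI[of _ x]) auto
  show "colex H G'" if H: "colex H G"
  proof -
    obtain z where z: "z \<in> G - H" "\<And>y. z < y \<Longrightarrow> y \<in> H \<longleftrightarrow> y \<in> G" using H unfolding colex_def by blast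
    show ?thesis
    proof (cases "x < z")
      case True
      then show ?thesis unfolding colex_def G' using z by (intro bexI[of _ z]) auto
    next
      case False
      then have "z < x" using z(1) x(1) by (cases "z = x") auto
      then show ?thesis unfolding colex_def G' using z x(1) by (intro bexI[of _ x]) auto
    qed
  qed
  show "colex H G \<or> H = G" if H: "H \<subseteq> F" "colex H G'"
  proof -
    obtain z where z: "z \<in> G' - H" "\<And>y. z < y \<Longrightarrow> y \<in> H \<longleftrightarrow> y \<in> G'" using H(2) unfolding colex_def by blast
    show ?thesis
    proof (cases "z = x")
      case False
      then have "z \<in> G" "x < z" using z(1) G' by auto
      then show ?thesis unfolding colex_def using z G' by (intro disjI1 bexI[of _ z]) auto
    next
      case True
      \<comment> \<open>If \<open>x\<close> itself is the deciding place, \<open>H\<close> agrees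
        with \<open>G\<close> from \<open>x\<close> upwards, while below \<open>x\<close> the set
        \<open>G\<close> contains all of \<open>F\<close>. So \<open>H\<close> is a subset of
        \<open>G\<close>, and the largest missing element decides the order.\<close>
      have above: "y \<in> H \<longleftrightarrow> y \<in> G" if "x \<le> y" for y
        using z True x(1) that unfolding G' by (cases "y = x") auto
      have sub: "H \<subseteq> G"
      proof
        fix y assume "y \<in> H"
        then show "y \<in> G" using above[of y] x(2) H(1) by (cases "x \<le> y") auto
      qed
      show ?thesis
      proof (cases "H = G")
        case False
        then have ne: "G - H \<noteq> {}" using sub by blast
        have fin: "finite (G - H)" using finite_subset[OF G finite_F] by simp
        define y where "y = Max (G - H)"
        have "y \<in> G - H" unfolding y_def using Max_in[OF fin ne] .
        moreover have "w \<in> H \<longleftrightarrow> w \<in> G" if "y < w" for w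
          using Max_ge[OF fin, of w] that sub unfolding y_def by auto
        ultimately show ?thesis unfolding colex_def by blast
      qed simp
    qed
  qed
qed

text \<open>\<open>G\<close> itself is counted, so the value is positive as long as the current
  guess is still to be tried.\<close>

definition remaining :: "int set \<Rightarrow> nat" where
  "remaining G = card {H. H \<subseteq> F \<and> \<not> colex H G}"

lemma remaining_le: "remaining G \<le> 2 ^ card F"
  unfolding remaining_def using card_mono[of "Pow F" "{H. H \<subseteq> F \<and> \<not> colex H G}"] finite_F
  by (auto simp: card_Pow)

lemma colex_irrefl: "\<not> colex G G"
  unfolding colex_def by blast

lemma remaining_step:
  assumes "G \<subseteq> F" and "\<And>H. colex H G \<Longrightarrow> colex H G'" "colex G G'"
  shows "Suc (remaining G') \<le> remaining G"
proof -
  have fin: "finite {H. H \<subseteq> F \<and> \<not> colex H G}" by (rule finite_subset[of _ "Pow F"]) (auto simp: finite_F)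
  have "{H. H \<subseteq> F \<and> \<not> colex H G'} \<subset> {H. H \<subseteq> F \<and> \<not> colex H G}" using assms colex_irrefl by blast
  from psubset_card_mono[OF fin this] show ?thesis unfolding remaining_def by simp
qed

text \<open>The carry runs through all agents in order. Resetting the cells of agents outside
  \<open>F\<close> is harmless, since they represent absent elements; a linear scan is affordable
  next to the cost of trying a guess.\<close>

lemma wp_next_guess:
  assumes s: "env s" "G \<subseteq> F" "bits_of s G"
  shows "wp next_guess s (\<lambda>t s'. t \<le> 100 * ((nat N + 1) * (M + 1)) \<and>
    (reg s' ''go'' = 0 \<and> G = F \<or>
     reg s' ''go'' = reg s ''go'' \<and> (\<exists>x. x \<in> F - G \<and> (\<forall>y\<in>F. y < x \<longrightarrow> y \<in> G) \<and>
       bits_of s' (insert x {y \<in> G. x < y}))))"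
proof -
  define I :: "machine \<Rightarrow> bool" where "I s' \<longleftrightarrow> 1 \<le> reg s' ''a'' \<and> reg s' ''a'' \<le> N + 1 \<and>
    (\<forall>y\<in>F. y < reg s' ''a'' \<longrightarrow> y \<in> G) \<and> bits_of s' {y \<in> G. reg s' ''a'' \<le> y}" for s'
  define \<phi> :: "machine \<Rightarrow> nat" where "\<phi> s' = 50 * nat (N + 1 - reg s' ''a'')" for s'
  let ?b = "Conj (Neg (Less (Reg ''N'') (Reg ''a'')))
              (Neg (Conj (Conj (Less (Reg ''a'') (entry ''M1'' (Reg ''a'')))
                           (Equal (Cell ''P'' (Reg ''a'') (entry ''M1'' (Reg ''a''))) (Num 1)))
                     (Equal (entry ''bit'' (Reg ''a'')) (Num 0))))"
  let ?c = "Seq (put ''bit'' (Reg ''a'') (Num 0)) (Assign ''a'' (Inc (Reg ''a'')))"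
  let ?d = "If (Less (Reg ''N'') (Reg ''a'')) (Assign ''go'' (Num 0)) (put ''bit'' (Reg ''a'') (Num 1))"
  let ?s = "set_reg ''a'' 1 s"
  have e0: "env ?s" using s unfolding env_def by simp
  have "wp (While ?b ?c) ?s (\<lambda>t s'. t \<le> 50 * nat N + 30 \<and> I s' \<and> reg s' ''go'' = reg s ''go'' \<and>
      (N < reg s' ''a'' \<or> reg s' ''a'' \<in> F - G))"
  proof (rule wp_While[where I = I and \<phi> = \<phi>])
    show "I ?s" using s(3) N_nonneg unfolding I_def bits_of_def F_def by (auto simp: col_def)
  next
    fix s' assume ag: "agree ?c ?s s'" and I: "I s'" and b: "bval ?b s'"
    have e: "env s'" by (rule env_agree[OF ag e0]) auto
    define a where "a = reg s' ''a''"
    have a: "1 \<le> a" "a \<le> N" using I b env_simps(1)[OF e] unfolding I_def a_def by auto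
    have bita: "col s' ''bit'' a = of_bool (a \<in> G)" using I a unfolding I_def bits_of_def a_def by auto
    have "a \<in> F \<longrightarrow> a \<in> G"
      using b a bita env_simps[OF e] unfolding F_def by (auto simp: a_def[symmetric] col_def split: if_splits)
    then have "\<forall>y\<in>F. y < a + 1 \<longrightarrow> y \<in> G" using I unfolding I_def a_def by (auto simp: zless_add1_eq)
    then show "wp ?c s' (\<lambda>t s''. I s'' \<and> 1 + bcost ?b + t + \<phi> s'' \<le> \<phi> s')"
      using I a unfolding I_def bits_of_def \<phi>_def by (auto simp: a_def[symmetric] col_def)
  next
    fix t s' assume ag: "agree ?c ?s s'" and I: "I s'" and b: "\<not> bval ?b s'"
      and t: "t \<le> \<phi> ?s + 1 + bcost ?b"
    have e: "env s'" by (rule env_agree[OF ag e0]) auto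
    define a where "a = reg s' ''a''"
    have "a \<in> F - G" if "a \<le> N"
    proof -
      have a: "1 \<le> a" using I unfolding I_def a_def by simp
      have "col s' ''bit'' a = of_bool (a \<in> G)" using I a that unfolding I_def bits_of_def a_def by auto
      then show ?thesis
        using b a that env_simps[OF e] unfolding F_def by (auto simp: a_def[symmetric] col_def split: if_splits)
    qed
    moreover have "reg s' ''go'' = reg s ''go''" using ag unfolding agree_def by simp
    ultimately show "t \<le> 50 * nat N + 30 \<and> I s' \<and> reg s' ''go'' = reg s ''go'' \<and>
      (N < reg s' ''a'' \<or> reg s' ''a'' \<in> F - G)"
      using t I unfolding \<phi>_def a_def by auto
  qed
  then have loop: "wp (Seq (Assign ''a'' (Num 1)) (While ?b ?c)) s (\<lambda>t s'. t \<le> 50 * nat N + 40 \<and>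
      I s' \<and> reg s' ''go'' = reg s ''go'' \<and> (N < reg s' ''a'' \<or> reg s' ''a'' \<in> F - G))"
    unfolding wp_Seq wp_Assign by (simp, elim wp_mono) auto
  have X: "nat N + 1 \<le> (nat N + 1) * (M + 1)" by simp
  \<comment> \<open>The sequence is bracketed to the left so that the whole scan is one component.
    Both bracketings cost the same time.\<close>
  have "wp (Seq (Seq (Assign ''a'' (Num 1)) (While ?b ?c)) ?d) s
    (\<lambda>t s'. t \<le> 50 * nat N + 80 \<and> (reg s' ''go'' = 0 \<and> G = F \<or>
     reg s' ''go'' = reg s ''go'' \<and> (\<exists>x. x \<in> F - G \<and> (\<forall>y\<in>F. y < x \<longrightarrow> y \<in> G) \<and>
       bits_of s' (insert x {y \<in> G. x < y}))))"
  proof (rule wp_SeqI[OF loop, where T' = 30])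
    fix s' assume ag: "agree (Seq (Assign ''a'' (Num 1)) (While ?b ?c)) s s'"
      and h: "I s' \<and> reg s' ''go'' = reg s ''go'' \<and> (N < reg s' ''a'' \<or> reg s' ''a'' \<in> F - G)"
    have e: "env s'" by (rule env_agree[OF ag s(1)]) auto
    show "wp ?d s' (\<lambda>t s'. t \<le> 30 \<and> (reg s' ''go'' = 0 \<and> G = F \<or>
     reg s' ''go'' = reg s ''go'' \<and> (\<exists>x. x \<in> F - G \<and> (\<forall>y\<in>F. y < x \<longrightarrow> y \<in> G) \<and>
       bits_of s' (insert x {y \<in> G. x < y}))))"
    proof (cases "N < reg s' ''a''")
      case True
      then have "F \<subseteq> G" using h unfolding I_def F_def by auto
      then have "G = F" using s(2) by blast
      then show ?thesis using True env_simps(1)[OF e] by simp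
    next
      case False
      define x where "x = reg s' ''a''"
      have x: "x \<in> F - G" "\<forall>y\<in>F. y < x \<longrightarrow> y \<in> G" "bits_of s' {y \<in> G. x \<le> y}"
        using h False unfolding I_def x_def by auto
      have "bits_of (set_arr ''bit'' x 0 1 s') (insert x {y \<in> G. x < y})"
        using x(1,3) unfolding bits_of_def by (auto simp: col_def less_le)
      then show ?thesis using x(1,2) False h env_simps(1)[OF e] by (auto simp: x_def[symmetric])
    qed
  qed simp
  then have "wp next_guess s (\<lambda>t s'. t \<le> 50 * nat N + 80 \<and> (reg s' ''go'' = 0 \<and> G = F \<or>
     reg s' ''go'' = reg s ''go'' \<and> (\<exists>x. x \<in> F - G \<and> (\<forall>y\<in>F. y < x \<longrightarrow> y \<in> G) \<and>
       bits_of s' (insert x {y \<in> G. x < y}))))"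
    unfolding next_guess_def wp_Seq wp_Assign by (elim wp_mono) simp
  then show ?thesis by (elim wp_mono) (use X in auto)
qed

lemma wp_search:
  assumes s: "env s" "\<And>x. col s ''hold'' x = 0" "\<And>x. col s ''bit'' x = 0" "reg s ''answer'' = 0"
  shows "wp search s (\<lambda>t s'. t \<le> 3000 * (2 ^ card F * ((nat N + 1) * (M + 1))) \<and>
    reg s' ''answer'' = of_bool (\<exists>f. solution f))"
proof -
  let ?X = "(nat N + 1) * (M + 1)"
  have X: "1 \<le> ?X" by simp
  let ?b = "Equal (Reg ''go'') (Num 1)" and ?c = "Seq try_guess next_guess"
  let ?s = "set_reg ''go'' 1 s"
  \<comment> \<open>While the answer is 0, every guess before \<open>G\<close> has been found to
    have no solution. An answer 1 is never withdrawn.\<close>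
  define J :: "machine \<Rightarrow> int set \<Rightarrow> bool" where "J s' G \<longleftrightarrow> G \<subseteq> F \<and> bits_of s' G \<and>
      (reg s' ''answer'' = 0 \<longrightarrow> (\<forall>f H. H \<subseteq> F \<longrightarrow> colex H G \<longrightarrow> fits H f \<longrightarrow> \<not> solution f))" for s' G
  define I :: "machine \<Rightarrow> bool" where "I s' \<longleftrightarrow> col s' ''hold'' 0 = 0 \<and>
     (reg s' ''answer'' = 0 \<or> reg s' ''answer'' = 1 \<and> (\<exists>f. solution f)) \<and>
     (reg s' ''go'' = 1 \<and> (\<exists>G. J s' G) \<or>
      reg s' ''go'' = 0 \<and> (reg s' ''answer'' = 0 \<longrightarrow> (\<forall>f. \<not> solution f)))" for s'
  define \<phi> :: "machine \<Rightarrow> nat" where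
    \<comment> \<open>The potential must be a function of the machine state, so the current guess is
      recovered from the stored bits; they determine it uniquely among the subsets of
      \<open>F\<close>.\<close>
    "\<phi> s' = (if reg s' ''go'' = 1 then remaining (THE G. J s' G) * (2500 * ?X) else 0)" for s'
  have J_unique: "G = H" if "J s' G" "J s' H" for s' G H
  proof -
    have "a \<in> G \<longleftrightarrow> a \<in> H" for a
    proof (cases "a \<in> {1..N}")
      case True
      have "(of_bool (a \<in> G) :: int) = of_bool (a \<in> H)"
        using that True unfolding J_def bits_of_def by metis
      then show ?thesis by (simp split: if_splits add: of_bool_def)
    next
      case False
      then show ?thesis using that unfolding J_def F_def by blast
    qed
    then show ?thesis by blast
  qed
  have \<phi>_J: "\<phi> s' = remaining G * (2500 * ?X)" if "J s' G" "reg s' ''go'' = 1" for s' G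
  proof -
    have "(THE G. J s' G) = G" by (rule the_equality[of "J s'", OF that(1)]) (rule J_unique[OF _ that(1)])
    then show ?thesis unfolding \<phi>_def using that(2) by simp
  qed
  have e0: "env ?s" using s(1) unfolding env_def by simp
  have J0: "J ?s {}" using s(3) unfolding J_def bits_of_def colex_def by (auto simp: col_def)
  have "wp (While ?b ?c) ?s (\<lambda>t s'. 3 + t \<le> 3000 * (2 ^ card F * ?X) \<and>
    reg s' ''answer'' = of_bool (\<exists>f. solution f))"
  proof (rule wp_While[where I = I and \<phi> = \<phi>])
    show "I ?s" using s(2,4) J0 unfolding I_def by (auto simp: col_def)
  next
    fix s' assume ag: "agree ?c ?s s'" and I: "I s'" and b: "bval ?b s'"
    have e: "env s'"
      by (rule env_agree[OF ag e0]) (auto simp: try_guess_def init_guess_def init_agent_def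
          init_forced_def propose_def propose_step_def read_outcome_def check_outcome_def
          check_partner_def check_blocking_def count_outcome_def decide_outcome_def next_guess_def)
    have go: "reg s' ''go'' = 1" using b by simp
    then obtain G where G: "J s' G" using I unfolding I_def by auto
    have h0: "col s' ''hold'' 0 = 0" using I unfolding I_def by blast
    have Gp: "G \<subseteq> F" "bits_of s' G" using G unfolding J_def by blast+
    have "wp ?c s' (\<lambda>t s''. t \<le> 2200 * ?X \<and> I s'' \<and>
      (reg s'' ''go'' = 0 \<or> (\<exists>H. J s'' H \<and> Suc (remaining H) \<le> remaining G)))"
    proof (rule wp_SeqI[OF wp_try_guess[OF e h0 Gp(2)], where T' = "100 * ?X"])
      fix s1 assume a1: "agree try_guess s' s1"
        and h1: "col s1 ''hold'' 0 = 0 \<and>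
          ((\<exists>f. solution f) \<and> reg s1 ''answer'' = 1 \<or>
           (\<forall>f. fits G f \<longrightarrow> \<not> solution f) \<and> reg s1 ''answer'' = reg s' ''answer'')"
      have e1: "env s1"
        by (rule env_agree[OF a1 e]) (auto simp: try_guess_def init_guess_def init_agent_def
          init_forced_def propose_def propose_step_def read_outcome_def check_outcome_def
          check_partner_def check_blocking_def count_outcome_def decide_outcome_def)
      have go1: "reg s1 ''go'' = 1" and bit1: "arr s1 ''bit'' = arr s' ''bit''"
        using a1 go unfolding agree_def
        by (simp_all add: try_guess_def init_guess_def init_agent_def
          init_forced_def propose_def propose_step_def read_outcome_def check_outcome_def
          check_partner_def check_blocking_def count_outcome_def decide_outcome_def)
      have b1: "bits_of s1 G" using Gp(2) bit1 unfolding bits_of_def col_def by simp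
      have ans1: "reg s1 ''answer'' = 0 \<or> reg s1 ''answer'' = 1 \<and> (\<exists>f. solution f)"
        using h1 I unfolding I_def by auto
      have none: "\<not> solution f" if "reg s1 ''answer'' = 0" "H \<subseteq> F" "colex H G \<or> H = G" "fits H f" for f H
        using that h1 G unfolding J_def by auto
      show "wp next_guess s1 (\<lambda>t s''. t \<le> 100 * ?X \<and> I s'' \<and>
        (reg s'' ''go'' = 0 \<or> (\<exists>H. J s'' H \<and> Suc (remaining H) \<le> remaining G)))"
      proof (rule wp_weaken[OF wp_next_guess[OF e1 Gp(1) b1]])
        fix s2 assume a2: "agree next_guess s1 s2"
          and h2: "reg s2 ''go'' = 0 \<and> G = F \<or>
            reg s2 ''go'' = reg s1 ''go'' \<and> (\<exists>x. x \<in> F - G \<and> (\<forall>y\<in>F. y < x \<longrightarrow> y \<in> G) \<and>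
              bits_of s2 (insert x {y \<in> G. x < y}))"
        have ans2: "reg s2 ''answer'' = reg s1 ''answer''" "col s2 ''hold'' 0 = 0"
          using a2 h1 unfolding agree_def col_def by (simp_all add: next_guess_def)
        from h2 show "I s2 \<and> (reg s2 ''go'' = 0 \<or> (\<exists>H. J s2 H \<and> Suc (remaining H) \<le> remaining G))"
        proof
          assume h: "reg s2 ''go'' = 0 \<and> G = F"
          have "\<not> solution f" if "reg s2 ''answer'' = 0" for f
          proof -
            define H where "H = {a \<in> F. f a < r a}"
            have H: "H \<subseteq> F" "fits H f" unfolding H_def fits_def by auto
            \<comment> \<open>\<open>F\<close> is the last guess in the order, so the guess fitted
              by any \<open>f\<close> has been tried by now.\<close>
            have "colex H F \<or> H = F"
            proof (cases "H = F")
              case False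
              then have ne: "F - H \<noteq> {}" using H(1) by blast
              have fin: "finite (F - H)" using finite_F by simp
              have "w \<in> H \<longleftrightarrow> w \<in> F" if "Max (F - H) < w" for w
                using Max_ge[OF fin, of w] that H(1) by auto
              then show ?thesis unfolding colex_def using Max_in[OF fin ne] by blast
            qed simp
            then show ?thesis using none[OF _ H(1) _ H(2)] that ans2(1) h by simp
          qed
          then show ?thesis using h ans1 ans2 unfolding I_def by simp
        next
          assume "reg s2 ''go'' = reg s1 ''go'' \<and> (\<exists>x. x \<in> F - G \<and> (\<forall>y\<in>F. y < x \<longrightarrow> y \<in> G) \<and>
              bits_of s2 (insert x {y \<in> G. x < y}))"
          then obtain x where go2: "reg s2 ''go'' = 1" and x: "x \<in> F - G" "\<forall>y\<in>F. y < x \<longrightarrow> y \<in> G"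
            and bits2: "bits_of s2 (insert x {y \<in> G. x < y})" using go1 by auto
          define G' where "G' = insert x {y \<in> G. x < y}"
          note cs = colex_successor[OF Gp(1) x G'_def]
          have "Suc (remaining G') \<le> remaining G" using remaining_step[OF Gp(1) cs(2,3)] .
          moreover have "J s2 G'" unfolding J_def
          proof (intro conjI impI allI)
            show "G' \<subseteq> F" using Gp(1) x(1) unfolding G'_def by blast
            show "bits_of s2 G'" using bits2 unfolding G'_def .
            show "\<not> solution f" if "reg s2 ''answer'' = 0" "H \<subseteq> F" "colex H G'" "fits H f" for f H
              using none[OF _ that(2) cs(1)[OF that(2,3)] that(4)] that(1) ans2(1) by simp
          qed
          ultimately show ?thesis using go2 ans1 ans2 unfolding I_def by auto
        qed
      qed simp
    qed (assumption?, use X in linarith)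
    then show "wp ?c s' (\<lambda>t s''. I s'' \<and> 1 + bcost ?b + t + \<phi> s'' \<le> \<phi> s')"
    proof (rule wp_mono)
      fix t :: nat and s''
      assume h: "t \<le> 2200 * ?X \<and> I s'' \<and>
        (reg s'' ''go'' = 0 \<or> (\<exists>H. J s'' H \<and> Suc (remaining H) \<le> remaining G))"
      have "\<phi> s'' + 2500 * ?X \<le> \<phi> s'"
      proof (cases "reg s'' ''go'' = 0")
        case True
        have "G \<in> {H. H \<subseteq> F \<and> \<not> colex H G}" using Gp(1) colex_irrefl by blast
        moreover have "finite {H. H \<subseteq> F \<and> \<not> colex H G}"
          by (rule finite_subset[of _ "Pow F"]) (auto simp: finite_F)
        ultimately have "1 \<le> remaining G" unfolding remaining_def
          by (metis One_nat_def Suc_leI card_gt_0_iff empty_iff)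
        then have "1 * (2500 * ?X) \<le> remaining G * (2500 * ?X)" by (rule mult_le_mono1)
        then show ?thesis using True \<phi>_J[OF G go] unfolding \<phi>_def by simp
      next
        case False
        then obtain H where H: "J s'' H" "Suc (remaining H) \<le> remaining G" and go'': "reg s'' ''go'' = 1"
          using h unfolding I_def by auto
        have "Suc (remaining H) * (2500 * ?X) \<le> remaining G * (2500 * ?X)" using H(2) by (rule mult_le_mono1)
        then show ?thesis using \<phi>_J[OF G go] \<phi>_J[OF H(1) go''] by simp
      qed
      then show "I s'' \<and> 1 + bcost ?b + t + \<phi> s'' \<le> \<phi> s'" using h X by simp
    qed
  next
    fix t s' assume ag: "agree ?c ?s s'" and I: "I s'" and b: "\<not> bval ?b s'"
      and t: "t \<le> \<phi> ?s + 1 + bcost ?b"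
    have "\<phi> ?s = remaining {} * (2500 * ?X)" using \<phi>_J[OF J0] by simp
    also have "\<dots> \<le> 2 ^ card F * (2500 * ?X)" using remaining_le by (rule mult_le_mono1)
    also have "\<dots> = 2500 * (2 ^ card F * ?X)" by (rule mult.left_commute)
    finally have "\<phi> ?s \<le> 2500 * (2 ^ card F * ?X)" .
    moreover have "1 * 1 \<le> 2 ^ card F * ?X" by (intro mult_le_mono) auto
    moreover have "t \<le> \<phi> ?s + 4" using t by simp
    ultimately have "3 + t \<le> 3000 * (2 ^ card F * ?X)" by linarith
    then show "3 + t \<le> 3000 * (2 ^ card F * ?X) \<and> reg s' ''answer'' = of_bool (\<exists>f. solution f)"
      using I b unfolding I_def by auto
  qed
  then show ?thesis unfolding search_def wp_Seq wp_Assign aval.simps by (elim wp_mono) simp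
qed

end

section \<open>Encoded instances\<close>

locale encoded_prefs =
  fixes n :: nat and Ac :: "nat \<Rightarrow> nat set" and R :: "nat \<Rightarrow> (nat \<times> nat) set"
    and prefs :: "nat \<Rightarrow> nat list"
  assumes roommates: "roommates {1..2 * n} Ac R"
    and prefs: "represents_prefs {1..2 * n} Ac R prefs"
begin

section \<open>Preference lists as integer arrays\<close>

abbreviation A :: "nat set" where "A \<equiv> {1..2 * n}"

definition N :: int where "N = int (2 * n)"

text \<open>The input array already has the required form: column \<open>0\<close> contains the
  length, and the cell behind the last entry is \<open>0\<close>, the dummy partner at rank
  \<open>len a + 1\<close>.\<close>

definition pr :: "int \<Rightarrow> int \<Rightarrow> int" where "pr = prefs_array A prefs"

definition len :: "int \<Rightarrow> int" where "len a = pr a 0"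

lemma agent_cases:
  assumes "a \<in> {1..N}"
  obtains x where "x \<in> A" "a = int x"
proof
  show "nat a \<in> A" "a = int (nat a)" using assms unfolding N_def by auto
qed

lemma int_agent: "int x \<in> {1..N} \<longleftrightarrow> x \<in> A"
  unfolding N_def by auto

lemma Ac_props:
  assumes "x \<in> A"
  shows "Ac x \<subseteq> A - {x}" "y \<in> Ac x \<Longrightarrow> x \<in> Ac y" "finite (Ac x)"
proof -
  show 1: "Ac x \<subseteq> A - {x}" using assms roommates unfolding roommates_def by blast
  then show "finite (Ac x)" by (rule finite_subset) simp
  show "x \<in> Ac y" if "y \<in> Ac x" using that 1 assms roommates unfolding roommates_def by blast
qed

lemma R_props:
  assumes "x \<in> A"
  shows "(y, y) \<notin> R x" "(y, z) \<in> R x \<Longrightarrow> (z, y) \<notin> R x"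
proof -
  have "trans (R x)" "irrefl (R x)"
    using assms roommates unfolding roommates_def strict_linear_order_on_def by blast+
  then show "(y, y) \<notin> R x" "(y, z) \<in> R x \<Longrightarrow> (z, y) \<notin> R x" by (meson UNIV_I irrefl_onD transD)+
qed

lemma prefs_props:
  assumes "x \<in> A"
  shows "set (prefs x) = Ac x"
    "i < j \<Longrightarrow> j < length (prefs x) \<Longrightarrow> (prefs x ! i, prefs x ! j) \<in> R x"
    "distinct (prefs x)"
proof -
  show "set (prefs x) = Ac x" using assms prefs unfolding represents_prefs_def by blast
  show R: "(prefs x ! i, prefs x ! j) \<in> R x" if "i < j" "j < length (prefs x)" for i j
    using that assms prefs unfolding represents_prefs_def sorted_wrt_iff_nth_less by blast
  show "distinct (prefs x)" unfolding distinct_conv_nth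
  proof (intro allI impI)
    fix i j assume ij: "i < length (prefs x)" "j < length (prefs x)" "i \<noteq> j"
    show "prefs x ! i \<noteq> prefs x ! j"
    proof (cases "i < j")
      case True
      then show ?thesis using R[OF True ij(2)] R_props(1)[OF assms] by auto
    next
      case False
      then have "j < i" using ij(3) by simp
      then show ?thesis using R[OF _ ij(1)] R_props(1)[OF assms] by metis
    qed
  qed
qed

lemma len_eq: "x \<in> A \<Longrightarrow> len (int x) = int (length (prefs x))"
  unfolding len_def pr_def prefs_array_def by simp

lemma pr_nth: "x \<in> A \<Longrightarrow> i < length (prefs x) \<Longrightarrow> pr (int x) (int i + 1) = int (prefs x ! i)"
  unfolding pr_def prefs_array_def by (simp add: Let_def nat_add_distrib)

lemma index_cases:
  assumes "x \<in> A" "j \<in> {1..len (int x)}"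
  obtains i where "i < length (prefs x)" "j = int i + 1" "pr (int x) j = int (prefs x ! i)"
proof
  show 1: "nat (j - 1) < length (prefs x)" and 2: "j = int (nat (j - 1)) + 1"
    using assms len_eq by auto
  show "pr (int x) j = int (prefs x ! nat (j - 1))" using pr_nth[OF assms(1) 1] 2 by simp
qed

lemma len_nonneg: "a \<in> {1..N} \<Longrightarrow> 0 \<le> len a"
  by (elim agent_cases) (simp add: len_eq)

lemma pr_inj:
  assumes "a \<in> {1..N}" "i \<in> {1..len a}" "j \<in> {1..len a}" "pr a i = pr a j"
  shows "i = j"
proof -
  obtain x where x: "x \<in> A" "a = int x" using agent_cases[OF assms(1)] by blast
  obtain i' where i: "i' < length (prefs x)" "i = int i' + 1" "pr (int x) i = int (prefs x ! i')"
    using index_cases[OF x(1)] assms(2) x(2) by blast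
  obtain j' where j: "j' < length (prefs x)" "j = int j' + 1" "pr (int x) j = int (prefs x ! j')"
    using index_cases[OF x(1)] assms(3) x(2) by blast
  have "prefs x ! i' = prefs x ! j'" using i j assms(4) x(2) by simp
  then show ?thesis using prefs_props(3)[OF x(1)] i j by (simp add: nth_eq_iff_index_eq)
qed

lemma pr_Ac:
  assumes "x \<in> A"
  shows "(\<exists>j\<in>{1..len (int x)}. pr (int x) j = b) \<longleftrightarrow> (\<exists>y\<in>Ac x. b = int y)"
proof
  assume "\<exists>j\<in>{1..len (int x)}. pr (int x) j = b"
  then obtain j where j: "j \<in> {1..len (int x)}" "pr (int x) j = b" by blast
  obtain i where "i < length (prefs x)" "pr (int x) j = int (prefs x ! i)"
    using index_cases[OF assms j(1)] by blast
  then show "\<exists>y\<in>Ac x. b = int y" using prefs_props(1)[OF assms] j(2) nth_mem by fastforce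
next
  assume "\<exists>y\<in>Ac x. b = int y"
  then obtain y where y: "y \<in> set (prefs x)" "b = int y" using prefs_props(1)[OF assms] by blast
  then obtain i where i: "i < length (prefs x)" "prefs x ! i = y" unfolding in_set_conv_nth by blast
  then have "int i + 1 \<in> {1..len (int x)}" "pr (int x) (int i + 1) = b"
    using len_eq[OF assms] pr_nth[OF assms i(1)] y(2) by auto
  then show "\<exists>j\<in>{1..len (int x)}. pr (int x) j = b" by blast
qed

lemma length_prefs: "x \<in> A \<Longrightarrow> length (prefs x) = card (Ac x)"
  using prefs_props(1,3)[of x] distinct_card[of "prefs x"] by simp

lemma acceptable_pairs_iff:
  "{x, y} \<in> acceptable_pairs A Ac \<longleftrightarrow> x \<in> A \<and> y \<in> Ac x"
proof
  assume "{x, y} \<in> acceptable_pairs A Ac"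
  then obtain a b where ab: "{x, y} = {a, b}" "a \<in> A" "b \<in> Ac a" unfolding acceptable_pairs_def by blast
  then have "x = a \<and> y = b \<or> x = b \<and> y = a" by (auto simp: doubleton_eq_iff)
  then show "x \<in> A \<and> y \<in> Ac x" using ab(2,3) Ac_props[OF ab(2)] by auto
next
  assume "x \<in> A \<and> y \<in> Ac x"
  then show "{x, y} \<in> acceptable_pairs A Ac"
    unfolding acceptable_pairs_def using Ac_props[of x] by blast
qed

lemma acceptable_pairs_cases:
  assumes "e \<in> acceptable_pairs A Ac"
  obtains x y where "e = {x, y}" "x \<in> A" "y \<in> A" "y \<in> Ac x" "x \<in> Ac y" "x \<noteq> y"
  using assms Ac_props(1) unfolding acceptable_pairs_def by blast

lemma acceptable_pairs_other:
  assumes "e \<in> acceptable_pairs A Ac" "x \<in> e"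
  shows "\<exists>y. e = {x, y}"
proof -
  obtain u v where "e = {u, v}" using acceptable_pairs_cases[OF assms(1)] by metis
  then show ?thesis using assms(2) by auto
qed

lemma finite_acceptable_pairs: "finite (acceptable_pairs A Ac)"
  by (rule finite_subset[of _ "Pow A"]) (auto simp: acceptable_pairs_def)

lemma len_le_pairs:
  assumes "a \<in> {1..N}"
  shows "nat (len a) \<le> card (acceptable_pairs A Ac)"
proof -
  obtain x where x: "x \<in> A" "a = int x" using agent_cases[OF assms] by blast
  have "inj_on (\<lambda>y. {x, y}) (Ac x)" by (rule inj_onI) (auto simp: doubleton_eq_iff)
  then have "card (Ac x) \<le> card (acceptable_pairs A Ac)"
    using x(1) acceptable_pairs_iff by (intro card_inj_on_le[OF _ _ finite_acceptable_pairs]) auto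
  then show ?thesis using length_prefs[OF x(1)] len_eq[OF x(1)] x(2) by simp
qed

text \<open>Double counting: an acceptable pair occurs on two lists, and the comparison
  \<open>x < y\<close> tells the two occurrences apart.\<close>

lemma len_total: "(\<Sum>a\<in>{1..N}. nat (len a)) \<le> 2 * card (acceptable_pairs A Ac)"
proof -
  have "{1..N} = int ` A"
  proof
    show "{1..N} \<subseteq> int ` A" using agent_cases by blast
    show "int ` A \<subseteq> {1..N}" using int_agent by blast
  qed
  then have "(\<Sum>a\<in>{1..N}. nat (len a)) = (\<Sum>x\<in>A. nat (len (int x)))"
    by (simp add: sum.reindex)
  also have "\<dots> = (\<Sum>x\<in>A. card (Ac x))"
    by (rule sum.cong) (simp_all add: len_eq length_prefs)
  also have "\<dots> = card (SIGMA x:A. Ac x)" using Ac_props(3) by simp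
  also have "\<dots> \<le> card (acceptable_pairs A Ac \<times> (UNIV :: bool set))"
  proof (rule card_inj_on_le[where f = "\<lambda>(x, y). ({x, y}, x < y)"])
    show "inj_on (\<lambda>(x, y). ({x, y}, x < y)) (SIGMA x:A. Ac x)"
    proof (rule inj_onI, clarify)
      fix x y u v :: nat assume "{x, y} = {u, v}" "(x < y) = (u < v)"
      then show "x = u \<and> y = v" unfolding doubleton_eq_iff by (metis less_asym' linorder_neqE_nat)
    qed
    show "(\<lambda>(x, y). ({x, y}, x < y)) ` (SIGMA x:A. Ac x) \<subseteq> acceptable_pairs A Ac \<times> UNIV"
    proof
      fix p assume "p \<in> (\<lambda>(x, y). ({x, y}, x < y)) ` (SIGMA x:A. Ac x)"
      then obtain x y where "x \<in> A" "y \<in> Ac x" "p = ({x, y}, x < y)" by auto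
      then show "p \<in> acceptable_pairs A Ac \<times> UNIV" using acceptable_pairs_iff[of x y] by blast
    qed
  qed (rule finite_cartesian_product, rule finite_acceptable_pairs, simp)
  also have "\<dots> = card (acceptable_pairs A Ac) * card (UNIV :: bool set)"
    by (rule card_cartesian_product)
  also have "\<dots> = 2 * card (acceptable_pairs A Ac)" by (simp add: card_UNIV_bool)
  finally show ?thesis .
qed

end

text \<open>\<open>rk\<close> is constrained only where its values are known, so that it can later
  be instantiated with the array present in memory after the ranks have been computed.\<close>

locale encoded_ranks = encoded_prefs +
  fixes rk :: "int \<Rightarrow> int \<Rightarrow> int"
  assumes rk: "a \<in> {1..N} \<Longrightarrow> j \<in> {1..len a} \<Longrightarrow> rk a (pr a j) = j"
    and rk_unmatched: "a \<in> {1..N} \<Longrightarrow> rk a 0 = len a + 1"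
    and rk_zero: "rk 0 a = 0"

sublocale encoded_ranks \<subseteq> sr_ranks N len pr rk
proof
  fix a j assume a: "a \<in> {1..N}"
  obtain x where x: "x \<in> A" "a = int x" using agent_cases[OF a] by blast
  show "0 \<le> len a" using len_nonneg[OF a] .
  show "pr a (len a + 1) = 0" unfolding x(2) len_eq[OF x(1)] by (simp add: pr_def prefs_array_def Let_def)
  show "rk a 0 = len a + 1" using rk_unmatched[OF a] .
  assume j: "j \<in> {1..len a}"
  obtain y where y: "y \<in> Ac x" "pr a j = int y" using pr_Ac[OF x(1), of "pr a j"] j x(2) by blast
  have yA: "y \<in> A" "y \<noteq> x" using y(1) Ac_props(1)[OF x(1)] by auto
  then have yN: "int y \<in> {1..N}" using int_agent by blast
  then show "pr a j \<in> {1..N} - {a}" using y(2) x(2) yA(2) by simp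
  show "rk a (pr a j) = j" using rk[OF a j] .
  fix b assume b: "b = pr a j"
  have "x \<in> Ac y" using Ac_props(2)[OF x(1) y(1)] .
  then have "\<exists>i\<in>{1..len (int y)}. pr (int y) i = int x" unfolding pr_Ac[OF yA(1)] by blast
  then obtain i where i: "i \<in> {1..len b}" "pr b i = a" using x(2) y(2) b by auto
  have "rk b a = i" using rk[of b i] i yN b y(2) by simp
  then show "rk b a \<in> {1..len b} \<and> pr b (rk b a) = a" using i by simp
next
  show "rk 0 a = 0" for a using rk_zero .
qed

section \<open>Sets of pairs versus rank functions\<close>

context encoded_ranks
begin

lemma acc_iff: "acc (int x) b \<longleftrightarrow> x \<in> A \<and> (\<exists>y\<in>Ac x. b = int y)"
proof (cases "x \<in> A")
  case True
  then show ?thesis unfolding acc_def int_agent using pr_Ac[OF True, of b] by simp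
next
  case False
  then show ?thesis unfolding acc_def int_agent by blast
qed

text \<open>Sortedness of the list gives the direction from ranks to preferences. The converse
  follows because distinct agents have distinct ranks and \<open>R x\<close> is asymmetric.\<close>

lemma rk_less_iff:
  assumes "x \<in> A" "y \<in> Ac x" "z \<in> Ac x"
  shows "rk (int x) (int y) < rk (int x) (int z) \<longleftrightarrow> (y, z) \<in> R x"
proof -
  have mono: "(y, z) \<in> R x" if "y \<in> Ac x" "z \<in> Ac x" "rk (int x) (int y) < rk (int x) (int z)" for y z
  proof -
    have acc: "acc (int x) (int y)" "acc (int x) (int z)" using acc_iff that assms(1) by blast+
    obtain i where i: "i < length (prefs x)" "rk (int x) (int y) = int i + 1"
      "pr (int x) (rk (int x) (int y)) = int (prefs x ! i)"
      using index_cases[OF assms(1) accD(5)[OF acc(1)]] by blast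
    obtain j where j: "j < length (prefs x)" "rk (int x) (int z) = int j + 1"
      "pr (int x) (rk (int x) (int z)) = int (prefs x ! j)"
      using index_cases[OF assms(1) accD(5)[OF acc(2)]] by blast
    have "prefs x ! i = y" "prefs x ! j = z" using i(3) j(3) accD(6)[OF acc(1)] accD(6)[OF acc(2)] by auto
    then show ?thesis using prefs_props(2)[OF assms(1), of i j] i(2) j(1,2) that(3) by simp
  qed
  show ?thesis
  proof
    assume R: "(y, z) \<in> R x"
    have "rk (int x) (int y) \<noteq> rk (int x) (int z)"
    proof
      assume eq: "rk (int x) (int y) = rk (int x) (int z)"
      have "acc (int x) (int y)" "acc (int x) (int z)" using acc_iff assms by blast+
      then have "int y = int z" using accD(6) eq by metis
      then show False using R R_props(1)[OF assms(1)] by simp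
    qed
    then show "rk (int x) (int y) < rk (int x) (int z)"
      using mono[OF assms(3,2)] R R_props(2)[OF assms(1) R] by linarith
  qed (rule mono[OF assms(2,3)])
qed

text \<open>This already makes \<open>M\<close> a matching, since all pairs of an agent have the
  partner found at its single rank.\<close>

definition describes :: "nat set set \<Rightarrow> (int \<Rightarrow> int) \<Rightarrow> bool" where
  "describes M f \<longleftrightarrow> M \<subseteq> acceptable_pairs A Ac \<and>
     (\<forall>x\<in>A. f (int x) \<in> {1..len (int x) + 1} \<and>
       (\<forall>y. {x, y} \<in> M \<longleftrightarrow> f (int x) \<le> len (int x) \<and> int y = pr (int x) (f (int x))))"

lemma describesD:
  assumes "describes M f" "x \<in> A"
  shows "1 \<le> f (int x)" "f (int x) \<le> len (int x) + 1"
    "{x, y} \<in> M \<longleftrightarrow> f (int x) \<le> len (int x) \<and> int y = pr (int x) (f (int x))"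
  using assms unfolding describes_def by auto

lemma describes_partner:
  assumes "describes M f" "x \<in> A" "f (int x) \<le> len (int x)"
  obtains y where "y \<in> Ac x" "pr (int x) (f (int x)) = int y" "rk (int x) (int y) = f (int x)"
    "{x, y} \<in> M" "matched M x" "partner M x = y"
proof -
  have j: "f (int x) \<in> {1..len (int x)}" using describesD(1)[OF assms(1,2)] assms(3) by simp
  obtain y where y: "y \<in> Ac x" "pr (int x) (f (int x)) = int y" using pr_Ac[OF assms(2)] j by blast
  have iff: "{x, z} \<in> M \<longleftrightarrow> z = y" for z using describesD(3)[OF assms(1,2)] assms(3) y(2) by auto
  show ?thesis
  proof (rule that[OF y])
    show "rk (int x) (int y) = f (int x)" using rk[OF int_agent[THEN iffD2, OF assms(2)] j] y(2) by simp
    show "{x, y} \<in> M" using iff by simp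
    then show "matched M x" unfolding matched_def by blast
    show "partner M x = y" unfolding partner_def iff by simp
  qed
qed

lemma describes_unmatched:
  assumes "describes M f" "x \<in> A" "\<not> f (int x) \<le> len (int x)"
  shows "\<not> matched M x" "f (int x) = len (int x) + 1"
proof -
  show "f (int x) = len (int x) + 1" using describesD(2)[OF assms(1,2)] assms(3) by simp
  show "\<not> matched M x"
  proof
    assume "matched M x"
    then obtain e where e: "e \<in> M" "x \<in> e" unfolding matched_def by blast
    then have "\<exists>y. e = {x, y}"
      using assms(1) acceptable_pairs_other unfolding describes_def by blast
    then show False using e(1) describesD(3)[OF assms(1,2)] assms(3) by blast
  qed
qed

lemma describes_prefers_iff:
  assumes "describes M f" "x \<in> A" "y \<in> Ac x"
  shows "\<not> matched M x \<or> (y, partner M x) \<in> R x \<longleftrightarrow> rk (int x) (int y) < f (int x)"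
proof (cases "f (int x) \<le> len (int x)")
  case True
  obtain z where z: "z \<in> Ac x" "rk (int x) (int z) = f (int x)" "matched M x" "partner M x = z"
    using describes_partner[OF assms(1,2) True] by blast
  then show ?thesis using rk_less_iff[OF assms(2,3) z(1)] by simp
next
  case False
  have "acc (int x) (int y)" using acc_iff assms(2,3) by blast
  then show ?thesis using describes_unmatched[OF assms(1,2) False] accD(5) by fastforce
qed

lemma describes_stable_iff:
  assumes d: "describes M f"
  shows "stable_matching A Ac R M \<longleftrightarrow> stable f"
proof -
  have "matching A Ac M" unfolding matching_def
  proof (intro conjI ballI impI)
    show M: "M \<subseteq> acceptable_pairs A Ac" using d unfolding describes_def by blast
    fix a e e' assume a: "a \<in> A" and e: "e \<in> M" "e' \<in> M" "a \<in> e \<and> a \<in> e'"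
    have "e \<in> acceptable_pairs A Ac" "e' \<in> acceptable_pairs A Ac" using M e by blast+
    then obtain y z where yz: "e = {a, y}" "e' = {a, z}" using acceptable_pairs_other e(3) by meson
    then have "{a, y} \<in> M" "{a, z} \<in> M" using e(1,2) by auto
    then have "int y = int z" unfolding describesD(3)[OF d a] by simp
    then show "e = e'" using yz by simp
  qed
  moreover have "stable f \<longleftrightarrow> (\<forall>a b. acc a b \<longrightarrow> \<not> (rk a b < f a \<and> rk b a < f b))"
  proof -
    have "f a \<in> {1..len a + 1}" if a: "a \<in> {1..N}" for a
      using agent_cases[OF a] describesD(1,2)[OF d] by auto
    moreover have "f (pr a (f a)) = rk (pr a (f a)) a" if a: "a \<in> {1..N}" "f a \<le> len a" for a
    proof -
      obtain x where x: "x \<in> A" "a = int x" using agent_cases[OF a(1)] by blast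
      obtain y where y: "y \<in> Ac x" "pr a (f a) = int y" "{x, y} \<in> M"
        using describes_partner[OF d x(1)] a(2) x(2) by blast
      have yA: "y \<in> A" using y(1) Ac_props(1)[OF x(1)] by blast
      have "{y, x} \<in> M" using y(3) by (simp add: insert_commute)
      then have f: "f (int y) \<le> len (int y)" "int x = pr (int y) (f (int y))"
        using describesD(3)[OF d yA] by blast+
      then have "rk (int y) (int x) = f (int y)"
        using rk[OF int_agent[THEN iffD2, OF yA], of "f (int y)"] describesD(1)[OF d yA] by simp
      then show ?thesis using y(2) x(2) by simp
    qed
    ultimately show ?thesis unfolding stable_def by blast
  qed
  moreover have "(\<exists>e. blocks A Ac R M e) \<longleftrightarrow> (\<exists>a b. acc a b \<and> rk a b < f a \<and> rk b a < f b)"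
  proof
    assume "\<exists>e. blocks A Ac R M e"
    then obtain x y where xy: "x \<in> A" "y \<in> A" "y \<in> Ac x" "x \<in> Ac y"
      "\<not> matched M x \<or> (y, partner M x) \<in> R x" "\<not> matched M y \<or> (x, partner M y) \<in> R y"
      unfolding blocks_def by blast
    then have "rk (int x) (int y) < f (int x)" "rk (int y) (int x) < f (int y)"
      using describes_prefers_iff[OF d] by blast+
    moreover have "acc (int x) (int y)" using acc_iff xy by blast
    ultimately show "\<exists>a b. acc a b \<and> rk a b < f a \<and> rk b a < f b" by blast
  next
    assume "\<exists>a b. acc a b \<and> rk a b < f a \<and> rk b a < f b"
    then obtain a b where ab: "acc a b" "rk a b < f a" "rk b a < f b" by blast
    obtain x where x: "x \<in> A" "a = int x" using agent_cases[OF accD(1)[OF ab(1)]] by blast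
    obtain y where y: "y \<in> Ac x" "b = int y" using ab(1) acc_iff x(2) by blast
    have xy: "y \<in> A" "x \<in> Ac y" using y(1) Ac_props[OF x(1)] by auto
    have "blocks A Ac R M {x, y}" unfolding blocks_def
      using x y xy ab(2,3) describes_prefers_iff[OF d x(1) y(1)] describes_prefers_iff[OF d xy] by blast
    then show "\<exists>e. blocks A Ac R M e" by blast
  qed
  ultimately show ?thesis unfolding stable_matching_def by blast
qed

text \<open>An unmatched agent has entry \<open>0\<close>, and the convention for
  \<open>rk a 0\<close> turns this into rank \<open>len a + 1\<close> without a case distinction.
  The program computes the ranks of \<open>M1\<close> in the same way.\<close>

definition rank_of :: "nat set set \<Rightarrow> int \<Rightarrow> int" where
  "rank_of M a = rk a (matching_array M a 0)"

lemma describes_rank_of: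
  assumes M: "matching A Ac M"
  shows "describes M (rank_of M)" unfolding describes_def
proof (intro conjI ballI)
  show acc: "M \<subseteq> acceptable_pairs A Ac" using M unfolding matching_def by blast
  fix x assume x: "x \<in> A"
  have a: "int x \<in> {1..N}" using x int_agent by blast
  have "rank_of M (int x) \<in> {1..len (int x) + 1} \<and>
    (\<forall>y. {x, y} \<in> M \<longleftrightarrow> rank_of M (int x) \<le> len (int x) \<and> int y = pr (int x) (rank_of M (int x)))"
  proof (cases "matched M x")
    case True
    then obtain e where e: "e \<in> M" "x \<in> e" unfolding matched_def by blast
    then obtain y where y: "e = {x, y}" using acc acceptable_pairs_other by blast
    have yx: "y \<in> Ac x" using e(1) y acc acceptable_pairs_iff by blast
    have iff: "{x, z} \<in> M \<longleftrightarrow> z = y" for z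
    proof
      assume z: "{x, z} \<in> M"
      have "\<forall>e\<in>M. \<forall>e'\<in>M. x \<in> e \<and> x \<in> e' \<longrightarrow> e = e'" using M x unfolding matching_def by blast
      from this[rule_format, OF z e(1)] have "{x, z} = {x, y}" using y by simp
      then show "z = y" by (auto simp: doubleton_eq_iff)
    qed (use e(1) y in simp)
    then have "partner M x = y" unfolding partner_def by simp
    then have r: "rank_of M (int x) = rk (int x) (int y)"
      using True unfolding rank_of_def matching_array_def by simp
    have "acc (int x) (int y)" using acc_iff x yx by blast
    note accD(5,6)[OF this]
    then show ?thesis unfolding iff r by simp
  next
    case False
    then have "rank_of M (int x) = len (int x) + 1"
      using rk_unmatched[OF a] unfolding rank_of_def matching_array_def by simp
    moreover have "{x, y} \<notin> M" for y using False unfolding matched_def by blast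
    ultimately show ?thesis using len_nonneg[OF a] by simp
  qed
  then show "rank_of M (int x) \<in> {1..len (int x) + 1}"
    "\<forall>y. {x, y} \<in> M \<longleftrightarrow> rank_of M (int x) \<le> len (int x) \<and> int y = pr (int x) (rank_of M (int x))"
    by blast+
qed

lemma pr_rank_of:
  assumes M: "matching A Ac M" and a: "a \<in> {1..N}"
  shows "pr a (rank_of M a) = matching_array M a 0"
proof -
  obtain x where x: "x \<in> A" "a = int x" using agent_cases[OF a] by blast
  note d = describes_rank_of[OF M]
  show ?thesis
  proof (cases "rank_of M (int x) \<le> len (int x)")
    case True
    obtain y where "pr (int x) (rank_of M (int x)) = int y" "matched M x" "partner M x = y"
      using describes_partner[OF d x(1) True] by blast
    then show ?thesis unfolding x(2) matching_array_def by simp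
  next
    case False
    show ?thesis using describes_unmatched[OF d x(1) False] pr_end[OF a]
      unfolding x(2) matching_array_def by simp
  qed
qed

definition pairs_of :: "(int \<Rightarrow> int) \<Rightarrow> nat set set" where
  "pairs_of f = {{x, nat (pr (int x) (f (int x)))} | x. x \<in> A \<and> f (int x) \<le> len (int x)}"

lemma describes_pairs_of:
  assumes f: "stable f"
  shows "describes (pairs_of f) f" unfolding describes_def
proof (intro conjI ballI allI)
  have nat_pr: "\<exists>y\<in>Ac x. pr (int x) (f (int x)) = int y" if "x \<in> A" "f (int x) \<le> len (int x)" for x
  proof -
    have "int x \<in> {1..N}" using that int_agent by blast
    then have "acc (int x) (pr (int x) (f (int x)))" using stable_partner(1)[OF f _ that(2) refl] by blast
    then show ?thesis using acc_iff by blast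
  qed
  show "pairs_of f \<subseteq> acceptable_pairs A Ac"
  proof
    fix e assume "e \<in> pairs_of f"
    then obtain x where x: "x \<in> A" "f (int x) \<le> len (int x)" "e = {x, nat (pr (int x) (f (int x)))}"
      unfolding pairs_of_def by blast
    obtain y where "y \<in> Ac x" "pr (int x) (f (int x)) = int y" using nat_pr[OF x(1,2)] by blast
    then show "e \<in> acceptable_pairs A Ac" using acceptable_pairs_iff x by simp
  qed
  fix x assume x: "x \<in> A"
  then have a: "int x \<in> {1..N}" using int_agent by blast
  show "f (int x) \<in> {1..len (int x) + 1}" using stableD(1,2)[OF f a] by simp
  fix y
  show "{x, y} \<in> pairs_of f \<longleftrightarrow> f (int x) \<le> len (int x) \<and> int y = pr (int x) (f (int x))"
  proof
    assume "{x, y} \<in> pairs_of f"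
    then obtain u where u: "u \<in> A" "f (int u) \<le> len (int u)" "{x, y} = {u, nat (pr (int u) (f (int u)))}"
      unfolding pairs_of_def by blast
    obtain v where v: "v \<in> Ac u" "pr (int u) (f (int u)) = int v" using nat_pr[OF u(1,2)] by blast
    have "int u \<in> {1..N}" using u(1) int_agent by blast
    note p = stable_partner[OF f this u(2) v(2)[symmetric]]
    have "x = u \<and> y = v \<or> x = v \<and> y = u" using u(3) v(2) by (auto simp: doubleton_eq_iff)
    then show "f (int x) \<le> len (int x) \<and> int y = pr (int x) (f (int x))" using u(2) v(2) p(4,5) by auto
  next
    assume h: "f (int x) \<le> len (int x) \<and> int y = pr (int x) (f (int x))"
    then have "y = nat (pr (int x) (f (int x)))" by (metis nat_int)
    then show "{x, y} \<in> pairs_of f" unfolding pairs_of_def using x h by blast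
  qed
qed

end

section \<open>Forced and forbidden pairs, and the distance from the given matching\<close>

locale encoded_instance = encoded_ranks +
  fixes M1 Q P :: "nat set set" and k :: int and qs :: "(nat \<times> nat) list"
  assumes inst: "adapt_SR_instance {1..2 * n} Ac R M1 Q P"
    and qs: "lists_pairs Q qs"
begin

text \<open>The guards match those of \<open>pair_matrix\<close>; without them \<open>nat\<close>
  would identify all negative indices with \<open>0\<close>.\<close>

definition in_pairs :: "nat set set \<Rightarrow> int \<Rightarrow> int \<Rightarrow> bool" where
  "in_pairs S a b \<longleftrightarrow> 0 \<le> a \<and> 0 \<le> b \<and> {nat a, nat b} \<in> S"

lemma pair_matrix_eq: "pair_matrix S = (\<lambda>a b. of_bool (in_pairs S a b))"
  unfolding pair_matrix_def in_pairs_def by (simp add: fun_eq_iff)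

lemma in_pairs_int: "in_pairs S (int x) (int y) \<longleftrightarrow> {x, y} \<in> S"
  unfolding in_pairs_def by simp

lemma in_pairs_sym: "in_pairs S a b \<Longrightarrow> in_pairs S b a"
  unfolding in_pairs_def by (simp add: insert_commute)

lemma in_pairs_mem:
  assumes S: "S \<subseteq> pairs A" and ab: "in_pairs S a b"
  shows "a \<in> {1..N}" "b \<in> {1..N}" "a \<noteq> b"
proof -
  have ge: "0 \<le> a" "0 \<le> b" and "{nat a, nat b} \<in> pairs A" using S ab unfolding in_pairs_def by auto
  then have s: "{nat a, nat b} \<subseteq> A" and c: "card {nat a, nat b} = 2" unfolding pairs_def by auto
  have "int (nat a) \<in> {1..N}" "int (nat b) \<in> {1..N}" using s int_agent by blast+
  then show "a \<in> {1..N}" "b \<in> {1..N}" using ge by simp_all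
  show "a \<noteq> b" using c by auto
qed

lemma Q_pairs: "Q \<subseteq> pairs A" and P_pairs: "P \<subseteq> pairs A" and M1_stable: "stable_matching A Ac R M1"
  using inst unfolding adapt_SR_instance_def by auto

lemma M1_matching: "matching A Ac M1"
  using M1_stable unfolding stable_matching_def by blast

definition r :: "int \<Rightarrow> int" where "r = rank_of M1"

lemma describes_r: "describes M1 r"
  unfolding r_def by (rule describes_rank_of[OF M1_matching])

lemma r_stable: "stable r"
  using describes_stable_iff[OF describes_r] M1_stable by blast

sublocale adapt_ranks N len pr rk r "in_pairs P" "in_pairs Q"
proof
  show "stable r" by (rule r_stable)
  show "in_pairs P b a" if "in_pairs P a b" for a b using that by (rule in_pairs_sym)
  show "in_pairs Q b a" if "in_pairs Q a b" for a b using that by (rule in_pairs_sym)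
  show "\<not> in_pairs P a 0" for a using in_pairs_mem(2)[OF P_pairs, of a 0] by auto
  show "\<not> in_pairs P a a" for a using in_pairs_mem(3)[OF P_pairs, of a a] by auto
  show "a \<in> {1..N} \<and> b \<in> {1..N}" if "in_pairs Q a b" for a b
    using in_pairs_mem(1,2)[OF Q_pairs that] by blast
qed

lemma mate_eq: "a \<in> {1..N} \<Longrightarrow> mate a = matching_array M1 a 0"
  unfolding mate_def unfolding r_def by (rule pr_rank_of[OF M1_matching])

text \<open>Putting the smaller end first makes unordered pairs correspond to the ordered ones that
  \<open>forced_count\<close> is compared with.\<close>

lemma card_Q: "int (length qs) = int (card {(a, b). in_pairs Q a b \<and> a < b})"
proof -
  let ?B = "{(a, b). in_pairs Q a b \<and> a < b}"
  let ?g = "\<lambda>(a, b). {nat a, nat b}"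
  have "card Q = length qs"
    using qs distinct_card[of "map (\<lambda>(a, b). {a, b}) qs"] unfolding lists_pairs_def by simp
  moreover have "inj_on ?g ?B"
  proof (rule inj_onI, clarify)
    fix a b c d assume h: "in_pairs Q a b" "in_pairs Q c d" "a < b" "c < d" "{nat a, nat b} = {nat c, nat d}"
    have ge: "0 \<le> a" "0 \<le> b" "0 \<le> c" "0 \<le> d" using h(1,2) unfolding in_pairs_def by auto
    have "nat a = nat c \<and> nat b = nat d \<or> nat a = nat d \<and> nat b = nat c"
      using h(5) unfolding doubleton_eq_iff .
    then show "a = c \<and> b = d" using ge h(3,4) by auto
  qed
  moreover have "?g ` ?B = Q"
  proof
    show "?g ` ?B \<subseteq> Q" unfolding in_pairs_def by auto
    show "Q \<subseteq> ?g ` ?B"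
    proof
      fix e assume e: "e \<in> Q"
      then have "card e = 2" using Q_pairs unfolding pairs_def by blast
      then obtain u v where uv: "e = {u, v}" "u \<noteq> v" by (meson card_2_iff)
      obtain x y where xy: "e = {x, y}" "x < y"
      proof (cases "u < v")
        case True
        then show ?thesis using that uv(1) by blast
      next
        case False
        then have "v < u" using uv(2) by simp
        moreover have "e = {v, u}" using uv(1) by (rule trans[OF _ insert_commute])
        ultimately show ?thesis using that by blast
      qed
      have "in_pairs Q (int x) (int y)" using e xy(1) in_pairs_int by blast
      then have "(int x, int y) \<in> ?B" using xy(2) by simp
      moreover have "e = ?g (int x, int y)" using xy(1) by simp
      ultimately show "e \<in> ?g ` ?B" by blast
    qed
  qed
  ultimately show ?thesis using card_image[of ?g ?B] by simp
qed

text \<open>This identifies the exponent of the running time: each forbidden pair of the given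
  matching is represented by its smaller agent.\<close>

lemma card_F: "card F = card (P \<inter> M1)"
proof (rule bij_betw_same_card[of "\<lambda>a. {nat a, nat (mate a)}"])
  have Fm: "a \<in> {1..N}" "a < mate a" "in_pairs P a (mate a)" "mate a \<in> {1..N}" "mate (mate a) = a"
    if "a \<in> F" for a
  proof -
    show a: "a \<in> {1..N}" "a < mate a" "in_pairs P a (mate a)" using that unfolding F_def by auto
    show "mate a \<in> {1..N}" "mate (mate a) = a" using mate_props[OF a(1) P_mate_matched[OF a(1,3)]] by auto
  qed
  have inj: "inj_on (\<lambda>a. {nat a, nat (mate a)}) F"
  proof (rule inj_onI)
    fix a b assume ab: "a \<in> F" "b \<in> F" "{nat a, nat (mate a)} = {nat b, nat (mate b)}"
    then have "nat a = nat b \<or> nat a = nat (mate b) \<and> nat (mate a) = nat b"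
      unfolding doubleton_eq_iff by blast
    then show "a = b" using Fm[OF ab(1)] Fm[OF ab(2)] by auto
  qed
  have "(\<lambda>a. {nat a, nat (mate a)}) ` F = P \<inter> M1"
  proof
    show "(\<lambda>a. {nat a, nat (mate a)}) ` F \<subseteq> P \<inter> M1"
    proof
      fix e assume "e \<in> (\<lambda>a. {nat a, nat (mate a)}) ` F"
      then obtain a where a: "a \<in> F" "e = {nat a, nat (mate a)}" by blast
      obtain x where x: "x \<in> A" "a = int x" using agent_cases[OF Fm(1)[OF a(1)]] by blast
      have "r a \<le> len a" using P_mate_matched[OF Fm(1,3)[OF a(1)]] .
      then have "{x, nat (mate a)} \<in> M1"
        using describesD(3)[OF describes_r x(1)] Fm(4)[OF a(1)] x(2) unfolding mate_def by simp
      then show "e \<in> P \<inter> M1" using a(2) x(2) Fm(3)[OF a(1)] unfolding in_pairs_def by simp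
    qed
    show "P \<inter> M1 \<subseteq> (\<lambda>a. {nat a, nat (mate a)}) ` F"
    proof
      fix e assume e: "e \<in> P \<inter> M1"
      then have acc: "e \<in> acceptable_pairs A Ac" using M1_matching unfolding matching_def by blast
      have main: "e \<in> (\<lambda>a. {nat a, nat (mate a)}) ` F" if xy: "e = {x, y}" "x \<in> A" "x < y" for x y
      proof -
        have "int y = mate (int x)"
          using e xy(1) describesD(3)[OF describes_r xy(2)] unfolding mate_def by blast
        then have "int x \<in> F" using e xy int_agent unfolding F_def by (auto simp: in_pairs_int simp flip: \<open>int y = _\<close>)
        moreover have "e = {nat (int x), nat (mate (int x))}" using xy(1) \<open>int y = _\<close>[symmetric] by simp
        ultimately show ?thesis by blast
      qed
      obtain x y where xy: "e = {x, y}" "x \<in> A" "y \<in> A" "x \<noteq> y" using acceptable_pairs_cases[OF acc] by metis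
      show "e \<in> (\<lambda>a. {nat a, nat (mate a)}) ` F"
      proof (cases "x < y")
        case True
        then show ?thesis using main xy by blast
      next
        case False
        then show ?thesis using main[of y x] xy by (simp add: insert_commute)
      qed
    qed
  qed
  then show "bij_betw (\<lambda>a. {nat a, nat (mate a)}) F (P \<inter> M1)" using inj unfolding bij_betw_def by blast
qed

lemma good_iff:
  assumes d: "describes M f"
  shows "good f \<longleftrightarrow> stable_matching A Ac R M \<and> Q \<subseteq> M \<and> M \<inter> P = {}"
proof -
  \<comment> \<open>Between real agents no test for being matched is needed: behind its list an
    agent has partner \<open>0\<close>, which is no agent.\<close>
  have mem: "{nat a, nat b} \<in> M \<longleftrightarrow> b = pr a (f a)" if ab: "a \<in> {1..N}" "b \<in> {1..N}" for a b
  proof -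
    obtain x where x: "x \<in> A" "a = int x" using agent_cases[OF ab(1)] by blast
    obtain y where y: "y \<in> A" "b = int y" using agent_cases[OF ab(2)] by blast
    have "f (int x) \<le> len (int x)" if "int y = pr (int x) (f (int x))"
    proof (rule ccontr)
      assume "\<not> ?thesis"
      then have "f (int x) = len (int x) + 1" using describesD(2)[OF d x(1)] by simp
      then show False using that pr_end[OF ab(1)] x(2) y(1) by simp
    qed
    then show ?thesis using describesD(3)[OF d x(1)] x(2) y(2) by auto
  qed
  have Q: "Q \<subseteq> M \<longleftrightarrow> (\<forall>a b. in_pairs Q a b \<longrightarrow> b = pr a (f a))"
  proof
    assume QM: "Q \<subseteq> M"
    show "\<forall>a b. in_pairs Q a b \<longrightarrow> b = pr a (f a)"
    proof (intro allI impI)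
      fix a b assume ab: "in_pairs Q a b"
      then have "{nat a, nat b} \<in> M" using QM unfolding in_pairs_def by blast
      then show "b = pr a (f a)" using mem in_pairs_mem[OF Q_pairs ab] by blast
    qed
  next
    assume h: "\<forall>a b. in_pairs Q a b \<longrightarrow> b = pr a (f a)"
    show "Q \<subseteq> M"
    proof
      fix e assume e: "e \<in> Q"
      then have "card e = 2" using Q_pairs unfolding pairs_def by blast
      then obtain x y where xy: "e = {x, y}" by (meson card_2_iff)
      then have i: "in_pairs Q (int x) (int y)" using e in_pairs_int by simp
      then have "{nat (int x), nat (int y)} \<in> M" using h mem in_pairs_mem[OF Q_pairs i] by blast
      then show "e \<in> M" using xy by simp
    qed
  qed
  have P: "M \<inter> P = {} \<longleftrightarrow> (\<forall>a\<in>{1..N}. \<not> in_pairs P a (pr a (f a)))"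
  proof
    assume MP: "M \<inter> P = {}"
    show "\<forall>a\<in>{1..N}. \<not> in_pairs P a (pr a (f a))"
    proof (intro ballI notI)
      fix a assume a: "a \<in> {1..N}" "in_pairs P a (pr a (f a))"
      then have "{nat a, nat (pr a (f a))} \<in> M" using mem in_pairs_mem[OF P_pairs a(2)] by blast
      then show False using a(2) MP unfolding in_pairs_def by blast
    qed
  next
    assume h: "\<forall>a\<in>{1..N}. \<not> in_pairs P a (pr a (f a))"
    show "M \<inter> P = {}"
    proof (rule ccontr)
      assume "M \<inter> P \<noteq> {}"
      then obtain e where e: "e \<in> M" "e \<in> P" by blast
      have "e \<in> acceptable_pairs A Ac" using d e(1) unfolding describes_def by blast
      then obtain x y where xy: "e = {x, y}" "x \<in> A" using acceptable_pairs_cases by metis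
      then have "int y = pr (int x) (f (int x))" using describesD(3)[OF d xy(2)] e(1) by blast
      then have "in_pairs P (int x) (pr (int x) (f (int x)))" using e(2) xy(1) in_pairs_int by metis
      then show False using h xy(2) int_agent by blast
    qed
  qed
  show ?thesis unfolding good_def using describes_stable_iff[OF d] Q P by blast
qed

text \<open>The pairs of one matching that are missing in the other one partition the agents whose
  partners differ.\<close>

lemma card_diff:
  assumes d: "describes M f" "describes M' f'" and matched: "\<And>a. a \<in> {1..N} \<Longrightarrow> f a \<noteq> f' a \<Longrightarrow> f a \<le> len a"
    and uniq: "matching A Ac M"
  shows "2 * card (M - M') = card {a \<in> {1..N}. f a \<noteq> f' a}"
proof -
  let ?C = "{x \<in> A. f (int x) \<noteq> f' (int x)}"
  have acc: "e \<in> acceptable_pairs A Ac" if "e \<in> M" for e using that uniq unfolding matching_def by blast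
  have card2: "card e = 2" if "e \<in> M" for e
    using acceptable_pairs_cases[OF acc[OF that]] by (metis card_2_iff)
  have U: "\<Union>(M - M') = ?C"
  proof (intro equalityI subsetI)
    fix x assume "x \<in> \<Union>(M - M')"
    then obtain e where e: "e \<in> M" "e \<notin> M'" "x \<in> e" by blast
    obtain y where y: "e = {x, y}" using acceptable_pairs_other[OF acc[OF e(1)] e(3)] by blast
    have x: "x \<in> A" using acc[OF e(1)] acceptable_pairs_iff unfolding y by blast
    have "f (int x) \<noteq> f' (int x)"
      using e(1,2) describesD(3)[OF d(1) x] describesD(3)[OF d(2) x] unfolding y by metis
    then show "x \<in> ?C" using x by blast
  next
    fix x assume "x \<in> ?C"
    then have x: "x \<in> A" "f (int x) \<noteq> f' (int x)" by auto
    have xN: "int x \<in> {1..N}" using int_agent x(1) by blast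
    have le: "f (int x) \<le> len (int x)" using matched[OF xN x(2)] .
    obtain y where y: "pr (int x) (f (int x)) = int y" "rk (int x) (int y) = f (int x)" "{x, y} \<in> M"
      using describes_partner[OF d(1) x(1) le] by blast
    have "{x, y} \<notin> M'"
    proof
      assume "{x, y} \<in> M'"
      then have h: "f' (int x) \<le> len (int x)" "int y = pr (int x) (f' (int x))"
        using describesD(3)[OF d(2) x(1)] by blast+
      have "f' (int x) \<in> {1..len (int x)}" using h(1) describesD(1)[OF d(2) x(1)] by simp
      then have "rk (int x) (int y) = f' (int x)" using rk[OF xN] h(2) by simp
      then show False using y(2) x(2) by simp
    qed
    then show "x \<in> \<Union>(M - M')" using y(3) by blast
  qed
  have "card (\<Union>(M - M')) = sum card (M - M')"
  proof (rule card_Union_disjoint)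
    show "pairwise disjnt (M - M')" unfolding pairwise_def disjnt_iff
    proof (intro ballI impI allI notI)
      fix e e' x assume h: "e \<in> M - M'" "e' \<in> M - M'" "e \<noteq> e'" "x \<in> e \<and> x \<in> e'"
      obtain y where "e = {x, y}" using acceptable_pairs_other[OF acc, of e x] h by blast
      then have "x \<in> A" using acc[of e] acceptable_pairs_iff h(1) by blast
      then show False using uniq h unfolding matching_def by (metis DiffD1)
    qed
    show "finite e" if "e \<in> M - M'" for e using card2[of e] that by (metis DiffD1 card.infinite zero_neq_numeral)
  qed
  also have "\<dots> = (\<Sum>e\<in>M - M'. 2)" by (rule sum.cong) (use card2 in auto)
  finally have "2 * card (M - M') = card ?C" unfolding U by simp
  also have "card ?C = card (int ` ?C)" by (simp add: card_image)
  also have "int ` ?C = {a \<in> {1..N}. f a \<noteq> f' a}"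
  proof (intro equalityI subsetI)
    fix a assume "a \<in> int ` ?C"
    then show "a \<in> {a \<in> {1..N}. f a \<noteq> f' a}" using int_agent by blast
  next
    fix a assume a: "a \<in> {a \<in> {1..N}. f a \<noteq> f' a}"
    then obtain x where "x \<in> A" "a = int x" using agent_cases by blast
    then show "a \<in> int ` ?C" using a by blast
  qed
  finally show ?thesis .
qed

text \<open>A changed agent is matched in both matchings, as the worse off side is always matched.
  Each of the two differences thus contains half as many pairs as there are changed agents, and
  together they contain exactly as many.\<close>

lemma card_changed:
  assumes d: "describes M f" and f: "stable f"
  shows "card (sym_diff M1 M) = card (changed f)"
proof -
  have matched: "r a \<le> len a" "f a \<le> len a" if af: "a \<in> {1..N}" "f a \<noteq> r a" for a
  proof -
    consider "r a < f a" | "f a < r a" using af(2) by linarith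
    then have "r a \<le> len a \<and> f a \<le> len a"
    proof cases
      case 1
      then show ?thesis using partner_of_worsener(1)[OF r_stable f af(1)] by simp
    next
      case 2
      then show ?thesis using partner_of_worsener(1)[OF f r_stable af(1)] by simp
    qed
    then show "r a \<le> len a" "f a \<le> len a" by blast+
  qed
  have M: "matching A Ac M"
    using describes_stable_iff[OF d] f unfolding stable_matching_def by blast
  have fin: "finite M1" "finite M"
    using finite_subset[OF conjunct1[OF M1_matching[unfolded matching_def]] finite_acceptable_pairs]
      finite_subset[OF conjunct1[OF M[unfolded matching_def]] finite_acceptable_pairs] by auto
  have "2 * card (M1 - M) = card {a \<in> {1..N}. r a \<noteq> f a}"
    by (rule card_diff[OF describes_r d _ M1_matching], erule matched(1), erule not_sym)
  moreover have "{a \<in> {1..N}. r a \<noteq> f a} = changed f" unfolding changed_def by auto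
  moreover have "2 * card (M - M1) = card {a \<in> {1..N}. f a \<noteq> r a}"
    by (rule card_diff[OF d describes_r _ M], erule matched(2))
  moreover have "{a \<in> {1..N}. f a \<noteq> r a} = changed f" unfolding changed_def by auto
  moreover have "card (sym_diff M1 M) = card (M1 - M) + card (M - M1)"
  proof (rule card_Un_disjoint)
    show "finite (M1 - M)" "finite (M - M1)" using fin by simp_all
    show "(M1 - M) \<inter> (M - M1) = {}" by blast
  qed
  ultimately show ?thesis by simp
qed

lemma adapt_SR_iff: "adapt_SR A Ac R M1 Q P k \<longleftrightarrow> (\<exists>f. good f \<and> int (card (changed f)) \<le> k)"
proof
  assume "adapt_SR A Ac R M1 Q P k"
  then obtain M where M: "stable_matching A Ac R M" "Q \<subseteq> M" "M \<inter> P = {}" "int (card (sym_diff M1 M)) \<le> k"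
    unfolding adapt_SR_def by blast
  have d: "describes M (rank_of M)" using M(1) describes_rank_of unfolding stable_matching_def by blast
  have g: "good (rank_of M)" using good_iff[OF d] M(1-3) by blast
  have "int (card (changed (rank_of M))) \<le> k" using card_changed[OF d goodD(1)[OF g]] M(4) by simp
  then show "\<exists>f. good f \<and> int (card (changed f)) \<le> k" using g by blast
next
  assume "\<exists>f. good f \<and> int (card (changed f)) \<le> k"
  then obtain f where f: "good f" "int (card (changed f)) \<le> k" by blast
  have d: "describes (pairs_of f) f" using describes_pairs_of[OF goodD(1)[OF f(1)]] .
  show "adapt_SR A Ac R M1 Q P k" unfolding adapt_SR_def
  proof (intro exI conjI)
    show "stable_matching A Ac R (pairs_of f)" "Q \<subseteq> pairs_of f" "pairs_of f \<inter> P = {}"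
      using good_iff[OF d] f(1) by blast+
    show "int (card (sym_diff M1 (pairs_of f))) \<le> k" using card_changed[OF d goodD(1)[OF f(1)]] f(2) by simp
  qed
qed

sublocale adapt_machine N len pr rk r "in_pairs P" "in_pairs Q" k "int (length qs)" "card (acceptable_pairs A Ac)"
proof
  show "0 \<le> N" unfolding N_def by simp
  show "len a = pr a 0" for a by (rule len_def)
  show "nat (len a) \<le> card (acceptable_pairs A Ac)" if "a \<in> {1..N}" for a using len_le_pairs[OF that] .
  show "(\<Sum>a\<in>{1..N}. nat (len a)) \<le> 2 * card (acceptable_pairs A Ac)" by (rule len_total)
  show "int (length qs) = int (card {(a, b). in_pairs Q a b \<and> a < b})" by (rule card_Q)
  show "\<not> in_pairs Q a a" for a using in_pairs_mem(3)[OF Q_pairs, of a a] by auto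
qed

end

section \<open>The complete program\<close>

text \<open>The machine can only increment, so doubling takes a loop of \<open>n\<close>
  rounds.\<close>

definition double_n :: com where
  "double_n = For ''a'' (Reg ''n'') (Assign ''N'' (Inc (Inc (Reg ''N''))))"

definition rank_agent :: com where
  "rank_agent = For ''j'' (entry ''pref'' (Reg ''a''))
     (Store ''rk'' (Reg ''a'') (Cell ''pref'' (Reg ''a'') (Reg ''j'')) (Reg ''j''))"

text \<open>The rank of partner \<open>0\<close> is stored before \<open>''r1''\<close> is read from
  the ranks, because the lookup for an unmatched agent uses it.\<close>

definition finish_agent :: com where
  "finish_agent = Seq (put ''rk'' (Reg ''a'') (Inc (entry ''pref'' (Reg ''a''))))
     (put ''r1'' (Reg ''a'') (Cell ''rk'' (Reg ''a'') (entry ''M1'' (Reg ''a''))))"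

definition rank_all :: com where
  "rank_all = For ''a'' (Reg ''N'') (Seq rank_agent finish_agent)"

definition solver :: com where
  "solver = Seq double_n (Seq rank_all search)"

section \<open>Preprocessing and the total running time\<close>

lemma wp_double_n:
  assumes "reg s ''n'' = int n" "reg s ''N'' = 0"
  shows "wp double_n s (\<lambda>t s'. t \<le> 20 * (n + 1) \<and> reg s' ''N'' = int (2 * n))"
  unfolding double_n_def
proof (rule wp_For[where E = "int n" and T = 5 and I = "\<lambda>i s'. reg s' ''N'' = 2 * (i - 1)"])
  fix s' assume "agree (For ''a'' (Reg ''n'') (Assign ''N'' (Inc (Inc (Reg ''N''))))) s s'"
  then show "aval (Reg ''n'') s' = int n" using assms(1) unfolding agree_def by simp
qed (use assms in auto)

context encoded_prefs
begin

abbreviation m :: nat where "m \<equiv> card (acceptable_pairs A Ac)"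

lemma wp_rank_agent:
  assumes s: "reg s ''a'' = a" "a \<in> {1..N}" "arr s ''pref'' = pr"
  shows "wp rank_agent s (\<lambda>t s'. t \<le> 30 * (m + 1) \<and>
    (\<forall>b. b \<noteq> a \<longrightarrow> arr s' ''rk'' b = arr s ''rk'' b) \<and>
    (\<forall>j\<in>{1..len a}. arr s' ''rk'' a (pr a j) = j))"
proof -
  let ?c = "Store ''rk'' (Reg ''a'') (Cell ''pref'' (Reg ''a'') (Reg ''j'')) (Reg ''j'')"
  define I :: "int \<Rightarrow> machine \<Rightarrow> bool" where "I i s' \<longleftrightarrow>
    (\<forall>b. b \<noteq> a \<longrightarrow> arr s' ''rk'' b = arr s ''rk'' b) \<and>
    (\<forall>j\<in>{1..<i}. j \<le> len a \<longrightarrow> arr s' ''rk'' a (pr a j) = j)" for i s'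
  show ?thesis unfolding rank_agent_def
  proof (rule wp_For[where E = "len a" and T = 10 and I = I])
    show "0 \<le> len a" using len_nonneg[OF s(2)] .
  next
    fix s' assume "agree (For ''j'' (entry ''pref'' (Reg ''a'')) ?c) s s'"
    then show "aval (entry ''pref'' (Reg ''a'')) s' = len a"
      using s(1,3) len_def unfolding agree_def by simp
  next
    fix j s' assume ag: "agree (For ''j'' (entry ''pref'' (Reg ''a'')) ?c) s s'"
      and j: "reg s' ''j'' = j" "1 \<le> j" "j \<le> len a" and I: "I j s'"
    have ra: "reg s' ''a'' = a" "arr s' ''pref'' = pr" using ag s(1,3) unfolding agree_def by auto
    \<comment> \<open>Since the entries of a list are distinct, the new store destroys no rank
      stored earlier.\<close>
    have "pr a i \<noteq> pr a j" if "i \<in> {1..<j}" for i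
      using pr_inj[OF s(2), of i j] that j(2,3) by auto
    moreover have "{1..<j + 1} = insert j {1..<j}" using j(2) by auto
    ultimately show "wp ?c s' (\<lambda>t s''. t \<le> 10 \<and> I (j + 1) s'')"
      using I j(1) ra unfolding I_def by simp
  next
    fix t s' assume I: "I (len a + 1) s'"
      and t: "t \<le> (nat (len a) + 1) * (10 + acost (entry ''pref'' (Reg ''a'')) + 8)"
    have "nat (len a) \<le> m" using len_le_pairs[OF s(2)] .
    then show "t \<le> 30 * (m + 1) \<and> (\<forall>b. b \<noteq> a \<longrightarrow> arr s' ''rk'' b = arr s ''rk'' b) \<and>
      (\<forall>j\<in>{1..len a}. arr s' ''rk'' a (pr a j) = j)"
      using I t unfolding I_def by auto
  qed (auto simp: I_def)
qed

definition ranked :: "(int \<Rightarrow> int) \<Rightarrow> machine \<Rightarrow> int \<Rightarrow> bool" where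
  "ranked mt s a \<longleftrightarrow> (\<forall>j\<in>{1..len a}. arr s ''rk'' a (pr a j) = j) \<and> arr s ''rk'' a 0 = len a + 1 \<and>
     arr s ''r1'' a 0 = arr s ''rk'' a (mt a)"

lemma pr_nonzero:
  assumes "a \<in> {1..N}" "j \<in> {1..len a}"
  shows "pr a j \<noteq> 0"
proof -
  obtain x where x: "x \<in> A" "a = int x" using agent_cases[OF assms(1)] by blast
  then obtain y where "y \<in> Ac x" "pr a j = int y" using pr_Ac[OF x(1), of "pr a j"] assms(2) by blast
  then show ?thesis using Ac_props(1)[OF x(1)] by auto
qed

text \<open>Row \<open>0\<close> of the rank table is never written; its initial zeros become the
  convention \<open>rk_zero\<close> for the dummy agent.\<close>

lemma wp_rank_all:
  assumes s: "reg s ''N'' = N" "arr s ''pref'' = pr" "\<And>a. a \<in> {1..N} \<Longrightarrow> arr s ''M1'' a 0 = mt a"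
    and zero: "arr s ''rk'' 0 = (\<lambda>_. 0)"
  shows "wp rank_all s (\<lambda>t s'. t \<le> 200 * ((nat N + 1) * (m + 1)) \<and>
    arr s' ''rk'' 0 = (\<lambda>_. 0) \<and> (\<forall>a\<in>{1..N}. ranked mt s' a))"
proof -
  let ?c = "Seq rank_agent finish_agent"
  define I :: "int \<Rightarrow> machine \<Rightarrow> bool" where
    "I i s' \<longleftrightarrow> arr s' ''rk'' 0 = (\<lambda>_. 0) \<and> (\<forall>a\<in>{1..<i}. ranked mt s' a)" for i s'
  show ?thesis unfolding rank_all_def
  proof (rule wp_For[where E = N and T = "31 + 30 * (m + 1)" and I = I])
    fix s' assume "agree (For ''a'' (Reg ''N'') ?c) s s'"
    then show "aval (Reg ''N'') s' = N"
      using s(1) unfolding agree_def by (simp add: rank_agent_def finish_agent_def)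
  next
    fix a s' assume ag: "agree (For ''a'' (Reg ''N'') ?c) s s'"
      and a: "reg s' ''a'' = a" "1 \<le> a" "a \<le> N" and I: "I a s'"
    have aN: "a \<in> {1..N}" using a by simp
    have pf: "arr s' ''pref'' = pr" "arr s' ''M1'' a 0 = mt a"
      using ag s(2) s(3)[OF aN] unfolding agree_def by (simp_all add: rank_agent_def finish_agent_def)
    show "wp ?c s' (\<lambda>t s''. t \<le> 31 + 30 * (m + 1) \<and> I (a + 1) s'')"
    proof (rule wp_SeqI[OF wp_rank_agent[OF a(1) aN pf(1)], where T' = 30])
      fix s1 assume ag1: "agree rank_agent s' s1"
        and h: "(\<forall>b. b \<noteq> a \<longrightarrow> arr s1 ''rk'' b = arr s' ''rk'' b) \<and>
          (\<forall>j\<in>{1..len a}. arr s1 ''rk'' a (pr a j) = j)"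
      have s1: "reg s1 ''a'' = a" "arr s1 ''pref'' = pr" "arr s1 ''M1'' a 0 = mt a"
        "arr s1 ''r1'' = arr s' ''r1''"
        using ag1 a(1) pf unfolding agree_def by (simp_all add: rank_agent_def)
      let ?s2 = "set_arr ''rk'' a 0 (len a + 1) s1"
      let ?s3 = "set_arr ''r1'' a 0 (arr ?s2 ''rk'' a (mt a)) ?s2"
      \<comment> \<open>Storing a rank for partner \<open>0\<close> leaves the ranks of real agents
        intact, because no list entry is \<open>0\<close>.\<close>
      have 1: "ranked mt ?s3 a" using h pr_nonzero[OF aN] unfolding ranked_def by simp
      have 2: "ranked mt ?s3 b" if "b \<in> {1..<a}" for b
        using that I h s1(4) unfolding I_def ranked_def by simp
      have 3: "arr ?s3 ''rk'' 0 = (\<lambda>_. 0)" using I h a(2) unfolding I_def by simp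
      have "I (a + 1) ?s3" unfolding I_def
      proof (rule conjI[OF 3], rule ballI)
        fix b assume b: "b \<in> {1..<a + 1}"
        show "ranked mt ?s3 b"
        proof (cases "b = a")
          case False
          then have "b \<in> {1..<a}" using b by simp
          then show ?thesis by (rule 2)
        qed (use 1 in simp)
      qed
      then show "wp finish_agent s1 (\<lambda>t s''. t \<le> 30 \<and> I (a + 1) s'')"
        using s1 len_def[of a] unfolding finish_agent_def by simp
    qed simp
  next
    fix t s' assume I: "I (N + 1) s'"
      and t: "t \<le> (nat N + 1) * (31 + 30 * (m + 1) + acost (Reg ''N'') + 8)"
    have "(nat N + 1) * (31 + 30 * (m + 1) + acost (Reg ''N'') + 8) \<le> (nat N + 1) * (200 * (m + 1))"
      by (rule mult_le_mono2) simp
    then have "t \<le> 200 * ((nat N + 1) * (m + 1))" using t by (simp only: mult.left_commute)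
    moreover have "{1..<N + 1} = {1..N}" by auto
    ultimately show "t \<le> 200 * ((nat N + 1) * (m + 1)) \<and>
      arr s' ''rk'' 0 = (\<lambda>_. 0) \<and> (\<forall>a\<in>{1..N}. ranked mt s' a)"
      using I unfolding I_def by simp
  qed (use zero in \<open>auto simp: I_def ranked_def N_def rank_agent_def finish_agent_def\<close>)
qed

end

lemma solver_correct:
  assumes inst: "adapt_SR_instance {1..2 * n} Ac R M1 Q P" and enc: "encodes s n Ac R M1 Q P k"
  shows "wp solver s (\<lambda>t s'.
    t \<le> 50000 * (2 ^ card (P \<inter> M1) * max 1 n * max 1 (card (acceptable_pairs {1..2 * n} Ac))) \<and>
    reg s' ''answer'' = (if adapt_SR {1..2 * n} Ac R M1 Q P k then 1 else 0))"
proof -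
  obtain prefs qs ps where rep: "represents_prefs {1..2 * n} Ac R prefs" and qs: "lists_pairs Q qs"
    and s: "s = initial_machine n prefs M1 qs ps Q P k"
    using enc unfolding encodes_def by blast
  interpret ep: encoded_prefs n Ac R prefs
    using inst rep unfolding adapt_SR_instance_def by unfold_locales auto
  let ?m = "card (acceptable_pairs {1..2 * n} Ac)"
  let ?X = "(nat ep.N + 1) * (?m + 1)"
  let ?c = "2 ^ card (P \<inter> M1)"
  let ?post = "\<lambda>s'. reg s' ''answer'' = (if adapt_SR {1..2 * n} Ac R M1 Q P k then 1 else 0)"
  have X: "1 \<le> ?X" by simp
  have reg0: "reg s ''n'' = int n" "reg s ''k'' = k" "reg s ''q'' = int (length qs)" "reg s ''N'' = 0"
    "reg s ''answer'' = 0" unfolding s initial_machine_def by simp_all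
  have arr0: "arr s ''pref'' = ep.pr" "arr s ''M1'' = matching_array M1" "arr s ''Q'' = pair_matrix Q"
    "arr s ''P'' = pair_matrix P" "arr s ''rk'' = (\<lambda>_ _. 0)" "arr s ''hold'' = (\<lambda>_ _. 0)"
    "arr s ''bit'' = (\<lambda>_ _. 0)" unfolding s initial_machine_def ep.pr_def by simp_all
  have "wp solver s (\<lambda>t s'. t \<le> 20 * (n + 1) + 3500 * (?c * ?X) \<and> ?post s')"
    unfolding solver_def
  proof (rule wp_SeqI[OF wp_double_n[OF reg0(1,4)], where T' = "3400 * (?c * ?X)"])
    fix s1 assume ag1: "agree double_n s s1" and N1: "reg s1 ''N'' = int (2 * n)"
    have reg1: "reg s1 ''N'' = ep.N" "reg s1 ''k'' = k" "reg s1 ''q'' = int (length qs)"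
      "reg s1 ''answer'' = 0"
      using ag1 reg0 N1 unfolding agree_def by (simp_all add: double_n_def ep.N_def)
    have arr1: "arr s1 = arr s"
      using ag1 unfolding agree_def by (simp add: double_n_def fun_eq_iff)
    show "wp (Seq rank_all search) s1 (\<lambda>t s'. t \<le> 3400 * (?c * ?X) \<and> ?post s')"
    proof (rule wp_SeqI[OF ep.wp_rank_all[where mt = "\<lambda>a. matching_array M1 a 0"], where T' = "3000 * (?c * ?X)"])
      show "reg s1 ''N'' = ep.N" "arr s1 ''pref'' = ep.pr" "arr s1 ''rk'' 0 = (\<lambda>_. 0)"
        "\<And>a. arr s1 ''M1'' a 0 = matching_array M1 a 0"
        using reg1 arr1 arr0 by simp_all
    next
      fix s2 assume ag2: "agree rank_all s1 s2"
        and h: "arr s2 ''rk'' 0 = (\<lambda>_. 0) \<and> (\<forall>a\<in>{1..ep.N}. ep.ranked (\<lambda>a. matching_array M1 a 0) s2 a)"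
      have reg2: "reg s2 ''N'' = ep.N" "reg s2 ''k'' = k" "reg s2 ''q'' = int (length qs)"
        "reg s2 ''answer'' = 0"
        using ag2 reg1 unfolding agree_def by (simp_all add: rank_all_def rank_agent_def finish_agent_def)
      have arr2: "arr s2 ''pref'' = ep.pr" "arr s2 ''M1'' = matching_array M1" "arr s2 ''Q'' = pair_matrix Q"
        "arr s2 ''P'' = pair_matrix P" "arr s2 ''hold'' = (\<lambda>_ _. 0)" "arr s2 ''bit'' = (\<lambda>_ _. 0)"
        using ag2 arr1 arr0 unfolding agree_def
        by (simp_all add: rank_all_def rank_agent_def finish_agent_def)
      \<comment> \<open>A rank table exists only from this state on, so the locale is instantiated
        here with the current contents of the array.\<close>
      interpret ei: encoded_instance n Ac R prefs "arr s2 ''rk''" M1 Q P k qs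
      proof
        show "arr s2 ''rk'' a (ep.pr a j) = j" if "a \<in> {1..ep.N}" "j \<in> {1..ep.len a}" for a j
          using h that unfolding ep.ranked_def by blast
        show "arr s2 ''rk'' a 0 = ep.len a + 1" if "a \<in> {1..ep.N}" for a
          using h that unfolding ep.ranked_def by blast
        show "arr s2 ''rk'' 0 a = 0" for a using h by simp
      qed (use inst qs in auto)
      have env: "ei.env s2" unfolding ei.env_def
      proof (intro conjI ballI)
        fix a assume a: "a \<in> {1..ep.N}"
        show "arr s2 ''r1'' a 0 = ei.r a"
          using h a unfolding ep.ranked_def ei.r_def ei.rank_of_def by blast
        show "arr s2 ''M1'' a 0 = ei.mate a" using ei.mate_eq[OF a] arr2 by simp
      qed (use reg2 arr2 ei.pair_matrix_eq in simp_all)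
      have "wp search s2 (\<lambda>t s'. t \<le> 3000 * (2 ^ card ei.F * ?X) \<and>
          reg s' ''answer'' = of_bool (\<exists>f. ei.solution f))"
        by (rule ei.wp_search[OF env]) (use arr2 reg2 in \<open>simp_all add: col_def\<close>)
      then show "wp search s2 (\<lambda>t s'. t \<le> 3000 * (?c * ?X) \<and> ?post s')"
        unfolding ei.card_F ei.adapt_SR_iff ei.solution_def by (elim wp_mono) (simp add: of_bool_def)
    next
      have "1 * ?X \<le> ?c * ?X" by (rule mult_le_mono1) simp
      then show "1 + 200 * ?X + 3000 * (?c * ?X) \<le> 3400 * (?c * ?X)" using X by linarith
    qed
  next
    have "1 * 1 \<le> ?c * ?X" by (rule mult_le_mono) auto
    then show "1 + 20 * (n + 1) + 3400 * (?c * ?X) \<le> 20 * (n + 1) + 3500 * (?c * ?X)" by linarith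
  qed
  moreover have "20 * (n + 1) + 3500 * (?c * ?X) \<le> 50000 * (?c * max 1 n * max 1 ?m)"
  proof -
    \<comment> \<open>\<open>2 * n + 1\<close> is at most three times \<open>max 1 n\<close>, and
      adding one to the number of acceptable pairs at most doubles its maximum with 1; the maxima
      keep the bound meaningful when there are no agents or no acceptable pairs.\<close>
    have "?X \<le> (3 * max 1 n) * (2 * max 1 ?m)" by (rule mult_le_mono) (auto simp: ep.N_def)
    then have "?c * ?X \<le> ?c * ((3 * max 1 n) * (2 * max 1 ?m))" by (rule mult_le_mono2)
    moreover have "?c * ((3 * max 1 n) * (2 * max 1 ?m)) = 6 * (?c * max 1 n * max 1 ?m)" by simp
    moreover have "1 * max 1 n * 1 \<le> ?c * max 1 n * max 1 ?m" by (intro mult_le_mono) auto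
    then have "n \<le> ?c * max 1 n * max 1 ?m" "1 \<le> ?c * max 1 n * max 1 ?m" by auto
    moreover have "20 * (n + 1) + 3500 * x \<le> 50000 * y" if "x \<le> z" "z = 6 * y" "n \<le> y" "1 \<le> y"
      for x y z :: nat using that by simp
    ultimately show ?thesis by blast
  qed
  ultimately show ?thesis by (elim wp_mono) auto
qed

theorem theorem2:
  shows "\<exists>(prog :: com) (C :: nat).
    \<forall>(n :: nat) (Ac :: nat \<Rightarrow> nat set) (R :: nat \<Rightarrow> (nat \<times> nat) set)
      (M1 :: nat set set) (Q :: nat set set) (P :: nat set set) (k :: int) (s :: machine).
      adapt_SR_instance {1..2 * n} Ac R M1 Q P \<longrightarrow>
      encodes s n Ac R M1 Q P k \<longrightarrow>
      (\<exists>t s'. exec prog s t s' \<and>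
         t \<le> C * (2 ^ card (P \<inter> M1) * max 1 n * max 1 (card (acceptable_pairs {1..2 * n} Ac))) \<and>
         reg s' ''answer'' = (if adapt_SR {1..2 * n} Ac R M1 Q P k then 1 else 0))"
  using solver_correct unfolding wp_def by blast

end
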